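(* Let $n_1<n_2$ be integers, $m_1,m_2\in\mathbb{N}^*$, $m=m_1+m_2$, $C_1\in\mathrm{GL}_{m_1}(\mathbb{C})$, $C_2\in\mathrm{GL}_{m_2}(\mathbb{C})$, let $U_{1,2}$ be an $m_1\times m_2$ matrix with coefficients in $\sum_{\nu=n_1}^{n_2-1}\mathbb{C}z^\nu$, and let $$D:=\begin{pmatrix}z^{n_1}C_1&U_{1,2}\\0&z^{n_2}C_2\end{pmatrix}.$$ Let $\hat H=\begin{pmatrix}\mathrm{Id}&\hat H_{1,2}\\0&\mathrm{Id}\end{pmatrix}\in\mathrm{GL}_m(\mathbb{C}[[z]])$ be the unique formal gauge transformation of this form satisfying $D=\sigma_q(\hat H)\,\mathrm{Diag}(z^{n_1}C_1,z^{n_2}C_2)\,\hat H^{-1}$. Let $$\Sigma:=\left\{\lambda\in\mathbb{C}^*/q^{(n_2-n_1)^{-1}\mathbb{Z}}\ \middle|\ \exists\,\alpha_1\in\mathrm{Sp}(C_1),\ \alpha_2\in\mathrm{Sp}(C_2):\ \lambda^{n_2-n_1}q^{-\frac{n_2-n_1-1}{2}}q^{\mathbb{Z}}=\frac{\alpha_1}{\alpha_2}q^{\mathbb{Z}}\right\}.$$ Let $\lambda\in(\mathbb{C}^*/q^{(n_2-n_1)^{-1}\mathbb{Z}})\setminus\Sigma$. Then the entries of $\hat{\mathcal B}_{n_2-n_1}(\hat H_{1,2})$ belong to $\mathbb{H}^{[\lambda]}_{n_2-n_1,n_2-n_1}$ and $$S_q^{[\lambda]}(\hat H)=\hat H^{[\lambda]}:=\begin{pmatrix}\mathrm{Id}&\hat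 H^{[\lambda]}_{1,2}\\0&\mathrm{Id}\end{pmatrix}.$$
   Context: Here $q\in\mathbb{C}$ is fixed with $|q|>1$, $\mathbb{N}^*$ is the set of positive integers. A logarithm $\log(q)$ is fixed and $q^\alpha:=e^{\alpha\log q}$. $\sigma_q$ sends $y(z)$ to $y(qz)$ (entrywise on matrices). For $K\in\mathbb{N}^*$, $q^{K^{-1}\mathbb{Z}}=\{q^{\ell}:\ell\in K^{-1}\mathbb{Z}\}$. $\mathrm{Sp}$ denotes the spectrum. For $p\in\mathbb{C}$, $|p|>1$, $\Theta_p(z):=\sum_{\ell\in\mathbb{Z}}p^{-\ell(\ell+1)/2}z^\ell$. $\mathcal{M}(\mathbb{C}^* )$ is the field of meromorphic functions on $\mathbb{C}^*$ and $\mathcal{M}(\mathbb{C}^*,0)$ is the field of functions meromorphic on some punctured neighborhood of $0$ in $\mathbb{C}^*$; functions with the same analytic continuation are identified, and a convergent power series is viewed as an element of $\mathcal{M}(\mathbb{C}^*,0)$. The matrix $\hat H^{[\lambda]}$ (known to exist and to be unique, for $\lambda\notin\Sigma$, by a theorem of Ramis–Sauloy–Zhang): it is the unique matrix of the form $\begin{pmatrix}\mathrm{Id}&\hat H^{[\lambda]}_{1,2}\\0&\mathrm{Id}\end{pmatrix}\in\mathrm{GL}_m(\mathcal{M}(\mathbb{C}^* ))$ satisfying $D\hat H^{[\lambda]}=\sigma_q(\hat H^{[\lambda]})\,\mathrm{Diag}(z^{n_1}C_1,z^{n_2}C_2)$ such that, for $|z|$ close to $0$, the entries of $\hat H^{[\lambda]}_{1,2}$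 have (at most) simple poles, contained in $-\lambda q^{(n_2-n_1)^{-1}\mathbb{Z}}$. $q$-Borel transformation of order $\mu\in\mathbb{Q}_{>0}$ (applied entrywise): $\hat{\mathcal B}_\mu:\mathbb{C}[[z]]\to\mathbb{C}[[\zeta]]$, $\sum_{\ell\ge0} a_\ell z^\ell\mapsto\sum_{\ell\ge0} a_\ell q^{-\ell(\ell-1)/(2\mu)}\zeta^\ell$. Let $(\mu,K)\in\mathbb{Q}_{>0}\times\mathbb{N}^*$ with $K\in\mu\mathbb{N}^*$ and $\lambda\in\mathbb{C}^*/q^{K^{-1}\mathbb{Z}}$. $\mathbb{H}^{[\lambda]}_{\mu,K}$ is the set of $f\in\mathcal{M}(\mathbb{C}^*,0)$ for which there exist $\varepsilon>0$ and a connected domain $\Omega\subset\mathbb{C}$ with $\bigcup_{\ell\in K^{-1}\mathbb{Z}}\{z\in\mathbb{C}^*:|z-\lambda q^\ell|<\varepsilon|q^\ell\lambda|\}\subset\Omega$ such that $f$ can be continued to an analytic function on $\Omega$ satisfying, for some $L,M>0$, $|f(z)|<L\,|\Theta_{|q|^{1/\mu}}(M|z|)|$ for all $z\in\Omega$. The $q$-Laplace transformation is $\mathcal{L}^{[\lambda]}_{\mu,K}:\mathbb{H}^{[\lambda]}_{\mu,K}\to\mathcal{M}(\mathbb{C}^*,0)$, $\mathcal{L}^{[\lambda]}_{\mu,K}(f)(z)=\frac{\mu}{K}\sum_{\ell\in K^{-1}\mathbb{Z}}\frac{f(q^\ell\lambda)}{\Theta_{q^{1/\mu}}(q^{1/\mu+\ell}\lambda/z)}$.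 $q$-Borel–Laplace sum: here the only order involved is $n_2-n_1$, and $S_q^{[\lambda]}(\hat H):=\begin{pmatrix}\mathrm{Id}&S_q^{[\lambda]}(\hat H_{1,2})\\0&\mathrm{Id}\end{pmatrix}$ with $S_q^{[\lambda]}(\hat H_{1,2}):=\mathcal{L}^{[\lambda]}_{n_2-n_1,n_2-n_1}\circ\hat{\mathcal B}_{n_2-n_1}(\hat H_{1,2})$, entrywise. *)

theory Defs
  imports
    "HOL-Complex_Analysis.Complex_Analysis"
    "Jordan_Normal_Form.Matrix"
    "Jordan_Normal_Form.Spectral_Radius"
begin

(* Conventions.
   - The parameter lq is the chosen logarithm of q, so q = exp lq and q^a = qpow lq a.
   - A class in (C - {0}) / q^(K^{-1} Z) is given by a nonzero representative lam; every notion below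
     depends on its class only.
   - The general definitions are meant for mu > 0, K > 0 and K a multiple of mu.
   - Formal objects are matrices over complex fps / complex fls; an analytic matrix is a function
     complex => complex mat.
   - Elements of M(C - {0}) and M(C - {0}, 0) are represented by functions.  Two representatives of the
     same element agree off a set without accumulation points in the domain, which is what the
     library quantifier for cosparse sets expresses. *)

definition qpow :: "complex \<Rightarrow> complex \<Rightarrow> complex" where
  "qpow lq a = exp (a * lq)"

definition inv_ints :: "nat \<Rightarrow> complex set" where
  "inv_ints K = range (\<lambda>k::int. of_int k / of_nat K)"

(* The exponent l(l+1)/2 is an integer, so the division is exact. *)
definition Theta :: "complex \<Rightarrow> complex \<Rightarrow> complex" where
  "Theta p z = (\<Sum>\<^sub>\<infinity>l\<in>(UNIV::int set). p powi (- (l * (l + 1) div 2)) * z powi l)"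


section \<open>The q-Borel and q-Laplace transformations\<close>

definition q_borel :: "complex \<Rightarrow> rat \<Rightarrow> complex fps \<Rightarrow> complex fps" where
  "q_borel lq mu f =
     Abs_fps (\<lambda>l. fps_nth f l * qpow lq (- (of_nat l * (of_nat l - 1)) / (2 * of_rat mu)))"

definition meromorphic_near_0 :: "(complex \<Rightarrow> complex) \<Rightarrow> bool" where
  "meromorphic_near_0 f \<longleftrightarrow> (\<exists>r>0. f meromorphic_on (ball 0 r - {0}))"

(* g is an analytic continuation of the germ f to a domain Omega as required of the members of
   the space H.  Theta is not defined at 0 (it tends to infinity there), so the growth condition
   is void at 0, should 0 belong to Omega. *)
definition qH_continuation ::
    "complex \<Rightarrow> rat \<Rightarrow> nat \<Rightarrow> complex \<Rightarrow> (complex \<Rightarrow> complex) \<Rightarrow> (complex \<Rightarrow> complex) \<Rightarrow> bool" where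
  "qH_continuation lq mu K lam f g \<longleftrightarrow>
     (\<exists>\<epsilon>>0. \<exists>\<Omega>. open \<Omega> \<and> connected \<Omega> \<and>
        (\<Union>l\<in>inv_ints K. {z. z \<noteq> 0 \<and> cmod (z - lam * qpow lq l) < \<epsilon> * cmod (qpow lq l * lam)}) \<subseteq> \<Omega> \<and>
        g holomorphic_on \<Omega> \<and>
        (\<exists>r>0. \<forall>\<^sub>\<approx>z\<in>\<Omega> \<inter> (ball 0 r - {0}). g z = f z) \<and>
        (\<exists>L>0. \<exists>M>0. \<forall>z\<in>\<Omega> - {0}.
           cmod (g z) <
             L * cmod (Theta (of_real (cmod (exp lq) powr (1 / of_rat mu))) (of_real (M * cmod z)))))"

definition qH :: "complex \<Rightarrow> rat \<Rightarrow> nat \<Rightarrow> complex \<Rightarrow> (complex \<Rightarrow> complex) set" where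
  "qH lq mu K lam = {f. meromorphic_near_0 f \<and> (\<exists>g. qH_continuation lq mu K lam f g)}"

(* The values at the points q^l lam are those of the analytic continuation of f. *)
definition q_laplace ::
    "complex \<Rightarrow> rat \<Rightarrow> nat \<Rightarrow> complex \<Rightarrow> (complex \<Rightarrow> complex) \<Rightarrow> complex \<Rightarrow> complex" where
  "q_laplace lq mu K lam f z =
     (let g = (SOME g. qH_continuation lq mu K lam f g) in
      of_rat mu / of_nat K *
      (\<Sum>\<^sub>\<infinity>l\<in>inv_ints K.
         g (qpow lq l * lam) /
         Theta (qpow lq (1 / of_rat mu)) (qpow lq (1 / of_rat mu + l) * lam / z)))"


section \<open>The q-difference system with two slopes\<close>

definition unip_mat :: "nat \<Rightarrow> nat \<Rightarrow> 'a :: {zero,one} mat \<Rightarrow> 'a mat" where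
  "unip_mat m1 m2 X = four_block_mat (1\<^sub>m m1) X (0\<^sub>m m2 m1) (1\<^sub>m m2)"

definition zpow_mat :: "int \<Rightarrow> complex mat \<Rightarrow> complex fls mat" where
  "zpow_mat n C = fls_X_intpow n \<cdot>\<^sub>m map_mat fls_const C"

definition D_mat ::
    "int \<Rightarrow> int \<Rightarrow> complex mat \<Rightarrow> complex mat \<Rightarrow> complex fls mat \<Rightarrow> complex fls mat" where
  "D_mat n1 n2 C1 C2 U =
     four_block_mat (zpow_mat n1 C1) U (0\<^sub>m (dim_row C2) (dim_col C1)) (zpow_mat n2 C2)"

definition Diag_mat :: "int \<Rightarrow> int \<Rightarrow> complex mat \<Rightarrow> complex mat \<Rightarrow> complex fls mat" where
  "Diag_mat n1 n2 C1 C2 =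
     four_block_mat (zpow_mat n1 C1) (0\<^sub>m (dim_row C1) (dim_col C2))
       (0\<^sub>m (dim_row C2) (dim_col C1)) (zpow_mat n2 C2)"

definition eval_mat :: "complex fls mat \<Rightarrow> complex \<Rightarrow> complex mat" where
  "eval_mat A z = map_mat (\<lambda>f. eval_fls f z) A"

definition sigma_q_fps :: "complex \<Rightarrow> complex fps \<Rightarrow> complex fps" where
  "sigma_q_fps q f = fps_compose f (fps_const q * fps_X)"

(* D = sigma_q(H) Diag H^{-1}, where G is the inverse of H in GL_m(C[[z]]). *)
definition formal_gauge ::
    "complex \<Rightarrow> complex fls mat \<Rightarrow> complex fls mat \<Rightarrow> complex fps mat \<Rightarrow> bool" where
  "formal_gauge q D \<Delta> H \<longleftrightarrow>
     (\<exists>G. inverts_mat H G \<and> inverts_mat G H \<and>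
        D = map_mat fps_to_fls (map_mat (sigma_q_fps q) H) * \<Delta> * map_mat fps_to_fls G)"

definition Sigma_set :: "complex \<Rightarrow> int \<Rightarrow> int \<Rightarrow> complex mat \<Rightarrow> complex mat \<Rightarrow> complex set" where
  "Sigma_set lq n1 n2 C1 C2 =
     {lam. lam \<noteq> 0 \<and>
        (\<exists>\<alpha>1\<in>spectrum C1. \<exists>\<alpha>2\<in>spectrum C2.
           range (\<lambda>k::int. lam powi (n2 - n1) * qpow lq (- (of_int (n2 - n1) - 1) / 2) * exp lq powi k)
           = range (\<lambda>k::int. \<alpha>1 / \<alpha>2 * exp lq powi k))}"

(* The characterization of the meromorphic gauge transformation H^[lam].  An element of M(C - {0})
   is represented by the function which is continuous off the poles and 0 at the poles
   (nicely meromorphic) and, as a matter of convention, 0 at the origin; so uniqueness in M(C - {0})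
   is uniqueness of the function.  A block unipotent matrix is automatically in GL_m(M(C - {0})). *)
definition is_H_lam ::
    "complex \<Rightarrow> int \<Rightarrow> int \<Rightarrow> nat \<Rightarrow> nat \<Rightarrow> complex mat \<Rightarrow> complex mat \<Rightarrow> complex fls mat \<Rightarrow> complex
      \<Rightarrow> (complex \<Rightarrow> complex mat) \<Rightarrow> bool" where
  "is_H_lam lq n1 n2 m1 m2 C1 C2 U lam H \<longleftrightarrow>
     (\<exists>X. (\<forall>z. X z \<in> carrier_mat m1 m2) \<and> H = (\<lambda>z. unip_mat m1 m2 (X z)) \<and>
        X 0 = 0\<^sub>m m1 m2 \<and>
        (\<forall>i<m1. \<forall>j<m2. (\<lambda>z. X z $$ (i, j)) nicely_meromorphic_on (- {0})) \<and>
        (\<forall>\<^sub>\<approx>z\<in>- {0}. eval_mat (D_mat n1 n2 C1 C2 U) z * H z =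
                        H (exp lq * z) * eval_mat (Diag_mat n1 n2 C1 C2) z) \<and>
        (\<forall>i<m1. \<forall>j<m2. \<exists>r>0. \<forall>z\<in>ball 0 r - {0}.
           is_pole (\<lambda>w. X w $$ (i, j)) z \<longrightarrow>
             zorder (\<lambda>w. X w $$ (i, j)) z = -1 \<and>
             z \<in> (\<lambda>l. - lam * qpow lq l) ` inv_ints (nat (n2 - n1))))"

definition H_lam ::
    "complex \<Rightarrow> int \<Rightarrow> int \<Rightarrow> nat \<Rightarrow> nat \<Rightarrow> complex mat \<Rightarrow> complex mat \<Rightarrow> complex fls mat \<Rightarrow> complex
      \<Rightarrow> complex \<Rightarrow> complex mat" where
  "H_lam lq n1 n2 m1 m2 C1 C2 U lam = (THE H. is_H_lam lq n1 n2 m1 m2 C1 C2 U lam H)"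

definition S_q ::
    "complex \<Rightarrow> int \<Rightarrow> int \<Rightarrow> nat \<Rightarrow> nat \<Rightarrow> complex \<Rightarrow> complex fps mat \<Rightarrow> complex \<Rightarrow> complex mat" where
  "S_q lq n1 n2 m1 m2 lam X z =
     unip_mat m1 m2
       (map_mat (\<lambda>f. q_laplace lq (of_int (n2 - n1)) (nat (n2 - n1)) lam
                       (eval_fps (q_borel lq (of_int (n2 - n1)) f)) z) X)"

end

theory Submission
  imports Defs
begin

text \<open>
  Write \<open>n = n2 - n1\<close>, \<open>p = q\<^sup>1\<^sup>/\<^sup>n\<close> and \<open>\<Theta> = Theta p\<close>, and work with the upper right block \<open>X\<close> of a
  unipotent matrix. For it the gauge equation reads \<open>C1 X(z) + U(z) z^(-n1) = z^n X(qz) C2\<close>; its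
  formal version is the recursion \<open>C1 X_l = q^(l-n) X_(l-n) C2\<close> for \<open>l \<ge> n\<close>, with prescribed right hand
  sides for \<open>l < n\<close>.

  \<^emph>\<open>The Borel transform is rational.\<close> The weight \<open>p^(-l(l-1)/2)\<close> is quadratic in the exponent, so
  replacing \<open>l\<close> by \<open>l - n\<close> changes it by a factor that turns \<open>q^(l-n)\<close> into the constant
  \<open>s = p^(-n(n-1)/2)\<close>. Hence the transform \<open>F\<close> solves the algebraic equation
  \<open>C1 F(\<zeta>) + W(\<zeta>) = s \<zeta>^n F(\<zeta>) C2\<close> with a polynomial \<open>W\<close> of degree less than \<open>n\<close>. After
  triangularisation of \<open>C1\<close> and \<open>C2\<close> it is solved entry by entry, dividing by \<open>\<alpha>1 - s \<alpha>2 \<zeta>^n\<close>. So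
  \<open>F\<close> is holomorphic off finitely many points and bounded off small discs around them, and these
  points lie off \<open>\<lambda> p^Z\<close> exactly because \<open>\<lambda>\<close> is not in the exceptional set
  (\<open>borel_continuation\<close>, \<open>not_Sigma_imp_nonresonant\<close>). The growth condition is then trivial, as the
  theta function with a base greater than \<open>1\<close> is at least \<open>1\<close> on the positive reals.

  \<^emph>\<open>The Laplace sum is a quotient.\<close> By \<open>\<Theta>(p^k w) = p^(k(k-1)/2) w^k \<Theta>(w)\<close> and
  \<open>\<Theta>(1/w) = w \<Theta>(w)\<close> all denominators of the Laplace sum are multiples of the single function
  \<open>\<Theta>(z/\<lambda>)\<close>. The sum is \<open>J(z/\<lambda>) / \<Theta>(z/\<lambda>)\<close>, where \<open>J(w)\<close> is the sum of
  \<open>F(\<lambda> p^k) p^(-k(k+1)/2) w^k\<close> over all integers \<open>k\<close> (\<open>laplace_sum\<close>). The algebraic equation for \<open>F\<close> at the points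
  \<open>\<lambda> p^k\<close> is, term by term, a \<open>q\<close>-difference equation for \<open>J\<close>, and dividing by \<open>\<Theta>(z/\<lambda>)\<close> yields the
  gauge equation (\<open>theta_quotient_equation\<close>). The zeros of \<open>\<Theta>\<close> are simple and form \<open>-p^Z\<close>
  (\<open>Theta_eq_0_iff\<close>, \<open>Theta_simple_zero\<close>), so the quotient has at most simple poles, all in \<open>-\<lambda> p^Z\<close>.

  \<^emph>\<open>Uniqueness.\<close> Multiplied by \<open>\<Theta>(z/\<lambda>)\<close>, the difference of two solutions becomes a matrix \<open>G\<close>
  that is holomorphic in a punctured disc and satisfies \<open>G(qz) C2 = c C1 G(z)\<close> for a constant \<open>c\<close>.
  Triangularising again, it remains to see that a scalar solution of \<open>g(qz) = \<beta> g(z)\<close> vanishes if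
  \<open>\<beta>\<close> is no power of \<open>q\<close>: the equation controls \<open>g\<close> near \<open>0\<close> by its values on an annulus, so
  \<open>z^N g(z)\<close> extends to \<open>0\<close> for large \<open>N\<close>, and its Taylor coefficients vanish
  (\<open>contraction_eigenfunction_eq_0\<close>, \<open>simple_pole_solution_unique\<close>).
\<close>

section \<open>Theta series and their functional equations\<close>

definition tri :: "int \<Rightarrow> int" where "tri k = k * (k + 1) div 2"

lemma two_tri: "2 * tri k = k * (k + 1)"
  unfolding tri_def by simp

lemma tri_reflect: "tri (- k - 1) = tri k"
  using two_tri[of k] two_tri[of "- k - 1"] by (simp add: algebra_simps)

lemma tri_step: "tri (k + 1) = tri k + (k + 1)"
  using two_tri[of k] two_tri[of "k + 1"] by (simp add: algebra_simps)

lemma tri_pred: "tri (k - 1) = tri k - k"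
  using tri_step[of "k - 1"] by simp

lemma tri_add: "tri (k + l) = tri k + k * l + tri l"
  using two_tri[of k] two_tri[of l] two_tri[of "k + l"] by (simp add: algebra_simps)

text \<open>
  The ratio of consecutive terms is \<open>r / R ^ (m + 1)\<close>, which tends to \<open>0\<close>.
\<close>
lemma summable_gaussian:
  fixes R r :: real
  assumes "R > 1" "r \<ge> 0"
  shows "summable (\<lambda>m::nat. R powi (- tri (int m)) * r ^ m)"
proof -
  have "(\<lambda>m. r / R ^ Suc m) \<longlonglongrightarrow> 0"
    using assms LIMSEQ_divide_realpow_zero[of R r] by (subst filterlim_sequentially_Suc) auto
  then have "eventually (\<lambda>m. r / R ^ Suc m < 1/2) sequentially"
    by (rule order_tendstoD) auto
  then obtain N where N: "\<And>m. m \<ge> N \<Longrightarrow> r / R ^ Suc m < 1/2"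
    by (auto simp: eventually_sequentially)
  show ?thesis
  proof (rule summable_ratio_test[of "1/2" N])
    fix m assume m: "m \<ge> N"
    have "R powi (- tri (int (Suc m))) * r ^ Suc m = R powi (- tri (int m)) * r ^ m * (r / R ^ Suc m)"
      using assms tri_step[of "int m"]
      by (simp add: power_int_diff power_int_minus power_int_add field_simps)
    also have "\<dots> \<le> R powi (- tri (int m)) * r ^ m * (1/2)"
      using assms N[OF m] by (intro mult_left_mono) auto
    finally show "norm (R powi (- tri (int (Suc m))) * r ^ Suc m) \<le> 1/2 * norm (R powi (- tri (int m)) * r ^ m)"
      using assms by simp
  qed auto
qed

text \<open>
  The involution \<open>k \<mapsto> - k - 1\<close> exchanges the two halves of the integers and preserves
  \<^term>\<open>tri\<close>, so both halves of a theta series become power series with the same weights.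
\<close>
lemma has_sum_int_halves:
  fixes f :: "int \<Rightarrow> 'a :: topological_comm_monoid_add"
  assumes "((\<lambda>m. f (int m)) has_sum A) UNIV" "((\<lambda>m. f (- int m - 1)) has_sum B) UNIV"
  shows "(f has_sum (A + B)) UNIV"
proof -
  have 1: "(f has_sum A) (range int)"
    using assms(1) by (subst has_sum_reindex) (auto simp: o_def)
  have "inj (\<lambda>m. - int m - 1)"
    by (auto simp: inj_def)
  then have 2: "(f has_sum B) (range (\<lambda>m. - int m - 1))"
    using assms(2) by (subst has_sum_reindex) (auto simp: o_def)
  have disj: "range int \<inter> range (\<lambda>m. - int m - 1) = {}"
    by auto
  have "range int \<union> range (\<lambda>m. - int m - 1) = UNIV"
  proof -
    have "k \<in> range int \<union> range (\<lambda>m. - int m - 1)" for k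
    proof (cases "k \<ge> 0")
      case True then show ?thesis by (metis UnI1 nonneg_int_cases rangeI)
    next
      case False
      then have "k = - int (nat (- k - 1)) - 1" by simp
      then show ?thesis by blast
    qed
    then show ?thesis by blast
  qed
  with has_sum_Un_disjoint[OF 1 2 disj] show ?thesis by simp
qed

text \<open>
  The numerators of the Laplace sums and, for constant \<open>a = 1\<close>, the theta function itself.
\<close>
definition gauss_series :: "complex \<Rightarrow> (int \<Rightarrow> complex) \<Rightarrow> complex \<Rightarrow> complex" where
  "gauss_series p a w = (\<Sum>\<^sub>\<infinity>k\<in>UNIV. a k * p powi (- tri k) * w powi k)"

definition gauss_fps :: "complex \<Rightarrow> (nat \<Rightarrow> complex) \<Rightarrow> complex fps" where
  "gauss_fps p b = Abs_fps (\<lambda>m. b m * p powi (- tri (int m)))"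

lemma Theta_conv_gauss_series: "Theta p w = gauss_series p (\<lambda>_. 1) w"
  by (simp add: Theta_def gauss_series_def tri_def)

lemma gauss_fps_summable:
  assumes "1 < cmod p" "\<And>m. cmod (b m) \<le> B"
  shows "summable (\<lambda>m. norm (fps_nth (gauss_fps p b) m * z ^ m))"
proof (rule summable_comparison_test')
  show "summable (\<lambda>m::nat. B * (cmod p powi (- tri (int m)) * cmod z ^ m))"
    by (intro summable_mult summable_gaussian assms) auto
  show "norm (norm (fps_nth (gauss_fps p b) n * z ^ n)) \<le> B * (cmod p powi (- tri (int n)) * cmod z ^ n)"
    if "n \<ge> 0" for n
    using assms(2)[of n]
    by (auto simp: gauss_fps_def norm_mult norm_power norm_power_int mult.assoc intro!: mult_right_mono)
qed

lemma gauss_fps_conv_radius: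
  assumes "1 < cmod p" "\<And>m. cmod (b m) \<le> B"
  shows "fps_conv_radius (gauss_fps p b) = \<infinity>"
  unfolding fps_conv_radius_def
  by (intro conv_radius_inftyI'' summable_norm_cancel[OF gauss_fps_summable[OF assms]])

lemma
  assumes "1 < cmod p" "bounded (range a)" "w \<noteq> 0"
  shows gauss_series_has_sum:
      "((\<lambda>k. a k * p powi (- tri k) * w powi k) has_sum gauss_series p a w) UNIV"
    and gauss_series_conv_fps:
      "gauss_series p a w = eval_fps (gauss_fps p (\<lambda>m. a (int m))) w +
         eval_fps (gauss_fps p (\<lambda>m. a (- int m - 1))) (1 / w) / w"
proof -
  obtain B where B: "\<And>k. cmod (a k) \<le> B"
    using assms(2) by (auto simp: bounded_iff)
  have sums: "((\<lambda>m. fps_nth (gauss_fps p b) m * z ^ m) has_sum eval_fps (gauss_fps p b) z) UNIV"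
    if "\<And>m. cmod (b m) \<le> B" for b z
  proof (rule norm_summable_imp_has_sum)
    show *: "summable (\<lambda>n. cmod (fps_nth (gauss_fps p b) n * z ^ n))"
      by (rule gauss_fps_summable) (use assms that in auto)
    show "(\<lambda>m. fps_nth (gauss_fps p b) m * z ^ m) sums eval_fps (gauss_fps p b) z"
      unfolding eval_fps_def by (rule summable_sums[OF summable_norm_cancel[OF *]])
  qed
  have 1: "((\<lambda>m. a (int m) * p powi (- tri (int m)) * w powi (int m)) has_sum
      eval_fps (gauss_fps p (\<lambda>m. a (int m))) w) UNIV"
    using sums[of "\<lambda>m. a (int m)" w] B by (simp add: gauss_fps_def)
  have "((\<lambda>m. fps_nth (gauss_fps p (\<lambda>m. a (- int m - 1))) m * (1/w) ^ m * (1 / w)) has_sum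
      eval_fps (gauss_fps p (\<lambda>m. a (- int m - 1))) (1/w) * (1 / w)) UNIV"
    by (rule has_sum_cmult_left[OF sums]) (use B in auto)
  moreover have "fps_nth (gauss_fps p (\<lambda>m. a (- int m - 1))) m * (1/w) ^ m * (1 / w) =
      a (- int m - 1) * p powi (- tri (- int m - 1)) * w powi (- int m - 1)" for m
    using assms(3) unfolding tri_reflect
    by (simp add: gauss_fps_def power_int_diff power_int_minus field_simps)
  ultimately have 2: "((\<lambda>m. a (- int m - 1) * p powi (- tri (- int m - 1)) * w powi (- int m - 1)) has_sum
      eval_fps (gauss_fps p (\<lambda>m. a (- int m - 1))) (1/w) * (1 / w)) UNIV"
    by simp
  have 3: "((\<lambda>k. a k * p powi (- tri k) * w powi k) has_sum
      eval_fps (gauss_fps p (\<lambda>m. a (int m))) w +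
         eval_fps (gauss_fps p (\<lambda>m. a (- int m - 1))) (1 / w) / w) UNIV"
    using has_sum_int_halves[OF 1 2] by simp
  show eq: "gauss_series p a w = eval_fps (gauss_fps p (\<lambda>m. a (int m))) w +
         eval_fps (gauss_fps p (\<lambda>m. a (- int m - 1))) (1 / w) / w"
    unfolding gauss_series_def using 3 by (rule infsumI)
  show "((\<lambda>k. a k * p powi (- tri k) * w powi k) has_sum gauss_series p a w) UNIV"
    using 3 unfolding eq .
qed

lemma gauss_series_holomorphic:
  assumes "1 < cmod p" "bounded (range a)"
  shows "gauss_series p a holomorphic_on - {0}"
proof -
  obtain B where B: "\<And>k. cmod (a k) \<le> B"
    using assms(2) by (auto simp: bounded_iff)
  have R: "fps_conv_radius (gauss_fps p (\<lambda>m. a (int m))) = \<infinity>"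
     "fps_conv_radius (gauss_fps p (\<lambda>m. a (- int m - 1))) = \<infinity>"
    by (rule gauss_fps_conv_radius, use assms B in auto)+
  have "(eval_fps (gauss_fps p (\<lambda>m. a (- int m - 1))) \<circ> (\<lambda>w. 1 / w)) holomorphic_on - {0}"
    by (rule holomorphic_on_compose_gen[OF _ holomorphic_on_eval_fps[OF subset_refl]])
       (auto intro!: holomorphic_intros simp: R)
  then have "(\<lambda>w. eval_fps (gauss_fps p (\<lambda>m. a (int m))) w +
         eval_fps (gauss_fps p (\<lambda>m. a (- int m - 1))) (1 / w) / w) holomorphic_on - {0}"
    by (intro holomorphic_intros) (auto simp: R o_def)
  then show ?thesis
    by (rule holomorphic_transform) (use gauss_series_conv_fps[OF assms] in auto)
qed

lemma Theta_has_sum: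
  assumes "1 < cmod p" "w \<noteq> 0"
  shows "((\<lambda>k. p powi (- tri k) * w powi k) has_sum Theta p w) UNIV"
  using gauss_series_has_sum[of p "\<lambda>_. 1" w] assms by (simp add: Theta_conv_gauss_series)

lemma Theta_holomorphic: "1 < cmod p \<Longrightarrow> Theta p holomorphic_on - {0}"
  using gauss_series_holomorphic[of p "\<lambda>_. 1"] by (simp add: Theta_conv_gauss_series[abs_def])

text \<open>
  Both functional equations come from reindexing the series: by \<open>k \<mapsto> k + 1\<close> here and by
  \<open>k \<mapsto> - k - 1\<close> in the next lemma.
\<close>
lemma Theta_mult_base:
  assumes "1 < cmod p" "w \<noteq> 0"
  shows "Theta p (p * w) = w * Theta p w"
proof -
  have p0: "p \<noteq> 0" using assms by auto
  have "((\<lambda>k. w * (p powi (- tri k) * w powi k)) has_sum w * Theta p w) UNIV"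
    by (rule has_sum_cmult_right[OF Theta_has_sum[OF assms]])
  moreover have "w * (p powi (- tri k) * w powi k) =
      ((\<lambda>k. p powi (- tri k) * (p * w) powi k) \<circ> (\<lambda>k. k + 1)) k" for k
    using p0 assms(2) unfolding o_def tri_step
    by (simp add: power_int_add power_int_diff power_int_mult_distrib power_int_minus field_simps)
  ultimately have "((\<lambda>k. p powi (- tri k) * (p * w) powi k) \<circ> (\<lambda>k. k + 1) has_sum w * Theta p w) UNIV"
    by (simp add: o_def)
  moreover have "inj (\<lambda>k::int. k + 1)" by simp
  moreover have "range (\<lambda>k::int. k + 1) = UNIV" by (metis surj_plus_right)
  ultimately have "((\<lambda>k. p powi (- tri k) * (p * w) powi k) has_sum w * Theta p w) UNIV"
    using has_sum_reindex[of "\<lambda>k::int. k + 1" UNIV "\<lambda>k. p powi (- tri k) * (p * w) powi k"] by simp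
  with Theta_has_sum[OF assms(1), of "p * w"] p0 assms(2) show ?thesis
    by (simp add: has_sum_unique)
qed

lemma Theta_inverse:
  assumes "1 < cmod p" "w \<noteq> 0"
  shows "Theta p (1 / w) = w * Theta p w"
proof -
  have p0: "p \<noteq> 0" using assms by auto
  have "((\<lambda>k. w * (p powi (- tri k) * w powi k)) has_sum w * Theta p w) UNIV"
    by (rule has_sum_cmult_right[OF Theta_has_sum[OF assms]])
  moreover have "w * (p powi (- tri k) * w powi k) =
      ((\<lambda>k. p powi (- tri k) * (1 / w) powi k) \<circ> (\<lambda>k. - k - 1)) k" for k
    using p0 assms(2) unfolding o_def tri_reflect
    by (simp add: power_int_diff power_int_minus power_int_divide_distrib field_simps)
  ultimately have "((\<lambda>k. p powi (- tri k) * (1 / w) powi k) \<circ> (\<lambda>k. - k - 1) has_sum w * Theta p w) UNIV"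
    by (simp add: o_def)
  moreover have "inj (\<lambda>k::int. - k - 1)" by (simp add: inj_def)
  moreover have "range (\<lambda>k::int. - k - 1) = UNIV"
    by (rule surjI[of _ "\<lambda>k. - k - 1"]) simp
  ultimately have "((\<lambda>k. p powi (- tri k) * (1 / w) powi k) has_sum w * Theta p w) UNIV"
    using has_sum_reindex[of "\<lambda>k::int. - k - 1" UNIV "\<lambda>k. p powi (- tri k) * (1 / w) powi k"] by simp
  with Theta_has_sum[OF assms(1), of "1 / w"] p0 assms(2) show ?thesis
    by (simp add: has_sum_unique)
qed

text \<open>
  Stated for an arbitrary \<open>f\<close> because the theta series and its product representation both satisfy
  the hypothesis.
\<close>
lemma quasi_periodic_powi:
  fixes f :: "complex \<Rightarrow> complex"
  assumes "p \<noteq> 0" "w \<noteq> 0" and "\<And>w. w \<noteq> 0 \<Longrightarrow> f (p * w) = w * f w"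
  shows "f (p powi k * w) = p powi tri (k - 1) * w powi k * f w"
proof (induction k rule: int_induct[where k = 0])
  case base
  show ?case by (simp add: tri_def)
next
  case (step1 i)
  have "f (p powi (i + 1) * w) = f (p * (p powi i * w))"
    using assms by (simp add: power_int_add mult_ac)
  also have "\<dots> = p powi i * w * (p powi tri (i - 1) * w powi i * f w)"
    using assms step1 by simp
  also have "\<dots> = p powi tri (i + 1 - 1) * w powi (i + 1) * f w"
    using assms tri_step[of "i - 1"] by (simp add: power_int_add mult_ac)
  finally show ?case .
next
  case (step2 i)
  have "p powi (i - 1) * w * f (p powi (i - 1) * w) = f (p * (p powi (i - 1) * w))"
    using assms by simp
  also have "p * (p powi (i - 1) * w) = p powi i * w"
    using assms by (simp add: power_int_diff)
  also have "f (p powi i * w) = p powi tri (i - 1) * w powi i * f w"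
    by (rule step2)
  also have "\<dots> = p powi (i - 1) * w * (p powi tri (i - 1 - 1) * w powi (i - 1) * f w)"
    using assms tri_step[of "i - 1 - 1"] by (simp add: power_int_add power_int_diff)
  finally show ?case using assms by simp
qed

lemma Theta_mult_base_powi:
  assumes "1 < cmod p" "w \<noteq> 0"
  shows "Theta p (p powi k * w) = p powi tri (k - 1) * w powi k * Theta p w"
  by (rule quasi_periodic_powi) (use assms Theta_mult_base in auto)

lemma Theta_minus_1: "1 < cmod p \<Longrightarrow> Theta p (- 1) = 0"
  using Theta_inverse[of p "-1"] by simp

lemma Theta_eq_0:
  assumes "1 < cmod p"
  shows "Theta p (- (p powi k)) = 0"
  using Theta_mult_base_powi[of p "-1" k] Theta_minus_1 assms by simp

text \<open>
  The series is \<open>A(w) + A(1/w) / w\<close> for an entire function \<open>A\<close> with \<open>A(0) = 1\<close>. If it vanished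
  identically, then \<open>A(w) = - A(1/w) / w\<close> would tend to \<open>0\<close> at infinity, and \<open>A = 0\<close> by Liouville.
\<close>
lemma Theta_not_identically_0:
  assumes "1 < cmod p"
  shows "\<exists>w. w \<noteq> 0 \<and> Theta p w \<noteq> 0"
proof (rule ccontr)
  assume *: "\<not> ?thesis"
  define A where "A = eval_fps (gauss_fps p (\<lambda>_. 1))"
  have R: "fps_conv_radius (gauss_fps p (\<lambda>_. 1)) = \<infinity>"
    by (rule gauss_fps_conv_radius[of _ _ 1]) (use assms in auto)
  have hol: "A holomorphic_on UNIV"
    unfolding A_def by (rule holomorphic_on_eval_fps) (simp add: R)
  have eq: "A w = - (A (1 / w) / w)" if "w \<noteq> 0" for w
    using * gauss_series_conv_fps[OF assms, of "\<lambda>_. 1" w] that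
    by (auto simp: Theta_conv_gauss_series A_def add_eq_0_iff)
  have "isCont A 0"
    using hol holomorphic_on_imp_continuous_on[of A UNIV] by (simp add: continuous_on_eq_continuous_at)
  then have "((\<lambda>w. A (1 / w)) \<longlongrightarrow> A 0) at_infinity"
    by (rule isCont_tendsto_compose) (intro tendsto_divide_0[OF tendsto_const] filterlim_ident)
  then have "((\<lambda>w. - (A (1 / w) * (1 / w))) \<longlongrightarrow> - (A 0 * 0)) at_infinity"
    by (intro tendsto_intros tendsto_divide_0[where c=1] filterlim_ident)
  moreover have "eventually (\<lambda>w. - (A (1 / w) * (1 / w)) = A w) at_infinity"
    using eventually_not_equal_at_infinity[of 0]
  proof eventually_elim
    case (elim w)
    show ?case using eq[OF elim] by simp
  qed
  ultimately have "(A \<longlongrightarrow> 0) at_infinity"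
    by (simp add: tendsto_cong)
  with hol have "A 0 = 0" by (rule Liouville_weak_0)
  then show False by (simp add: A_def eval_fps_at_0 gauss_fps_def tri_def)
qed

section \<open>Functions on a punctured disc with a multiplicative symmetry\<close>

text \<open>
  Every point of the punctured disc is moved by a power of \<open>q\<close> into a fixed closed annulus, and since
  \<open>1 \<le> cmod \<beta>\<close> the modulus of \<open>g\<close> does not decrease on the way. So a bound on the annulus is a
  bound everywhere.
\<close>
lemma contraction_bounded:
  fixes g :: "complex \<Rightarrow> complex"
  assumes q: "1 < cmod q" and r: "r > 0" and \<beta>: "1 \<le> cmod \<beta>"
    and hol: "g holomorphic_on ball 0 r - {0}"
    and eq: "\<And>z. z \<noteq> 0 \<Longrightarrow> cmod (q * z) < r \<Longrightarrow> g (q * z) = \<beta> * g z"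
  shows "\<exists>B. \<forall>z. z \<noteq> 0 \<longrightarrow> cmod z \<le> r / 2 \<longrightarrow> cmod (g z) \<le> B"
proof -
  define \<rho> where "\<rho> = r / 2"
  have \<rho>: "\<rho> > 0" "\<rho> < r" using r by (auto simp: \<rho>_def)
  define A where "A = cball 0 \<rho> - ball (0::complex) (\<rho> / cmod q)"
  have "compact A" unfolding A_def by (intro compact_diff) auto
  moreover have "A \<subseteq> ball 0 r - {0}"
    using \<rho> q by (auto simp: A_def intro!: divide_pos_pos)
  ultimately have "compact (g ` A)"
    using hol by (meson compact_continuous_image continuous_on_subset holomorphic_on_imp_continuous_on)
  then obtain B where B: "\<And>z. z \<in> A \<Longrightarrow> cmod (g z) \<le> B"
    by (meson bounded_iff compact_imp_bounded imageI)
  have *: "cmod (g z) \<le> B" if "\<rho> / cmod q ^ Suc k \<le> cmod z" "cmod z \<le> \<rho>" for k z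
    using that
  proof (induction k arbitrary: z)
    case 0
    then show ?case by (intro B) (auto simp: A_def)
  next
    case (Suc k)
    show ?case
    proof (cases "\<rho> / cmod q ^ Suc k \<le> cmod z")
      case True
      with Suc show ?thesis by blast
    next
      case False
      moreover have "0 < cmod q ^ Suc k"
        using q by (intro zero_less_power) auto
      ultimately have "cmod z * cmod q ^ Suc k < \<rho>"
        by (simp add: not_le pos_less_divide_eq del: power_Suc)
      moreover have "cmod z * cmod q * 1 \<le> cmod z * cmod q * cmod q ^ k"
        using q by (intro mult_left_mono) (auto intro: one_le_power)
      ultimately have "cmod (q * z) \<le> \<rho>"
        by (simp add: norm_mult mult_ac)
      moreover have "\<rho> / cmod q ^ Suc k \<le> cmod (q * z)"
      proof -
        have "\<rho> / cmod q ^ Suc k = cmod q * (\<rho> / cmod q ^ Suc (Suc k))"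
          using q by auto
        also have "\<dots> \<le> cmod q * cmod z"
          using Suc.prems(1) by (intro mult_left_mono) auto
        finally show ?thesis by (simp add: norm_mult)
      qed
      ultimately have "cmod (g (q * z)) \<le> B" by (rule Suc.IH[rotated])
      moreover have "0 < \<rho> / cmod q ^ Suc (Suc k)"
        using \<rho> q by (intro divide_pos_pos zero_less_power) auto
      then have "z \<noteq> 0" using Suc.prems(1) by auto
      then have "g (q * z) = \<beta> * g z"
        using \<open>cmod (q * z) \<le> \<rho>\<close> \<rho> by (intro eq) auto
      moreover have "1 * cmod (g z) \<le> cmod \<beta> * cmod (g z)"
        using \<beta> by (intro mult_right_mono) auto
      ultimately show ?thesis by (simp add: norm_mult)
    qed
  qed
  have "cmod (g z) \<le> B" if z: "z \<noteq> 0" "cmod z \<le> \<rho>" for z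
  proof -
    obtain k where "\<rho> / cmod z < cmod q ^ k"
      using real_arch_pow[OF q] by blast
    also have "\<dots> \<le> cmod q ^ Suc k"
      using q by (intro power_increasing) auto
    finally have "\<rho> < cmod q ^ Suc k * cmod z"
      using z by (simp add: pos_divide_less_eq del: power_Suc)
    moreover have "0 < cmod q ^ Suc k"
      using q by (intro zero_less_power) auto
    ultimately have "\<rho> / cmod q ^ Suc k \<le> cmod z"
      by (simp add: pos_divide_le_eq mult.commute del: power_Suc)
    with * z show ?thesis by blast
  qed
  then show ?thesis unfolding \<rho>_def by blast
qed

text \<open>
  The isolated singularity at \<open>0\<close> is removable by \<open>contraction_bounded\<close>; continuity carries the
  equation over to \<open>0\<close>.
\<close>
lemma contraction_extends:
  fixes g :: "complex \<Rightarrow> complex"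
  assumes q: "1 < cmod q" and r: "r > 0" and \<beta>: "1 \<le> cmod \<beta>"
    and hol: "g holomorphic_on ball 0 r - {0}"
    and eq: "\<And>z. z \<noteq> 0 \<Longrightarrow> cmod (q * z) < r \<Longrightarrow> g (q * z) = \<beta> * g z"
  obtains h where "h holomorphic_on ball 0 r" "\<And>z. z \<in> ball 0 r - {0} \<Longrightarrow> h z = g z"
    "\<And>z. cmod (q * z) < r \<Longrightarrow> h (q * z) = \<beta> * h z"
proof -
  obtain B where B: "\<And>z. z \<noteq> 0 \<Longrightarrow> cmod z \<le> r / 2 \<Longrightarrow> cmod (g z) \<le> B"
    using contraction_bounded[OF assms] by blast
  have "eventually (\<lambda>z. z \<in> ball 0 (r / 2) - {0}) (at 0)"
    using r by (intro eventually_at_in_open) auto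
  then have "eventually (\<lambda>z. cmod (g z) \<le> B) (at 0)"
    by eventually_elim (use B in auto)
  then obtain h where h: "h holomorphic_on ball 0 r" "\<And>z. z \<in> ball 0 r - {0} \<Longrightarrow> h z = g z"
    using holomorphic_on_extend_bounded[of g "ball 0 r" 0] hol r by (auto simp: interior_open)
  have small: "cmod z < r" if "cmod (q * z) < r" for z
  proof -
    have "1 * cmod z \<le> cmod q * cmod z" using q by (intro mult_right_mono) auto
    with that show ?thesis by (simp add: norm_mult)
  qed
  have q0: "q \<noteq> 0" using q by auto
  have nz: "h (q * z) = \<beta> * h z" if "cmod (q * z) < r" "z \<noteq> 0" for z
    using h(2)[of z] h(2)[of "q * z"] eq[of z] that small[of z] q0 by auto
  have cont: "isCont h 0"
    using h(1) r by (meson centre_in_ball continuous_on_eq_continuous_at holomorphic_on_imp_continuous_on open_ball)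
  then have cont': "(h \<longlongrightarrow> h 0) (at 0)" by (simp add: isCont_def)
  then have lim1: "((\<lambda>z. \<beta> * h z) \<longlongrightarrow> \<beta> * h 0) (at 0)"
    by (intro tendsto_intros)
  have "((\<lambda>z. h (q * z)) \<longlongrightarrow> h 0) (at 0)"
    by (rule isCont_tendsto_compose[OF cont]) (auto intro!: tendsto_eq_intros)
  moreover have "eventually (\<lambda>z. z \<in> ball 0 (r / cmod q) - {0}) (at 0)"
    using r q by (intro eventually_at_in_open) (auto intro!: divide_pos_pos)
  then have "eventually (\<lambda>z. h (q * z) = \<beta> * h z) (at 0)"
    by eventually_elim (use nz q0 in \<open>auto simp: norm_mult field_simps\<close>)
  ultimately have "((\<lambda>z. \<beta> * h z) \<longlongrightarrow> h 0) (at 0)"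
    by (rule Lim_transform_eventually)
  from LIM_unique[OF this lim1] have "h (q * 0) = \<beta> * h 0" by simp
  with nz have "h (q * z) = \<beta> * h z" if "cmod (q * z) < r" for z
    using that by (cases "z = 0") auto
  with h show ?thesis by (rule that)
qed

text \<open>
  After extension to \<open>0\<close> the value at \<open>z\<close> equals the values at all \<open>z / q ^ k\<close>, which tend to the
  value at \<open>0\<close>.
\<close>
lemma contraction_invariant_constant:
  fixes g :: "complex \<Rightarrow> complex"
  assumes q: "1 < cmod q" and r: "r > 0"
    and hol: "g holomorphic_on ball 0 r - {0}"
    and eq: "\<And>z. z \<noteq> 0 \<Longrightarrow> cmod (q * z) < r \<Longrightarrow> g (q * z) = g z"
  shows "\<exists>c. \<forall>z\<in>ball 0 r - {0}. g z = c"
proof -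
  obtain h where h: "h holomorphic_on ball 0 r" "\<And>z. z \<in> ball 0 r - {0} \<Longrightarrow> h z = g z"
    "\<And>z. cmod (q * z) < r \<Longrightarrow> h (q * z) = h z"
    using contraction_extends[OF q r _ hol, of 1] eq by auto
  have q0: "q \<noteq> 0" using q by auto
  have "h z = h 0" if z: "cmod z < r" for z
  proof -
    have lim: "(\<lambda>k. z / q ^ k) \<longlonglongrightarrow> 0"
      by (rule tendsto_norm_zero_cancel)
         (use LIMSEQ_divide_realpow_zero[OF q, of "cmod z"] in \<open>simp add: norm_divide norm_power\<close>)
    have small: "cmod (z / q ^ k) < r" for k
    proof -
      have "cmod z / cmod q ^ k \<le> cmod z / 1"
        using q by (intro divide_left_mono) (auto intro!: one_le_power zero_less_power)
      with z show ?thesis by (simp add: norm_divide norm_power)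
    qed
    have "h (z / q ^ k) = h z" for k
    proof (induction k)
      case (Suc k)
      have "q * (z / q ^ Suc k) = z / q ^ k" using q0 by simp
      with h(3)[of "z / q ^ Suc k"] small[of k] Suc show ?case by simp
    qed auto
    then have "(\<lambda>k. h (z / q ^ k)) \<longlonglongrightarrow> h z" by simp
    moreover have "isCont h 0"
      using h(1) r by (meson centre_in_ball continuous_on_eq_continuous_at holomorphic_on_imp_continuous_on open_ball)
    then have "(\<lambda>k. h (z / q ^ k)) \<longlonglongrightarrow> h 0"
      by (rule isCont_tendsto_compose[OF _ lim])
    ultimately show ?thesis by (rule LIMSEQ_unique)
  qed
  then show ?thesis using h(2) by (intro exI[of _ "h 0"]) auto
qed

text \<open>
  Multiplication by \<open>z ^ N\<close> replaces \<open>\<beta>\<close> by \<open>q ^ N * \<beta>\<close>, which makes the function extend to \<open>0\<close>.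
  Comparing the \<open>n\<close>-th derivatives at \<open>0\<close> of both sides of the equation gives
  \<open>q ^ n = q ^ N * \<beta>\<close> unless that derivative vanishes.
\<close>
lemma contraction_eigenfunction_eq_0:
  fixes g :: "complex \<Rightarrow> complex"
  assumes q: "1 < cmod q" and r: "r > 0" and \<beta>: "\<beta> \<noteq> 0" "\<And>k::int. \<beta> \<noteq> q powi k"
    and hol: "g holomorphic_on ball 0 r - {0}"
    and eq: "\<And>z. z \<noteq> 0 \<Longrightarrow> cmod (q * z) < r \<Longrightarrow> g (q * z) = \<beta> * g z"
    and z: "z \<noteq> 0" "cmod z < r"
  shows "g z = 0"
proof -
  have q0: "q \<noteq> 0" using q by auto
  \<comment> \<open>\<open>N\<close> is so large that the new eigenvalue \<open>q ^ N * \<beta>\<close> has modulus at least \<open>1\<close>.\<close>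
  obtain N where "1 / cmod \<beta> < cmod q ^ N"
    using real_arch_pow[OF q] by blast
  then have N: "1 \<le> cmod (q ^ N * \<beta>)"
    using \<beta> by (simp add: norm_mult norm_power field_simps)
  have hol': "(\<lambda>z. z ^ N * g z) holomorphic_on ball 0 r - {0}"
    by (intro holomorphic_intros hol)
  obtain h where h: "h holomorphic_on ball 0 r" "\<And>z. z \<in> ball 0 r - {0} \<Longrightarrow> h z = z ^ N * g z"
    "\<And>z. cmod (q * z) < r \<Longrightarrow> h (q * z) = q ^ N * \<beta> * h z"
    by (rule contraction_extends[OF q r N hol']) (auto simp: eq power_mult_distrib)
  have "(deriv ^^ n) h 0 = 0" for n
  proof -
    have inS: "cmod (q * w) < r" if "w \<in> ball 0 (r / cmod q)" for w
      using that q0 by (auto simp: norm_mult field_simps)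
    have ev: "eventually (\<lambda>z. h (q * z) = q ^ N * \<beta> * h z) (nhds 0)"
      by (rule eventually_mono[OF eventually_nhds_in_open[of "ball 0 (r / cmod q)"]])
         (use r q inS h(3) in \<open>auto intro!: divide_pos_pos\<close>)
    have "q ^ n * (deriv ^^ n) h (q * 0) = (deriv ^^ n) (\<lambda>z. h (q * z)) 0"
      by (rule higher_deriv_compose_linear[OF h(1), of "ball 0 (r / cmod q)", symmetric])
         (use inS r q in \<open>auto intro!: divide_pos_pos\<close>)
    also have "\<dots> = (deriv ^^ n) (\<lambda>z. q ^ N * \<beta> * h z) 0"
      by (rule higher_deriv_cong_ev[OF ev]) auto
    also have "\<dots> = q ^ N * \<beta> * (deriv ^^ n) h 0"
      by (rule higher_deriv_cmult[OF h(1)]) (use r in auto)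
    finally have "(q ^ n - q ^ N * \<beta>) * (deriv ^^ n) h 0 = 0"
      by (simp add: algebra_simps)
    moreover have "\<beta> \<noteq> q powi (int n - int N)" by (rule \<beta>)
    then have "q ^ n - q ^ N * \<beta> \<noteq> 0"
      using q0 by (auto simp: power_int_diff field_simps)
    ultimately show ?thesis by simp
  qed
  then have "h z = 0"
    by (intro holomorphic_fun_eq_0_on_ball[OF h(1)]) (use z in auto)
  with h(2)[of z] z show ?thesis by auto
qed

section \<open>A product with the zeros of the theta function\<close>

text \<open>
  Euler's series for the product of all \<open>1 + z / p ^ k\<close> with \<open>k > 0\<close>. As a power series it is entire by
  the ratio test, and its zeros are found from its functional equation.
\<close>
definition euler_fps :: "complex \<Rightarrow> complex fps" where
  "euler_fps p = Abs_fps (\<lambda>n. 1 / (\<Prod>k=1..n. p ^ k - 1))"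

lemma power_ne_1:
  fixes p :: complex
  assumes "1 < cmod p" "k > 0"
  shows "p ^ k \<noteq> 1"
proof
  assume "p ^ k = 1"
  then have "cmod p ^ k = 1" by (metis norm_one norm_power)
  with assms show False using one_less_power[of "cmod p" k] by simp
qed

lemma euler_fps_conv_radius:
  assumes p: "1 < cmod p"
  shows "fps_conv_radius (euler_fps p) = \<infinity>"
  unfolding fps_conv_radius_def
proof (rule conv_radius_inftyI'')
  fix z :: complex
  have "filterlim (\<lambda>n. cmod p ^ n) at_top sequentially"
    using filterlim_realpow_sequentially_gt1[OF p]
    by (simp add: filterlim_at_infinity_conv_norm_at_top norm_power)
  then have "filterlim (\<lambda>n. cmod p ^ Suc n) at_top sequentially"
    by (rule filterlim_compose) (rule filterlim_Suc)
  then have "eventually (\<lambda>n. cmod p ^ Suc n \<ge> 2 * cmod z + 1) sequentially"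
    by (simp add: filterlim_at_top)
  then obtain N where N: "\<And>n. n \<ge> N \<Longrightarrow> cmod p ^ Suc n \<ge> 2 * cmod z + 1"
    by (auto simp: eventually_sequentially)
  show "summable (\<lambda>n. fps_nth (euler_fps p) n * z ^ n)"
  proof (rule summable_ratio_test[of "1/2" N])
    fix n assume n: "n \<ge> N"
    have ge: "cmod (p ^ Suc n - 1) \<ge> 2 * cmod z"
      using N[OF n] norm_triangle_ineq2[of "p ^ Suc n" 1] by (simp only: norm_power norm_one)
    have ne: "p ^ Suc n - 1 \<noteq> 0"
      using power_ne_1[OF p, of "Suc n"] by auto
    have le: "cmod (z / (p ^ Suc n - 1)) \<le> 1 / 2"
      using ge ne by (simp add: norm_divide field_simps del: power_Suc)
    have "fps_nth (euler_fps p) (Suc n) * z ^ Suc n = fps_nth (euler_fps p) n * z ^ n * (z / (p ^ Suc n - 1))"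
      by (simp add: euler_fps_def)
    then have "norm (fps_nth (euler_fps p) (Suc n) * z ^ Suc n) =
        norm (fps_nth (euler_fps p) n * z ^ n) * cmod (z / (p ^ Suc n - 1))"
      by (simp only: norm_mult)
    also have "\<dots> \<le> norm (fps_nth (euler_fps p) n * z ^ n) * (1/2)"
      by (intro mult_left_mono le) auto
    finally show "norm (fps_nth (euler_fps p) (Suc n) * z ^ Suc n) \<le> 1/2 * norm (fps_nth (euler_fps p) n * z ^ n)"
      by simp
  qed auto
qed

definition euler_fun :: "complex \<Rightarrow> complex \<Rightarrow> complex" where
  "euler_fun p = eval_fps (euler_fps p)"

lemma euler_fun_holomorphic: "1 < cmod p \<Longrightarrow> euler_fun p holomorphic_on A"
  unfolding euler_fun_def by (rule holomorphic_on_eval_fps) (simp add: euler_fps_conv_radius)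

lemma euler_fun_0: "euler_fun p 0 = 1"
  by (simp add: euler_fun_def eval_fps_at_0 euler_fps_def)

lemma euler_fun_mult_base:
  assumes p: "1 < cmod p"
  shows "euler_fun p (p * z) = (1 + z) * euler_fun p z"
proof -
  have eq: "Abs_fps (\<lambda>n. fps_nth (euler_fps p) n * p ^ n) = (1 + fps_X) * euler_fps p"
  proof (rule fps_ext)
    fix n
    show "fps_nth (Abs_fps (\<lambda>n. fps_nth (euler_fps p) n * p ^ n)) n = fps_nth ((1 + fps_X) * euler_fps p) n"
    proof (cases n)
      case (Suc m)
      have "p ^ Suc m - 1 \<noteq> 0" using power_ne_1[OF p, of "Suc m"] by auto
      moreover have "(\<Prod>k=1..m. p ^ k - 1) \<noteq> 0" using power_ne_1[OF p] by auto
      ultimately show ?thesis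
        using Suc by (simp add: euler_fps_def distrib_right field_simps del: power_Suc)
    qed (simp add: euler_fps_def distrib_right)
  qed
  have "euler_fun p (p * z) = eval_fps (Abs_fps (\<lambda>n. fps_nth (euler_fps p) n * p ^ n)) z"
    by (simp add: euler_fun_def eval_fps_def power_mult_distrib mult_ac)
  also have "\<dots> = eval_fps (1 + fps_X) z * eval_fps (euler_fps p) z"
    unfolding eq by (rule eval_fps_mult)
      (auto simp: euler_fps_conv_radius p less_le_trans[OF _ fps_conv_radius_add])
  also have "eval_fps (1 + fps_X) z = 1 + z"
    by (subst eval_fps_add) auto
  finally show ?thesis by (simp add: euler_fun_def)
qed

text \<open>
  If \<open>z\<close> is a zero, then either \<open>z = - p\<close> or \<open>z / p\<close> is a zero, by the functional equation. There is
  no zero near \<open>0\<close>, so dividing by \<open>p\<close> repeatedly must end in the first case.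
\<close>
lemma euler_fun_zeros:
  assumes p: "1 < cmod p" and "euler_fun p z = 0"
  shows "\<exists>k>0. z = - (p ^ k)"
proof -
  have p0: "p \<noteq> 0" using p by auto
  have "isCont (euler_fun p) 0"
    using euler_fun_holomorphic[OF p, of UNIV] holomorphic_on_imp_continuous_on
    by (metis UNIV_I continuous_on_eq_continuous_at open_UNIV)
  then have "(euler_fun p \<longlongrightarrow> euler_fun p 0) (nhds 0)"
    unfolding isCont_def tendsto_at_iff_tendsto_nhds .
  then have "(euler_fun p \<longlongrightarrow> 1) (nhds 0)"
    by (simp add: euler_fun_0)
  then have "eventually (\<lambda>z. euler_fun p z \<noteq> 0) (nhds 0)"
    by (rule tendsto_imp_eventually_ne) auto
  then obtain \<delta> where \<delta>: "\<delta> > 0" "\<And>z. cmod z < \<delta> \<Longrightarrow> euler_fun p z \<noteq> 0"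
    by (auto simp: eventually_nhds_metric)
  have *: "\<exists>k>0. z = - (p ^ k)" if "cmod z < \<delta> * cmod p ^ m" "euler_fun p z = 0" for m z
    using that
  proof (induction m arbitrary: z)
    case 0
    then show ?case using \<delta>(2)[of z] by simp
  next
    case (Suc m)
    have "(1 + z / p) * euler_fun p (z / p) = 0"
      using euler_fun_mult_base[OF p, of "z / p"] Suc.prems p0 by simp
    then consider "1 + z / p = 0" | "euler_fun p (z / p) = 0" by auto
    then show ?case
    proof cases
      case 1
      then have "z = - (p ^ 1)" using p0 by (simp add: field_simps add_eq_0_iff)
      then show ?thesis by blast
    next
      case 2
      moreover have "cmod (z / p) < \<delta> * cmod p ^ m"
        using Suc.prems(1) p0 by (simp add: norm_divide field_simps)
      ultimately obtain k where "k > 0" "z / p = - (p ^ k)" using Suc.IH by blast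
      then have "z = - (p ^ Suc k)" using p0 by (simp add: field_simps)
      then show ?thesis by blast
    qed
  qed
  obtain m where "cmod z / \<delta> < cmod p ^ m" using real_arch_pow[OF p] by blast
  then have "cmod z < \<delta> * cmod p ^ m" using \<delta> by (simp add: field_simps)
  with * assms show ?thesis by blast
qed

text \<open>
  The Jacobi triple product without its constant factor.
\<close>
definition theta_prod :: "complex \<Rightarrow> complex \<Rightarrow> complex" where
  "theta_prod p z = euler_fun p z * euler_fun p (p / z)"

lemma theta_prod_holomorphic:
  assumes "1 < cmod p"
  shows "theta_prod p holomorphic_on - {0}"
proof -
  have "(euler_fun p \<circ> (\<lambda>z. p / z)) holomorphic_on - {0}"
    by (rule holomorphic_on_compose_gen[OF _ euler_fun_holomorphic[OF assms, of UNIV]])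
       (auto intro!: holomorphic_intros)
  then show ?thesis
    unfolding theta_prod_def o_def by (intro holomorphic_intros euler_fun_holomorphic assms)
qed

text \<open>
  What remains of the triple product after its factor \<open>z + 1\<close> is split off.
\<close>
definition theta_cofactor :: "complex \<Rightarrow> complex \<Rightarrow> complex" where
  "theta_cofactor p z = euler_fun p z * euler_fun p (1 / z) / z"

lemma theta_cofactor_holomorphic:
  assumes "1 < cmod p"
  shows "theta_cofactor p holomorphic_on - {0}"
proof -
  have "(euler_fun p \<circ> (\<lambda>z. 1 / z)) holomorphic_on - {0}"
    by (rule holomorphic_on_compose_gen[OF _ euler_fun_holomorphic[OF assms, of UNIV]])
       (auto intro!: holomorphic_intros)
  then show ?thesis
    unfolding theta_cofactor_def o_def by (intro holomorphic_intros euler_fun_holomorphic assms) auto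
qed

lemma theta_cofactor_minus_1:
  assumes "1 < cmod p"
  shows "theta_cofactor p (- 1) \<noteq> 0"
  using euler_fun_zeros[OF assms, of "- 1"] power_ne_1[OF assms] by (auto simp: theta_cofactor_def)

lemma theta_prod_factor:
  assumes "1 < cmod p" "z \<noteq> 0"
  shows "theta_prod p z = (z + 1) * theta_cofactor p z"
proof -
  have "euler_fun p (p / z) = (1 + 1 / z) * euler_fun p (1 / z)"
    using euler_fun_mult_base[OF assms(1), of "1 / z"] by simp
  then show ?thesis
    using assms(2) by (simp add: theta_prod_def theta_cofactor_def divide_simps) algebra
qed

lemma theta_prod_mult_base:
  assumes "1 < cmod p" "z \<noteq> 0"
  shows "theta_prod p (p * z) = z * theta_prod p z"
proof -
  have "p \<noteq> 0" using assms by auto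
  moreover have "euler_fun p (p / z) = (1 + 1 / z) * euler_fun p (1 / z)"
    using euler_fun_mult_base[OF assms(1), of "1 / z"] by simp
  ultimately show ?thesis
    using euler_fun_mult_base[OF assms(1), of z] assms(2)
    by (simp add: theta_prod_def divide_simps) (simp add: algebra_simps)
qed

lemma theta_prod_eq_0_iff:
  assumes p: "1 < cmod p" and z: "z \<noteq> 0"
  shows "theta_prod p z = 0 \<longleftrightarrow> (\<exists>k::int. z = - (p powi k))"
proof
  have p0: "p \<noteq> 0" using p by auto
  show "\<exists>k::int. z = - (p powi k)" if "theta_prod p z = 0"
  proof -
    from that consider "euler_fun p z = 0" | "euler_fun p (p / z) = 0"
      by (auto simp: theta_prod_def)
    then show ?thesis
    proof cases
      case 1
      then obtain k where "z = - (p ^ k)" using euler_fun_zeros[OF p] by blast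
      then have "z = - (p powi int k)" by simp
      then show ?thesis by blast
    next
      case 2
      then obtain k where k: "p / z = - (p ^ k)" using euler_fun_zeros[OF p] by blast
      have "z * p ^ k = z * (- (p / z))" using k by simp
      also have "\<dots> = - p" using z by simp
      finally have "z = (- p) / p ^ k" using p0 by (subst eq_divide_eq) simp
      then have "z = - (p powi (1 - int k))"
        using p0 by (simp add: power_int_diff)
      then show ?thesis by blast
    qed
  qed
  show "theta_prod p z = 0" if "\<exists>k::int. z = - (p powi k)"
  proof -
    from that obtain k where k: "z = p powi k * (- 1)" by auto
    have "theta_prod p z = p powi tri (k - 1) * (- 1) powi k * theta_prod p (- 1)"
      unfolding k by (rule quasi_periodic_powi[OF p0 _ theta_prod_mult_base[OF p]]) auto
    also have "theta_prod p (- 1) = 0" using theta_prod_factor[OF p, of "-1"] by simp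
    finally show ?thesis by simp
  qed
qed

section \<open>Zeros of the theta function\<close>

text \<open>
  Both sides satisfy the same functional equation, so their quotient is invariant under \<open>z \<mapsto> p z\<close>.
  It has no poles: the product has at \<open>-1\<close> a simple zero, where the theta function vanishes
  as well, and by invariance the same holds at the other points of \<open>-p^Z\<close>. An invariant
  holomorphic function on a punctured disc is constant, and here the constant is not \<open>0\<close>, because
  the theta function does not vanish identically.
\<close>
lemma Theta_conv_theta_prod:
  assumes p: "1 < cmod p"
  obtains C where "C \<noteq> 0" "\<And>z. z \<noteq> 0 \<Longrightarrow> Theta p z = C * theta_prod p z"
proof -
  have p0: "p \<noteq> 0" using p by auto
  define h0 where "h0 = (\<lambda>z. Theta p z / theta_prod p z)"
  define v where "v = theta_cofactor p"
  define c where "c = deriv (Theta p) (- 1) / v (- 1)"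
  define h where "h = remove_sings h0"
  have v: "theta_prod p z = (z + 1) * v z" if "z \<noteq> 0" for z
    using theta_prod_factor[OF p that] by (simp add: v_def)
  have v_hol: "v holomorphic_on - {0}"
    unfolding v_def by (rule theta_cofactor_holomorphic[OF p])
  have v_nz: "v (- 1) \<noteq> 0"
    unfolding v_def by (rule theta_cofactor_minus_1[OF p])
  have mero: "h0 meromorphic_on - {0}"
    unfolding h0_def
    by (intro meromorphic_intros analytic_on_imp_meromorphic_on)
       (auto simp: analytic_on_open open_Compl Theta_holomorphic theta_prod_holomorphic p)
  have invariant: "h0 (p powi k * z) = h0 z" if "z \<noteq> 0" for k z
    using Theta_mult_base_powi[OF p that, of k] p0 that
      quasi_periodic_powi[of p z "theta_prod p" k, OF p0 that theta_prod_mult_base[OF p]]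
    by (simp add: h0_def)
  \<comment> \<open>Both functions have the factor \<open>z + 1\<close>; the limit is a quotient of their cofactors.\<close>
  have lim_m1: "h0 \<midarrow>- 1\<rightarrow> c"
  proof -
    have "(Theta p has_field_derivative deriv (Theta p) (- 1)) (at (- 1))"
      by (rule holomorphic_derivI[OF Theta_holomorphic[OF p]]) auto
    then have "((\<lambda>z. (Theta p z - Theta p (- 1)) / (z - (- 1))) \<longlongrightarrow> deriv (Theta p) (- 1)) (at (- 1))"
      by (simp only: has_field_derivative_iff)
    moreover have "isCont v (- 1)"
      using holomorphic_on_imp_continuous_on[OF v_hol]
      by (simp add: continuous_on_eq_continuous_at open_Compl)
    then have "(v \<longlongrightarrow> v (- 1)) (at (- 1))" by (simp add: isCont_def)
    ultimately have "((\<lambda>z. (Theta p z - Theta p (- 1)) / (z - (- 1)) / v z) \<longlongrightarrow> c) (at (- 1))"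
      unfolding c_def using v_nz by (intro tendsto_divide)
    moreover have "eventually (\<lambda>z::complex. z \<in> - {0}) (at (- 1))"
      by (intro eventually_at_in_open') auto
    then have "eventually (\<lambda>z. (Theta p z - Theta p (- 1)) / (z - (- 1)) / v z = h0 z) (at (- 1))"
      by eventually_elim (simp add: h0_def v Theta_minus_1 p add.commute)
    ultimately show ?thesis by (rule Lim_transform_eventually)
  qed
  have lim: "h0 \<midarrow>- (p powi k)\<rightarrow> c" for k
  proof -
    have "filterlim (\<lambda>z. z / p powi k) (at (- 1)) (at (- (p powi k)))"
    proof (rule filterlim_atI)
      show "((\<lambda>z. z / p powi k) \<longlongrightarrow> - 1) (at (- (p powi k)))"
        using p0 by (auto intro!: tendsto_eq_intros)
      show "eventually (\<lambda>z. z / p powi k \<noteq> - 1) (at (- (p powi k)))"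
        using p0 by (auto simp: eventually_at_filter field_simps)
    qed
    then have "((\<lambda>z. h0 (z / p powi k)) \<longlongrightarrow> c) (at (- (p powi k)))"
      by (rule filterlim_compose[OF lim_m1])
    moreover have "eventually (\<lambda>z. z \<in> - {0}) (at (- (p powi k)))"
      using p0 by (intro eventually_at_in_open') auto
    then have "eventually (\<lambda>z. h0 (z / p powi k) = h0 z) (at (- (p powi k)))"
    proof eventually_elim
      case (elim z)
      show ?case using invariant[of "z / p powi k" k] elim p0 by simp
    qed
    ultimately show ?thesis by (rule Lim_transform_eventually)
  qed
  have h_zero: "h (- (p powi k)) = c" for k
    unfolding h_def using lim by (rule remove_sings_eqI)
  have h0_ana: "h0 analytic_on {z}" if "z \<noteq> 0" "\<And>k. z \<noteq> - (p powi k)" for z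
  proof -
    have "theta_prod p z \<noteq> 0" using theta_prod_eq_0_iff[OF p] that by blast
    then show ?thesis
      unfolding h0_def using that
      by (intro analytic_on_divide analytic_on_holomorphic[THEN iffD2])
         (auto intro!: exI[of _ "- {0}"] simp: Theta_holomorphic theta_prod_holomorphic p)
  qed
  have h_eq: "h z = h0 z" if "z \<noteq> 0" "\<And>k. z \<noteq> - (p powi k)" for z
    unfolding h_def using h0_ana[OF that] by simp
  have "h analytic_on {z}" if "z \<noteq> 0" for z
  proof (cases "\<exists>k. z = - (p powi k)")
    case True
    then obtain k where k: "z = - (p powi k)" by blast
    have "isolated_singularity_at h0 z"
      using mero that by (meson ComplI empty_iff insert_iff meromorphic_onE)
    then show ?thesis unfolding h_def using lim[of k] k by (auto intro: remove_sings_analytic_at)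
  next
    case False
    then show ?thesis unfolding h_def using h0_ana[of z] that
      by (auto intro: remove_sings_analytic_on)
  qed
  then have "h analytic_on A - {0}" for A
    by (subst analytic_on_analytic_at) auto
  then have h_hol: "h holomorphic_on A - {0}" for A
    by (rule analytic_imp_holomorphic)
  have h_inv: "h (p * z) = h z" if "z \<noteq> 0" for z
  proof (cases "\<exists>k. z = - (p powi k)")
    case True
    then obtain k where k: "z = - (p powi k)" by blast
    then have "p * z = - (p powi (k + 1))" using p0 by (simp add: power_int_add)
    then show ?thesis using h_zero k by metis
  next
    case False
    have "p * z \<noteq> - (p powi k)" for k
    proof
      assume "p * z = - (p powi k)"
      then have "z = - (p powi (k - 1))" using p0 by (simp add: power_int_diff field_simps)
      with False show False by blast
    qed
    with False show ?thesis using h_eq[of z] h_eq[of "p * z"] invariant[of z 1] that p0 by auto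
  qed
  have const: "h z = h 1" if "z \<noteq> 0" for z
  proof -
    define r where "r = cmod z + 2"
    have "r > 0" by (simp add: r_def add_nonneg_pos)
    then obtain d where "\<forall>z\<in>ball 0 r - {0}. h z = d"
      using contraction_invariant_constant[OF p _ h_hol[of "ball 0 r"]] h_inv by blast
    moreover have "z \<in> ball 0 r - {0}" "(1::complex) \<in> ball 0 r - {0}"
      using that norm_ge_zero[of z] by (auto simp: r_def simp del: norm_ge_zero)
    ultimately show ?thesis by metis
  qed
  have fact: "Theta p z = h 1 * theta_prod p z" if "z \<noteq> 0" for z
  proof (cases "\<exists>k. z = - (p powi k)")
    case True
    then show ?thesis
      using Theta_eq_0[OF p] theta_prod_eq_0_iff[OF p that] by auto
  next
    case False
    then have "theta_prod p z \<noteq> 0" "h0 z = h 1"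
      using theta_prod_eq_0_iff[OF p that] const[OF that] h_eq[OF that] by auto
    then show ?thesis by (auto simp: h0_def field_simps)
  qed
  moreover have "h 1 \<noteq> 0"
    using Theta_not_identically_0[OF p] fact by auto
  ultimately show ?thesis using that by blast
qed

lemma Theta_eq_0_iff:
  assumes p: "1 < cmod p" and z: "z \<noteq> 0"
  shows "Theta p z = 0 \<longleftrightarrow> (\<exists>k::int. z = - (p powi k))"
  using Theta_conv_theta_prod[OF p] theta_prod_eq_0_iff[OF p z] z by (metis mult_eq_0_iff)

text \<open>
  At \<open>-1\<close> this is the factorisation of the product; quasi-periodicity moves it to \<open>- (p powi k)\<close>.
\<close>
lemma Theta_simple_zero:
  assumes p: "1 < cmod p"
  obtains v where "v holomorphic_on - {0}" "v (- (p powi k)) \<noteq> 0"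
    "\<And>z. z \<noteq> 0 \<Longrightarrow> Theta p z = (z + p powi k) * v z"
proof -
  have p0: "p \<noteq> 0" using p by auto
  obtain C where C: "C \<noteq> 0" "\<And>z. z \<noteq> 0 \<Longrightarrow> Theta p z = C * theta_prod p z"
    using Theta_conv_theta_prod[OF p] by blast
  define u where "u = (\<lambda>z. z / p powi k)"
  define v where "v = (\<lambda>z. p powi tri (k - 1) * u z powi k * C * theta_cofactor p (u z) / p powi k)"
  have u_hol: "u holomorphic_on - {0}"
    unfolding u_def using p0 by (intro holomorphic_intros) auto
  have "(theta_cofactor p \<circ> u) holomorphic_on - {0}"
    by (rule holomorphic_on_compose_gen[OF u_hol theta_cofactor_holomorphic[OF p]]) (use p0 in \<open>auto simp: u_def\<close>)
  then have "v holomorphic_on - {0}"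
    unfolding v_def o_def using p0 by (intro holomorphic_intros u_hol) (auto simp: u_def)
  moreover have "v (- (p powi k)) \<noteq> 0"
    using p0 C(1) theta_cofactor_minus_1[OF p] by (simp add: v_def u_def)
  moreover have "Theta p z = (z + p powi k) * v z" if z: "z \<noteq> 0" for z
  proof -
    have "Theta p z = Theta p (p powi k * u z)" using p0 by (simp add: u_def)
    also have "\<dots> = p powi tri (k - 1) * u z powi k * Theta p (u z)"
      by (rule Theta_mult_base_powi[OF p]) (use p0 z in \<open>auto simp: u_def\<close>)
    also have "Theta p (u z) = C * ((u z + 1) * theta_cofactor p (u z))"
      using C(2)[of "u z"] theta_prod_factor[OF p, of "u z"] p0 z by (simp add: u_def)
    also have "u z + 1 = (z + p powi k) / p powi k"
      using p0 by (simp add: u_def field_simps)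
    finally show ?thesis by (simp add: v_def mult_ac)
  qed
  ultimately show ?thesis by (rule that)
qed

section \<open>Simultaneous triangularisation of a two-sided equation\<close>

lemma index_mult_mat_sum:
  assumes "A \<in> carrier_mat a b" "B \<in> carrier_mat b c" "i < a" "j < c"
  shows "(A * B) $$ (i, j) = (\<Sum>k<b. A $$ (i, k) * B $$ (k, j))"
  using assms by (simp add: scalar_prod_def atLeast0LessThan)

text \<open>
  A Schur decomposition. The diagonal entries are the eigenvalues, which is where the spectra of
  \<open>C1\<close> and \<open>C2\<close> enter.
\<close>
lemma complex_mat_triangularise:
  fixes C :: "complex mat"
  assumes C: "C \<in> carrier_mat m m"
  obtains P Q T where "P \<in> carrier_mat m m" "Q \<in> carrier_mat m m" "T \<in> carrier_mat m m"
    "P * Q = 1\<^sub>m m" "Q * P = 1\<^sub>m m" "C = P * T * Q" "upper_triangular T"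
    "\<And>i. i < m \<Longrightarrow> T $$ (i, i) \<in> spectrum C"
proof -
  obtain es where es: "char_poly C = (\<Prod>e\<leftarrow>es. [:- e, 1:])"
    using char_poly_factorized[OF C] by blast
  obtain T P Q where TPQ: "schur_decomposition C es = (T, P, Q)"
    by (cases "schur_decomposition C es") auto
  from schur_decomposition[OF C es TPQ]
  have wit: "similar_mat_wit C T P Q" and T: "upper_triangular T" "diag_mat T = es" by auto
  note * = similar_mat_witD2[OF C wit]
  have "T $$ (i, i) \<in> spectrum C" if "i < m" for i
  proof -
    have "T $$ (i, i) \<in> set es"
      using that *(5) unfolding T(2)[symmetric] diag_mat_def by auto
    then have "poly (char_poly C) (T $$ (i, i)) = 0"
      unfolding es poly_prod_list by (auto simp: prod_list_zero_iff)
    then show ?thesis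
      using eigenvalue_root_char_poly[OF C] by (simp add: spectrum_def)
  qed
  with * T show ?thesis by (intro that[of P Q T]) auto
qed

lemma invertible_mat_zero_notin_spectrum:
  fixes C :: "complex mat"
  assumes C: "C \<in> carrier_mat m m" and inv: "invertible_mat C"
  shows "0 \<notin> spectrum C"
proof
  assume "0 \<in> spectrum C"
  then obtain v where v: "v \<in> carrier_vec m" "v \<noteq> 0\<^sub>v m" "C *\<^sub>v v = 0 \<cdot>\<^sub>v v"
    using C by (auto simp: spectrum_def eigenvalue_def eigenvector_def)
  obtain B where B: "inverts_mat C B" "inverts_mat B C"
    using inv by (auto simp: invertible_mat_def)
  have CB: "C * B = 1\<^sub>m m" using B(1) C by (simp add: inverts_mat_def)
  have "dim_col (B * C) = m" using C by simp
  moreover have BC': "B * C = 1\<^sub>m (dim_row B)" using B(2) by (simp add: inverts_mat_def)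
  ultimately have dB: "dim_row B = m" by (metis index_one_mat(3))
  then have BC: "B * C = 1\<^sub>m m" using BC' by simp
  have "dim_col (C * B) = m" using CB by simp
  then have Bc: "B \<in> carrier_mat m m" using dB by auto
  have "v = 1\<^sub>m m *\<^sub>v v" using v by simp
  also have "\<dots> = B *\<^sub>v (C *\<^sub>v v)"
    unfolding BC[symmetric] using Bc C v(1) by (rule assoc_mult_mat_vec)
  also have "\<dots> = 0\<^sub>v m" using v Bc by auto
  finally show False using v(2) by simp
qed

text \<open>
  For upper triangular \<open>R\<close> and \<open>T\<close> the entry \<open>(i, j)\<close> of an equation between \<open>R M\<close> and \<open>M T\<close> involves,
  besides \<open>M $$ (i, j)\<close>, only entries below it in its column and to its left in its row. They all
  come earlier in the order by \<open>m1 - i + j\<close>.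
\<close>
lemma triangular_pair_induct [consumes 2, case_names step]:
  fixes i j m1 m2 :: nat
  assumes "i < m1" "j < m2"
    and step: "\<And>i j. i < m1 \<Longrightarrow> j < m2 \<Longrightarrow> (\<And>k. i < k \<Longrightarrow> k < m1 \<Longrightarrow> P k j) \<Longrightarrow>
                (\<And>k. k < j \<Longrightarrow> P i k) \<Longrightarrow> P i j"
  shows "P i j"
  using assms(1,2)
proof (induction "m1 - i + j" arbitrary: i j rule: less_induct)
  case less
  show ?case
  proof (rule step)
    show "P k j" if "i < k" "k < m1" for k
      using that less.prems by (intro less.hyps) auto
    show "P i k" if "k < j" for k
      using that less.prems by (intro less.hyps) auto
  qed (use less.prems in auto)
qed

lemma
  fixes R M T :: "complex mat"
  assumes "R \<in> carrier_mat m1 m1" "upper_triangular R" "T \<in> carrier_mat m2 m2" "upper_triangular T"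
    "M \<in> carrier_mat m1 m2" "i < m1" "j < m2"
  shows triangular_mult_left_index:
      "(R * M) $$ (i, j) = R $$ (i, i) * M $$ (i, j) + (\<Sum>k\<in>{i<..<m1}. R $$ (i, k) * M $$ (k, j))"
    and triangular_mult_right_index:
      "(M * T) $$ (i, j) = M $$ (i, j) * T $$ (j, j) + (\<Sum>k<j. M $$ (i, k) * T $$ (k, j))"
proof -
  have "(R * M) $$ (i, j) = (\<Sum>k<m1. R $$ (i, k) * M $$ (k, j))"
    using assms by (intro index_mult_mat_sum) auto
  also have "\<dots> = (\<Sum>k\<in>insert i {i<..<m1}. R $$ (i, k) * M $$ (k, j))"
    by (rule sum.mono_neutral_right) (use assms in \<open>auto simp: upper_triangular_def not_less less_le\<close>)
  finally show "(R * M) $$ (i, j) = R $$ (i, i) * M $$ (i, j) + (\<Sum>k\<in>{i<..<m1}. R $$ (i, k) * M $$ (k, j))"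
    by simp
  have "(M * T) $$ (i, j) = (\<Sum>k<m2. M $$ (i, k) * T $$ (k, j))"
    using assms by (intro index_mult_mat_sum) auto
  also have "\<dots> = (\<Sum>k\<in>insert j {..<j}. M $$ (i, k) * T $$ (k, j))"
    by (rule sum.mono_neutral_right) (use assms in \<open>auto simp: upper_triangular_def not_less less_le\<close>)
  finally show "(M * T) $$ (i, j) = M $$ (i, j) * T $$ (j, j) + (\<Sum>k<j. M $$ (i, k) * T $$ (k, j))"
    by simp
qed

lemma
  fixes P1 Q1 R P2 Q2 T M :: "complex mat"
  assumes [simp]: "P1 \<in> carrier_mat m1 m1" "Q1 \<in> carrier_mat m1 m1" "R \<in> carrier_mat m1 m1"
    "P2 \<in> carrier_mat m2 m2" "Q2 \<in> carrier_mat m2 m2" "T \<in> carrier_mat m2 m2"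
    "M \<in> carrier_mat m1 m2"
    and inv: "P1 * Q1 = 1\<^sub>m m1" "Q1 * P1 = 1\<^sub>m m1" "P2 * Q2 = 1\<^sub>m m2" "Q2 * P2 = 1\<^sub>m m2"
  shows conjugate_mult_left: "Q1 * (P1 * R * Q1 * M) * P2 = R * (Q1 * M * P2)"
    and conjugate_mult_right: "Q1 * (M * (P2 * T * Q2)) * P2 = Q1 * M * P2 * T"
    and conjugate_cancel: "P1 * (Q1 * M * P2) * Q2 = M"
proof -
  have QM: "Q1 * M \<in> carrier_mat m1 m2" by (rule mult_carrier_mat[of _ m1 m1]) auto
  have RQM: "R * (Q1 * M) \<in> carrier_mat m1 m2" by (rule mult_carrier_mat[of _ m1 m1]) (use QM in auto)
  have "P1 * R * Q1 * M = P1 * (R * (Q1 * M))"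
    using assoc_mult_mat[of "P1 * R" m1 m1 Q1 m1 M m2] assoc_mult_mat[of P1 m1 m1 R m1 "Q1 * M" m2] QM
      mult_carrier_mat[of P1 m1 m1 R m1] by simp
  then have "Q1 * (P1 * R * Q1 * M) = (Q1 * P1) * (R * (Q1 * M))"
    using assoc_mult_mat[of Q1 m1 m1 P1 m1 "R * (Q1 * M)" m2] RQM by simp
  also have "\<dots> = R * (Q1 * M)" unfolding inv by (rule left_mult_one_mat[OF RQM])
  finally show "Q1 * (P1 * R * Q1 * M) * P2 = R * (Q1 * M * P2)"
    using assoc_mult_mat[of R m1 m1 "Q1 * M" m2 P2 m2] QM by simp
  have MP: "M * P2 \<in> carrier_mat m1 m2" by (rule mult_carrier_mat[of _ m1 m2]) auto
  have MPT: "M * P2 * T \<in> carrier_mat m1 m2" by (rule mult_carrier_mat[of _ m1 m2]) (use MP in auto)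
  have TQ: "T * Q2 \<in> carrier_mat m2 m2" by (rule mult_carrier_mat[of _ m2 m2]) auto
  have "M * (P2 * T * Q2) = M * P2 * T * Q2"
    using assoc_mult_mat[of M m1 m2 P2 m2 "T * Q2" m2] assoc_mult_mat[of P2 m2 m2 T m2 Q2 m2]
      assoc_mult_mat[of "M * P2" m1 m2 T m2 Q2 m2] TQ MP by simp
  then have "Q1 * (M * (P2 * T * Q2)) * P2 = Q1 * (M * P2 * T * (Q2 * P2))"
    using assoc_mult_mat[of Q1 m1 m1 "M * P2 * T * Q2" m2 P2 m2]
      assoc_mult_mat[of "M * P2 * T" m1 m2 Q2 m2 P2 m2] MPT
      mult_carrier_mat[OF MPT, of Q2 m2] by simp
  also have "\<dots> = Q1 * (M * P2 * T)" unfolding inv right_mult_one_mat[OF MPT] ..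
  also have "\<dots> = Q1 * M * P2 * T"
    using assoc_mult_mat[of Q1 m1 m1 "M * P2" m2 T m2] assoc_mult_mat[of Q1 m1 m1 M m2 P2 m2] MP by simp
  finally show "Q1 * (M * (P2 * T * Q2)) * P2 = Q1 * M * P2 * T" .
  have "P1 * (Q1 * M * P2) * Q2 = P1 * (Q1 * M * P2 * Q2)"
    using assoc_mult_mat[of P1 m1 m1 "Q1 * M * P2" m2 Q2 m2] mult_carrier_mat[OF QM, of P2 m2] by simp
  also have "Q1 * M * P2 * Q2 = Q1 * M"
    using assoc_mult_mat[of "Q1 * M" m1 m2 P2 m2 Q2 m2] QM
    by (simp add: inv right_mult_one_mat[OF QM])
  also have "P1 * (Q1 * M) = M"
    using assoc_mult_mat[of P1 m1 m1 Q1 m1 M m2] by (simp add: inv left_mult_one_mat[of M m1 m2])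
  finally show "P1 * (Q1 * M * P2) * Q2 = M" .
qed

section \<open>Power series with a bounded continuation\<close>

lemma bounded_image_mult:
  fixes f g :: "'a \<Rightarrow> complex"
  assumes "bounded (f ` S)" "bounded (g ` S)"
  shows "bounded ((\<lambda>x. f x * g x) ` S)"
proof -
  obtain A B where "\<And>x. x \<in> S \<Longrightarrow> cmod (f x) \<le> A" "\<And>x. x \<in> S \<Longrightarrow> cmod (g x) \<le> B"
    using assms by (auto simp: bounded_iff)
  then have "cmod (f x * g x) \<le> A * B" if "x \<in> S" for x
    using that by (auto simp: norm_mult intro!: mult_mono order.trans[OF norm_ge_zero])
  then show ?thesis by (auto simp: bounded_iff)
qed

lemma bounded_image_cmult:
  fixes f :: "'a \<Rightarrow> complex"
  shows "bounded (f ` S) \<Longrightarrow> bounded ((\<lambda>x. c * f x) ` S)"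
  by (rule bounded_image_mult) (auto intro: boundedI[of _ "cmod c"])

lemma bounded_image_sum:
  fixes f :: "'b \<Rightarrow> 'a \<Rightarrow> complex"
  shows "(\<And>l. l \<in> A \<Longrightarrow> bounded (f l ` S)) \<Longrightarrow> bounded ((\<lambda>x. \<Sum>l\<in>A. f l x) ` S)"
  by (induction A rule: infinite_finite_induct)
     (auto intro: bounded_plus_comp boundedI[of _ 0])

text \<open>
  Boundedness on \<open>\<Omega>\<close> plays the part of the growth condition: it is stronger, and it is stable under
  the operations by which the triangular system is solved.
\<close>
definition bounded_continuation :: "complex set \<Rightarrow> complex set \<Rightarrow> complex fps \<Rightarrow> (complex \<Rightarrow> complex) \<Rightarrow> bool" where
  "bounded_continuation P \<Omega> f g \<longleftrightarrow>
     g has_fps_expansion f \<and> g holomorphic_on - P \<and> bounded (g ` \<Omega>)"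

lemma bounded_continuation_0: "bounded_continuation P \<Omega> 0 (\<lambda>_. 0)"
  unfolding bounded_continuation_def by (auto intro!: boundedI[of _ 0])

lemma bounded_continuation_add:
  assumes "bounded_continuation P \<Omega> f1 g1" "bounded_continuation P \<Omega> f2 g2"
  shows "bounded_continuation P \<Omega> (f1 + f2) (\<lambda>z. g1 z + g2 z)"
  using assms unfolding bounded_continuation_def
  by (auto intro!: fps_expansion_intros holomorphic_intros bounded_plus_comp)

lemma bounded_continuation_cmult:
  assumes "bounded_continuation P \<Omega> f g"
  shows "bounded_continuation P \<Omega> (fps_const c * f) (\<lambda>z. c * g z)"
  using assms unfolding bounded_continuation_def
  by (auto intro!: fps_expansion_intros holomorphic_intros bounded_image_cmult)

lemma bounded_continuation_sum:
  assumes "\<And>k. k \<in> A \<Longrightarrow> bounded_continuation P \<Omega> (f k) (g k)"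
  shows "bounded_continuation P \<Omega> (\<Sum>k\<in>A. f k) (\<lambda>z. \<Sum>k\<in>A. g k z)"
  using assms
  by (induction A rule: infinite_finite_induct)
     (auto intro: bounded_continuation_0 bounded_continuation_add)

text \<open>
  One step of the triangular system: \<open>f1\<close> and \<open>f2\<close> collect the entries that are already known,
  and \<open>w\<close> holds the polynomial inhomogeneity. Every term of the numerator is at most of order \<open>z ^ n\<close>
  relative to a bounded function, so the quotient stays bounded.
\<close>
lemma bounded_continuation_solve:
  assumes rc: "r \<noteq> 0"
    and P: "\<And>z. r = c * z ^ n \<Longrightarrow> z \<in> P"
    and \<Omega>: "\<And>k. k \<le> n \<Longrightarrow> bounded ((\<lambda>z. z ^ k / (r - c * z ^ n)) ` \<Omega>)"
    and n: "n > 0"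
    and eq: "(fps_const r - fps_const c * fps_X ^ n) * f =
               (\<Sum>l<n. fps_const (w l) * fps_X ^ l) + f1 + fps_X ^ n * f2"
    and f12: "bounded_continuation P \<Omega> f1 g1" "bounded_continuation P \<Omega> f2 g2"
  shows "bounded_continuation P \<Omega> f
           (\<lambda>z. ((\<Sum>l<n. w l * z ^ l) + g1 z + z ^ n * g2 z) / (r - c * z ^ n))"
  unfolding bounded_continuation_def
proof (intro conjI)
  let ?D = "fps_const r - fps_const c * fps_X ^ n"
  have D0: "fps_nth ?D 0 \<noteq> 0" using rc n by simp
  then have D: "?D \<noteq> 0" by (metis fps_zero_nth)
  have "(\<lambda>z. ((\<Sum>l<n. w l * z ^ l) + g1 z + z ^ n * g2 z) / (r - c * z ^ n)) has_fps_expansion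
      ((\<Sum>l<n. fps_const (w l) * fps_X ^ l) + f1 + fps_X ^ n * f2) / ?D"
    using f12 D0 unfolding bounded_continuation_def by (intro fps_expansion_intros) auto
  also have "((\<Sum>l<n. fps_const (w l) * fps_X ^ l) + f1 + fps_X ^ n * f2) / ?D = f"
    unfolding eq[symmetric] using D by simp
  finally show "(\<lambda>z. ((\<Sum>l<n. w l * z ^ l) + g1 z + z ^ n * g2 z) / (r - c * z ^ n)) has_fps_expansion f" .
  show "(\<lambda>z. ((\<Sum>l<n. w l * z ^ l) + g1 z + z ^ n * g2 z) / (r - c * z ^ n)) holomorphic_on - P"
    using f12 P unfolding bounded_continuation_def by (intro holomorphic_intros) auto
  have "bounded ((\<lambda>z. \<Sum>l<n. w l * (z ^ l / (r - c * z ^ n))) ` \<Omega>)"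
    by (intro bounded_image_sum bounded_image_cmult \<Omega>) auto
  moreover have "bounded ((\<lambda>z. g1 z * (z ^ 0 / (r - c * z ^ n)) + g2 z * (z ^ n / (r - c * z ^ n))) ` \<Omega>)"
    using f12 unfolding bounded_continuation_def
    by (intro bounded_plus_comp bounded_image_mult \<Omega>) auto
  ultimately have "bounded ((\<lambda>z. (\<Sum>l<n. w l * (z ^ l / (r - c * z ^ n))) +
      (g1 z * (z ^ 0 / (r - c * z ^ n)) + g2 z * (z ^ n / (r - c * z ^ n)))) ` \<Omega>)"
    by (rule bounded_plus_comp)
  also have "(\<lambda>z. (\<Sum>l<n. w l * (z ^ l / (r - c * z ^ n))) +
      (g1 z * (z ^ 0 / (r - c * z ^ n)) + g2 z * (z ^ n / (r - c * z ^ n)))) =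
      (\<lambda>z. ((\<Sum>l<n. w l * z ^ l) + g1 z + z ^ n * g2 z) / (r - c * z ^ n))"
    by (simp add: add_divide_distrib sum_divide_distrib mult.commute add.assoc)
  finally show "bounded ((\<lambda>z. ((\<Sum>l<n. w l * z ^ l) + g1 z + z ^ n * g2 z) / (r - c * z ^ n)) ` \<Omega>)" .
qed

text \<open>
  Near infinity the quotient stays bounded, since \<open>k \<le> n\<close>; what remains of the plane is
  compact and contains no zero of the denominator.
\<close>
lemma bounded_off_discs:
  fixes r c :: complex
  assumes \<delta>: "\<delta> > 0" and c: "c \<noteq> 0" and n: "n > 0" and k: "k \<le> n"
    and P: "\<And>z. r = c * z ^ n \<Longrightarrow> z \<in> P"
  shows "bounded ((\<lambda>z. z ^ k / (r - c * z ^ n)) ` (- (\<Union>x\<in>P. cball x \<delta>)))"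
proof -
  \<comment> \<open>For \<open>cmod z > \<rho>\<close> the term \<open>c * z ^ n\<close> has at least twice the modulus of \<open>r\<close>.\<close>
  define \<rho> where "\<rho> = 1 + 2 * cmod r / cmod c"
  define K where "K = cball 0 \<rho> - (\<Union>x\<in>P. ball x \<delta>)"
  have "compact K" unfolding K_def by (intro compact_diff open_UN) auto
  moreover have "continuous_on K (\<lambda>z. z ^ k / (r - c * z ^ n))"
    using P \<delta> by (intro continuous_intros) (force simp: K_def)
  ultimately have "bounded ((\<lambda>z. z ^ k / (r - c * z ^ n)) ` K)"
    by (intro compact_imp_bounded compact_continuous_image)
  then obtain B where B: "\<And>z. z \<in> K \<Longrightarrow> cmod (z ^ k / (r - c * z ^ n)) \<le> B"
    by (auto simp: bounded_iff)
  have far: "cmod (z ^ k / (r - c * z ^ n)) \<le> 2 / cmod c" if "cmod z > \<rho>" for z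
  proof -
      have "0 \<le> 2 * cmod r / cmod c" by simp
    then have z1: "1 \<le> cmod z" using that unfolding \<rho>_def by linarith
    have "2 * cmod r / cmod c \<le> cmod z" using that by (simp add: \<rho>_def)
    also have "\<dots> \<le> cmod z ^ n" using z1 n by (intro self_le_power) auto
    finally have "2 * cmod r \<le> cmod c * cmod z ^ n" using c by (simp add: field_simps)
    moreover have "cmod c * cmod z ^ n - cmod r \<le> cmod (r - c * z ^ n)"
      using norm_triangle_ineq2[of "c * z ^ n" r] by (simp add: norm_mult norm_power norm_minus_commute)
    ultimately have *: "cmod c * cmod z ^ n \<le> 2 * cmod (r - c * z ^ n)" by linarith
    have pos: "0 < cmod c * cmod z ^ n" using c z1 by (intro mult_pos_pos zero_less_power) auto
    have "cmod z ^ k * cmod c \<le> cmod z ^ n * cmod c"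
      using z1 k by (intro mult_right_mono power_increasing) auto
    with * have "cmod z ^ k * cmod c \<le> 2 * cmod (r - c * z ^ n)" by (simp add: mult.commute)
    moreover have "0 < cmod (r - c * z ^ n)" using * pos by linarith
    ultimately show ?thesis using c by (simp add: norm_divide norm_power divide_simps)
  qed
  have "cmod (z ^ k / (r - c * z ^ n)) \<le> max B (2 / cmod c)"
    if "z \<in> - (\<Union>x\<in>P. cball x \<delta>)" for z
  proof (cases "cmod z > \<rho>")
    case True
    then show ?thesis using far[of z] by simp
  next
    case False
    then have "z \<in> K" using that by (force simp: K_def)
    then show ?thesis using B[of z] by simp
  qed
  then show ?thesis unfolding bounded_iff by blast
qed

section \<open>A domain that contains the discs around the orbit\<close>

text \<open>
  Removing an open ball with \<open>cball a s \<subseteq> S\<close> keeps \<open>S\<close> connected. The set in question is the union of such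
  differences over all \<open>s > r\<close> close to \<open>r\<close>, and these share the points of the largest sphere.
\<close>
lemma connected_open_diff_cball:
  fixes S :: "'a :: euclidean_space set"
  assumes S: "open S" "connected S" and sub: "cball a r \<subseteq> S" and r: "r > 0" and dim: "2 \<le> DIM('a)"
  shows "connected (S - cball a r)"
proof -
  have "cball a r \<noteq> {}" using r by simp
  then obtain e where "e > 0" "{x. infdist x (cball a r) \<le> e} \<subseteq> S"
    by (rule compact_in_open_separated[OF _ compact_cball S(1) sub])
  then have e: "e > 0" "\<And>x. infdist x (cball a r) \<le> e \<Longrightarrow> x \<in> S" by auto
  define R where "R = r + e"
  have R: "R > r" using e by (simp add: R_def)
  have subR: "cball a R \<subseteq> S"
  proof
    fix x assume x: "x \<in> cball a R"
    show "x \<in> S"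
    proof (cases "x \<in> cball a r")
      case False
      then have d: "dist a x > r" by simp
      then have ax: "a \<noteq> x" using r by auto
      define y where "y = a + (r / dist a x) *\<^sub>R (x - a)"
      have "dist a y = r" using d r ax by (simp add: y_def dist_norm norm_minus_commute)
      moreover have "dist x y = dist a x - r"
      proof -
        have "x - y = (1 - r / dist a x) *\<^sub>R (x - a)" by (simp add: y_def algebra_simps)
        then have "dist x y = \<bar>1 - r / dist a x\<bar> * dist a x"
          by (simp add: dist_norm norm_minus_commute)
        also have "\<dots> = dist a x - r" using d r ax by (simp add: abs_if field_simps)
        finally show ?thesis .
      qed
      ultimately have "infdist x (cball a r) \<le> dist a x - r"
        by (metis dist_commute infdist_le mem_cball order_refl)
      also have "\<dots> \<le> e" using x by (simp add: R_def)
      finally show ?thesis by (rule e)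
    qed (use sub in auto)
  qed
  have conn: "connected (S - ball a s)" if "r < s" "s \<le> R" for s
    by (rule connected_diff_ball) (use S that subR dim in auto)
  have "x \<in> \<Union>{S - ball a s |s. r < s \<and> s \<le> R}" if "x \<in> S - cball a r" for x
    using that R by (intro UnionI[of "S - ball a (min R (dist a x))"]) auto
  then have "S - cball a r = \<Union>{S - ball a s |s. r < s \<and> s \<le> R}"
    by auto
  moreover have "connected (\<Union>{S - ball a s |s. r < s \<and> s \<le> R})"
  proof (rule connected_Union)
    obtain b :: 'a where b: "b \<in> Basis" using nonempty_Basis by blast
    have "a + R *\<^sub>R b \<in> cball a R - ball a R" using b R r by (simp add: dist_norm)
    then have "a + R *\<^sub>R b \<in> \<Inter>{S - ball a s |s. r < s \<and> s \<le> R}" using subR by auto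
    then show "\<Inter>{S - ball a s |s. r < s \<and> s \<le> R} \<noteq> {}" by blast
  qed (use conn in auto)
  ultimately show ?thesis by simp
qed

lemma connected_compl_disjoint_cballs:
  fixes P :: "'a :: euclidean_space set"
  assumes "finite P" "\<delta> > 0" "2 \<le> DIM('a)" "\<And>x y. x \<in> P \<Longrightarrow> y \<in> P \<Longrightarrow> x \<noteq> y \<Longrightarrow> 2 * \<delta> < dist x y"
  shows "connected (- (\<Union>x\<in>P. cball x \<delta>))"
  using assms(1,4)
proof (induction P rule: finite_induct)
  case empty
  show ?case by (simp add: convex_connected)
next
  case (insert a P)
  have "cball a \<delta> \<inter> cball x \<delta> = {}" if "x \<in> P" for x
  proof -
    have *: "2 * \<delta> < dist a x" using insert that by auto
    have False if "z \<in> cball a \<delta>" "z \<in> cball x \<delta>" for z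
      using that * dist_triangle2[of a x z] by auto
    then show ?thesis by blast
  qed
  then have "connected (- (\<Union>x\<in>P. cball x \<delta>) - cball a \<delta>)"
    using insert assms by (intro connected_open_diff_cball open_Compl closed_UN) auto
  moreover have "- (\<Union>x\<in>P. cball x \<delta>) - cball a \<delta> = - (\<Union>x\<in>insert a P. cball x \<delta>)"
    by blast
  ultimately show ?case by (simp only:)
qed

text \<open>
  The orbit tends to infinity in one direction and to \<open>0\<close> in the other, so all but finitely many of
  its points have distance at least \<open>1/2\<close> from \<open>1\<close>.
\<close>
lemma powi_orbit_separated:
  assumes p: "1 < cmod p" and a: "a \<noteq> 0" "\<And>k::int. a * p powi k \<noteq> 1"
  obtains c where "c > 0" "\<And>k::int. c \<le> cmod (a * p powi k - 1)"
proof -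
  \<comment> \<open>Beyond \<open>N1\<close> the modulus of \<open>a * p powi k\<close> is at least \<open>2\<close>, before \<open>- N2\<close> it is at most \<open>1/2\<close>.\<close>
  obtain N1 where N1: "2 / cmod a < cmod p ^ N1" using real_arch_pow[OF p] by blast
  obtain N2 where N2: "2 * cmod a < cmod p ^ N2" using real_arch_pow[OF p] by blast
  define I where "I = {- int N2..int N1}"
  define c where "c = Min (insert (1/2) ((\<lambda>k. cmod (a * p powi k - 1)) ` I))"
  have fin: "finite (insert (1/2) ((\<lambda>k. cmod (a * p powi k - 1)) ` I))" by (simp add: I_def)
  have "c > 0" unfolding c_def using fin a by (subst Min_gr_iff) auto
  moreover have "c \<le> cmod (a * p powi k - 1)" for k
  proof -
    have c_half: "c \<le> 1/2" unfolding c_def using fin by (intro Min_le) auto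
    consider "k \<in> I" | "k > int N1" | "k < - int N2" by (force simp: I_def)
    then show ?thesis
    proof cases
      case 1
      then show ?thesis unfolding c_def using fin by (intro Min_le) auto
    next
      case 2
      have "cmod p ^ N1 \<le> cmod p powi k"
        using power_int_increasing[of "int N1" k "cmod p"] 2 p by simp
      then have "2 / cmod a \<le> cmod p powi k" using N1 by linarith
      then have "2 \<le> cmod (a * p powi k)"
        using a by (simp add: norm_mult norm_power_int divide_le_eq mult.commute)
      then show ?thesis using c_half norm_triangle_ineq2[of "a * p powi k" 1] by simp
    next
      case 3
      have "cmod p ^ N2 \<le> cmod p powi (- k)"
        using power_int_increasing[of "int N2" "- k" "cmod p"] 3 p by simp
      then have le: "2 * cmod a \<le> cmod p powi (- k)" using N2 by linarith
      have "cmod a * cmod p powi k * 2 \<le> cmod p powi (- k) * cmod p powi k"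
        using mult_right_mono[OF le, of "cmod p powi k"] by (simp add: mult_ac)
      also have "\<dots> = 1" using p by (subst power_int_add[symmetric]) auto
      finally have "cmod (a * p powi k) \<le> 1/2" by (simp add: norm_mult norm_power_int)
      then show ?thesis using c_half norm_triangle_ineq2[of 1 "a * p powi k"]
        by (simp add: norm_minus_commute)
    qed
  qed
  ultimately show ?thesis by (rule that)
qed

text \<open>
  The disc around \<open>lam * p powi k\<close> has a radius proportional to the modulus of its centre, so the
  separation of \<open>x\<close> from the orbit is needed in relative form. If a disc met the ball around \<open>x\<close>, then
  its centre would be so small, of order \<open>\<delta>\<close>, that the disc could not reach \<open>x\<close>.
\<close>
lemma orbit_discs_avoid_cball:
  assumes p: "1 < cmod p" and lam: "lam \<noteq> 0" and x: "x \<noteq> 0" "\<And>k::int. x \<noteq> lam * p powi k"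
  shows "eventually (\<lambda>\<delta>. \<forall>k::int. \<forall>z. cmod (z - lam * p powi k) < \<delta> * cmod (lam * p powi k) \<longrightarrow>
           z \<notin> cball x \<delta>) (at_right 0)"
proof -
  have p0: "p \<noteq> 0" using p by auto
  have "x / lam * p powi k \<noteq> 1" for k
  proof
    assume "x / lam * p powi k = 1"
    then have "x = lam * p powi (- k)"
      using lam p0 by (simp add: power_int_minus field_simps)
    with x show False by blast
  qed
  then obtain c where c: "c > 0" "\<And>k::int. c \<le> cmod (x / lam * p powi k - 1)"
    using powi_orbit_separated[OF p, of "x / lam"] x lam by auto
  have sep: "c * cmod (lam * p powi k) \<le> cmod (x - lam * p powi k)" for k
  proof -
    have "x - lam * p powi k = lam * p powi k * (x / lam * p powi (- k) - 1)"
      using lam p0 by (simp add: power_int_minus field_simps)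
    then have "cmod (x - lam * p powi k) = cmod (lam * p powi k) * cmod (x / lam * p powi (- k) - 1)"
      by (simp only: norm_mult)
    also have "\<dots> \<ge> cmod (lam * p powi k) * c"
      by (intro mult_left_mono c) auto
    finally show ?thesis by (simp add: mult.commute)
  qed
  \<comment> \<open>Let \<open>A\<close> be the modulus of the centre of a disc that meets \<open>cball x \<delta>\<close>. The first bound gives
    \<open>2 * A \<le> 4 * \<delta> / c\<close>, the second bounds the radius of the disc by \<open>A\<close>, and then the modulus of \<open>x\<close> is
    at most \<open>\<delta> + 2 * A\<close>, against the third bound.\<close>
  define b where "b = Min {c / 2, 1, cmod x / (1 + 4 / c)}"
  have pos: "0 < 1 + 4 / c" using c by (intro add_pos_pos divide_pos_pos) auto
  have b: "b > 0" unfolding b_def using c x pos by (auto intro!: divide_pos_pos)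
  have main: "z \<notin> cball x \<delta>"
    if \<delta>: "0 < \<delta>" "\<delta> < b" and z: "cmod (z - lam * p powi k) < \<delta> * cmod (lam * p powi k)" for \<delta> k z
  proof
    assume zx: "z \<in> cball x \<delta>"
    define A where "A = cmod (lam * p powi k)"
    have b': "\<delta> < c / 2" "\<delta> < 1" "\<delta> < cmod x / (1 + 4 / c)" using \<delta> by (auto simp: b_def)
    have xz: "cmod (x - z) \<le> \<delta>" using zx by (simp add: dist_norm)
    have A0: "A \<ge> 0" by (simp add: A_def)
    have "cmod (x - lam * p powi k) \<le> cmod (x - z) + cmod (z - lam * p powi k)"
      using norm_triangle_ineq[of "x - z" "z - lam * p powi k"] by simp
    with sep[of k] xz z have 1: "c * A \<le> \<delta> + \<delta> * A" unfolding A_def by linarith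
    have "\<delta> * A \<le> c / 2 * A" using b' A0 by (intro mult_right_mono) auto
    with 1 have "c * A \<le> 2 * \<delta>" by (simp add: field_simps)
    then have A: "2 * A \<le> \<delta> * 4 / c" using c by (simp add: field_simps)
    have "cmod x \<le> cmod (x - z) + cmod (z - lam * p powi k) + A"
      using norm_triangle_ineq[of "x - z" z] norm_triangle_ineq[of "z - lam * p powi k" "lam * p powi k"]
      by (simp add: A_def)
    also have "\<dots> \<le> \<delta> + \<delta> * A + A" using xz z by (simp add: A_def)
    also have "\<dots> \<le> \<delta> + 1 * A + A" using b' A0 by (intro add_mono mult_right_mono) auto
    also have "\<dots> \<le> \<delta> * (1 + 4 / c)" using A by (simp add: distrib_left)
    also have "\<dots> < cmod x" using b'(3) pos by (simp add: pos_less_divide_eq)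
    finally show False by simp
  qed
  show ?thesis
    unfolding eventually_at_right_field using b main by (intro exI[of _ b]) auto
qed

text \<open>
  The domain on which the Borel transform is bounded: the plane without small closed discs around
  the poles.
\<close>
lemma ex_disc_domain:
  assumes p: "1 < cmod p" and lam: "lam \<noteq> 0" and P: "finite P" "0 \<notin> P"
    and avoid: "\<And>k::int. lam * p powi k \<notin> P"
  obtains \<delta> where "\<delta> > 0" "connected (- (\<Union>x\<in>P. cball x \<delta>))"
    "\<And>k z. cmod (z - lam * p powi k) < \<delta> * cmod (lam * p powi k) \<Longrightarrow> z \<in> - (\<Union>x\<in>P. cball x \<delta>)"
proof -
  have "eventually (\<lambda>\<delta>. \<forall>x\<in>P. \<forall>k::int. \<forall>z. cmod (z - lam * p powi k) < \<delta> * cmod (lam * p powi k) \<longrightarrow>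
           z \<notin> cball x \<delta>) (at_right 0)"
  proof (intro eventually_ball_finite ballI P)
    fix x assume "x \<in> P"
    with P avoid have "x \<noteq> 0" "\<And>k::int. x \<noteq> lam * p powi k" by auto
    then show "eventually (\<lambda>\<delta>. \<forall>k::int. \<forall>z. cmod (z - lam * p powi k) < \<delta> * cmod (lam * p powi k) \<longrightarrow>
           z \<notin> cball x \<delta>) (at_right 0)"
      by (rule orbit_discs_avoid_cball[OF p lam])
  qed
  moreover have "eventually (\<lambda>\<delta>. \<forall>x\<in>P. \<forall>y\<in>P. x \<noteq> y \<longrightarrow> 2 * \<delta> < dist x y) (at_right 0)"
  proof (intro eventually_ball_finite ballI P)
    fix x y assume "x \<in> P" "y \<in> P"
    show "eventually (\<lambda>\<delta>. x \<noteq> y \<longrightarrow> 2 * \<delta> < dist x y) (at_right 0)"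
    proof (cases "x = y")
      case False
      then show ?thesis
        unfolding eventually_at_right_field by (intro exI[of _ "dist x y / 2"]) auto
    qed auto
  qed
  moreover have "eventually (\<lambda>\<delta>::real. \<delta> > 0) (at_right 0)"
    by (rule eventually_at_right_less)
  ultimately have "eventually (\<lambda>\<delta>. (\<forall>x\<in>P. \<forall>k::int. \<forall>z.
      cmod (z - lam * p powi k) < \<delta> * cmod (lam * p powi k) \<longrightarrow> z \<notin> cball x \<delta>) \<and>
      (\<forall>x\<in>P. \<forall>y\<in>P. x \<noteq> y \<longrightarrow> 2 * \<delta> < dist x y) \<and> \<delta> > 0) (at_right 0)"
    by eventually_elim auto
  then obtain \<delta> where \<delta>: "\<forall>x\<in>P. \<forall>k::int. \<forall>z.
      cmod (z - lam * p powi k) < \<delta> * cmod (lam * p powi k) \<longrightarrow> z \<notin> cball x \<delta>"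
      "\<forall>x\<in>P. \<forall>y\<in>P. x \<noteq> y \<longrightarrow> 2 * \<delta> < dist x y" "\<delta> > 0"
    using eventually_happens'[OF trivial_limit_at_right_real] by blast
  have "connected (- (\<Union>x\<in>P. cball x \<delta>))"
    by (rule connected_compl_disjoint_cballs) (use P \<delta> in auto)
  with \<delta> show ?thesis by (intro that[of \<delta>]) auto
qed

section \<open>The Borel transform is rational\<close>

lemma finite_nth_root_eqs:
  fixes r c :: complex
  assumes "n > 0" "c \<noteq> 0"
  shows "finite {z. r = c * z ^ n}"
proof -
  have "z ^ n = r / c" if "r = c * z ^ n" for z
    using that assms(2) by simp
  then have "{z. r = c * z ^ n} \<subseteq> {z. z ^ n = r / c}" by blast
  then show ?thesis using finite_nth_roots[OF assms(1)] by (rule finite_subset)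
qed

text \<open>
  In the bases that triangularise \<open>C1\<close> and \<open>C2\<close> the entry \<open>(i, j)\<close> of the generating function is
  multiplied by \<open>R $$ (i, i) - s * T $$ (j, j) * z ^ n\<close>, up to entries treated before. The set \<open>P\<close>
  consists of the zeros of these factors, and nonresonance is what keeps the orbit away from it.
\<close>
lemma borel_continuation:
  fixes B W :: "nat \<Rightarrow> complex mat"
  assumes p: "1 < cmod p" and n: "n > 0" and s: "s \<noteq> 0" and lam: "lam \<noteq> 0"
    and C1: "C1 \<in> carrier_mat m1 m1" "0 \<notin> spectrum C1"
    and C2: "C2 \<in> carrier_mat m2 m2" "0 \<notin> spectrum C2"
    and B: "\<And>l. B l \<in> carrier_mat m1 m2" and W: "\<And>l. W l \<in> carrier_mat m1 m2"
    and eq: "\<And>l. C1 * B l = (if l < n then - W l else s \<cdot>\<^sub>m (B (l - n) * C2))"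
    and nonres: "\<And>\<alpha>1 \<alpha>2 k. \<alpha>1 \<in> spectrum C1 \<Longrightarrow> \<alpha>2 \<in> spectrum C2 \<Longrightarrow>
                   \<alpha>1 \<noteq> s * \<alpha>2 * (lam * p powi k) ^ n"
  obtains P \<delta> g where "finite P" "0 \<notin> P" "\<And>k::int. lam * p powi k \<notin> P" "\<delta> > 0"
    "connected (- (\<Union>x\<in>P. cball x \<delta>))"
    "\<And>k z. cmod (z - lam * p powi k) < \<delta> * cmod (lam * p powi k) \<Longrightarrow> z \<in> - (\<Union>x\<in>P. cball x \<delta>)"
    "\<And>i j. i < m1 \<Longrightarrow> j < m2 \<Longrightarrow>
       bounded_continuation P (- (\<Union>x\<in>P. cball x \<delta>)) (Abs_fps (\<lambda>l. B l $$ (i, j))) (g i j)"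
proof -
  obtain P1 Q1 R where R: "P1 \<in> carrier_mat m1 m1" "Q1 \<in> carrier_mat m1 m1" "R \<in> carrier_mat m1 m1"
    "P1 * Q1 = 1\<^sub>m m1" "Q1 * P1 = 1\<^sub>m m1" "C1 = P1 * R * Q1" "upper_triangular R"
    "\<And>i. i < m1 \<Longrightarrow> R $$ (i, i) \<in> spectrum C1"
    using complex_mat_triangularise[OF C1(1)] by blast
  obtain P2 Q2 T where T: "P2 \<in> carrier_mat m2 m2" "Q2 \<in> carrier_mat m2 m2" "T \<in> carrier_mat m2 m2"
    "P2 * Q2 = 1\<^sub>m m2" "Q2 * P2 = 1\<^sub>m m2" "C2 = P2 * T * Q2" "upper_triangular T"
    "\<And>i. i < m2 \<Longrightarrow> T $$ (i, i) \<in> spectrum C2"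
    using complex_mat_triangularise[OF C2(1)] by blast
  define P where "P = (\<Union>i<m1. \<Union>j<m2. {z. R $$ (i, i) = s * T $$ (j, j) * z ^ n})"
  have R0: "R $$ (i, i) \<noteq> 0" if "i < m1" for i using R(8)[OF that] C1(2) by metis
  have T0: "T $$ (i, i) \<noteq> 0" if "i < m2" for i using T(8)[OF that] C2(2) by metis
  have P: "finite P" unfolding P_def
    using T0 s n by (intro finite_UN_I finite_nth_root_eqs) auto
  have P0: "0 \<notin> P" unfolding P_def using R0 n by (simp add: zero_power)
  have Plam: "lam * p powi k \<notin> P" for k
  proof
    assume "lam * p powi k \<in> P"
    then obtain i j where "i < m1" "j < m2" "R $$ (i, i) = s * T $$ (j, j) * (lam * p powi k) ^ n"
      by (auto simp: P_def)
    with nonres R(8) T(8) show False by blast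
  qed
  obtain \<delta> where \<delta>: "\<delta> > 0" "connected (- (\<Union>x\<in>P. cball x \<delta>))"
    "\<And>k z. cmod (z - lam * p powi k) < \<delta> * cmod (lam * p powi k) \<Longrightarrow> z \<in> - (\<Union>x\<in>P. cball x \<delta>)"
    using ex_disc_domain[OF p lam P P0 Plam] by blast
  define \<Omega> where "\<Omega> = - (\<Union>x\<in>P. cball x \<delta>)"
  define E where "E = (\<lambda>l. Q1 * B l * P2)"
  define V where "V = (\<lambda>l. Q1 * W l * P2)"
  have E: "E l \<in> carrier_mat m1 m2" for l
    unfolding E_def using R T B by (intro mult_carrier_mat[of _ m1 m2] mult_carrier_mat[of _ m1 m1]) auto
  have V: "V l \<in> carrier_mat m1 m2" for l
    unfolding V_def using R T W by (intro mult_carrier_mat[of _ m1 m2] mult_carrier_mat[of _ m1 m1]) auto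
  have Eeq: "R * E l = (if l < n then - V l else s \<cdot>\<^sub>m (E (l - n) * T))" for l
  proof -
    have "R * E l = Q1 * (C1 * B l) * P2"
      unfolding E_def R(6) by (rule conjugate_mult_left[symmetric]) (use R T B in auto)
    also have "\<dots> = (if l < n then - V l else s \<cdot>\<^sub>m (E (l - n) * T))"
    proof (cases "l < n")
      case True
      then have "Q1 * (C1 * B l) * P2 = Q1 * (- W l) * P2" by (simp add: eq)
      also have "\<dots> = - V l"
        unfolding V_def using R(2) T(1) W[of l] mult_carrier_mat[OF R(2) W[of l]]
        by simp
      finally show ?thesis using True by simp
    next
      case False
      have BC: "B (l - n) * C2 \<in> carrier_mat m1 m2" by (rule mult_carrier_mat[OF B C2(1)])
      have "Q1 * (C1 * B l) * P2 = Q1 * (s \<cdot>\<^sub>m (B (l - n) * C2)) * P2" using False by (simp add: eq)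
      also have "\<dots> = s \<cdot>\<^sub>m (Q1 * (B (l - n) * C2) * P2)"
        using mult_smult_distrib[OF R(2) BC, of s]
          mult_smult_assoc_mat[OF mult_carrier_mat[OF R(2) BC] T(1), of s] by simp
      also have "Q1 * (B (l - n) * C2) * P2 = E (l - n) * T"
        unfolding E_def T(6) by (rule conjugate_mult_right) (use R T B in auto)
      finally show ?thesis using False by simp
    qed
    finally show ?thesis .
  qed
  have "\<exists>g. bounded_continuation P \<Omega> (Abs_fps (\<lambda>l. E l $$ (i, j))) g" if "i < m1" "j < m2" for i j
    using that
  proof (induction rule: triangular_pair_induct)
    case (step i j)
    let ?f = "\<lambda>i j. Abs_fps (\<lambda>l. E l $$ (i, j))"
    have "\<exists>g. \<forall>k\<in>{i<..<m1}. bounded_continuation P \<Omega> (?f k j) (g k)"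
      using step(3) by (intro bchoice) auto
    then obtain g1 where g1: "\<And>k. k \<in> {i<..<m1} \<Longrightarrow> bounded_continuation P \<Omega> (?f k j) (g1 k)" by blast
    have "\<exists>g. \<forall>k\<in>{..<j}. bounded_continuation P \<Omega> (?f i k) (g k)"
      using step(4) by (intro bchoice) auto
    then obtain g2 where g2: "\<And>k. k \<in> {..<j} \<Longrightarrow> bounded_continuation P \<Omega> (?f i k) (g2 k)" by blast
    let ?F1 = "\<Sum>k\<in>{i<..<m1}. fps_const (- R $$ (i, k)) * ?f k j"
    let ?F2 = "\<Sum>k\<in>{..<j}. fps_const (s * T $$ (k, j)) * ?f i k"
    have F: "(fps_const (R $$ (i, i)) - fps_const (s * T $$ (j, j)) * fps_X ^ n) * ?f i j =
       (\<Sum>l<n. fps_const (- V l $$ (i, j)) * fps_X ^ l) + ?F1 + fps_X ^ n * ?F2"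
    proof (rule fps_ext)
      fix l
      have lhs: "fps_nth ((fps_const (R $$ (i, i)) - fps_const (s * T $$ (j, j)) * fps_X ^ n) * ?f i j) l =
         R $$ (i, i) * E l $$ (i, j) - (if l < n then 0 else s * T $$ (j, j) * E (l - n) $$ (i, j))"
        by (simp add: left_diff_distrib mult.assoc fps_X_power_mult_nth)
      have "(\<Sum>l<n. fps_const (- V l $$ (i, j)) * fps_X ^ l) =
          Abs_fps (\<lambda>l. if l < n then - V l $$ (i, j) else 0)"
        by (rule fps_ext) (simp add: fps_sum_nth fps_X_power_iff if_distrib[of "\<lambda>x. _ * x"] cong: if_cong)
      then have rhs: "fps_nth ((\<Sum>l<n. fps_const (- V l $$ (i, j)) * fps_X ^ l) + ?F1 + fps_X ^ n * ?F2) l =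
          (if l < n then - V l $$ (i, j) else 0) - (\<Sum>k\<in>{i<..<m1}. R $$ (i, k) * E l $$ (k, j)) +
          (if l < n then 0 else s * (\<Sum>k<j. E (l - n) $$ (i, k) * T $$ (k, j)))"
        by (simp add: fps_sum_nth fps_X_power_mult_nth sum_negf sum_distrib_left mult_ac)
      have left: "(R * E l) $$ (i, j) =
          R $$ (i, i) * E l $$ (i, j) + (\<Sum>k\<in>{i<..<m1}. R $$ (i, k) * E l $$ (k, j))"
        by (rule triangular_mult_left_index[OF R(3,7) T(3,7) E step(1,2)])
      have right: "(E (l - n) * T) $$ (i, j) =
          E (l - n) $$ (i, j) * T $$ (j, j) + (\<Sum>k<j. E (l - n) $$ (i, k) * T $$ (k, j))"
        by (rule triangular_mult_right_index[OF R(3,7) T(3,7) E step(1,2)])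
      have "(R * E l) $$ (i, j) =
          (if l < n then - V l $$ (i, j) else s * (E (l - n) * T) $$ (i, j))"
        unfolding Eeq[of l] using V[of l] E[of "l - n"] T(3) step(1,2)
        by (auto simp del: index_mult_mat(1))
      then have entry: "R $$ (i, i) * E l $$ (i, j) + (\<Sum>k\<in>{i<..<m1}. R $$ (i, k) * E l $$ (k, j)) =
          (if l < n then - V l $$ (i, j) else s * (E (l - n) $$ (i, j) * T $$ (j, j) +
             (\<Sum>k<j. E (l - n) $$ (i, k) * T $$ (k, j))))"
        unfolding left right .
      have arith: "a + b = (if Q then v else s * (y * t + c)) \<Longrightarrow>
          a - (if Q then 0 else s * t * y) = (if Q then v else 0) - b + (if Q then 0 else s * c)"
        for a b v y t c :: complex and Q
        by (simp add: algebra_simps split: if_splits)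
      show "fps_nth ((fps_const (R $$ (i, i)) - fps_const (s * T $$ (j, j)) * fps_X ^ n) * ?f i j) l =
          fps_nth ((\<Sum>l<n. fps_const (- V l $$ (i, j)) * fps_X ^ l) + ?F1 + fps_X ^ n * ?F2) l"
        unfolding lhs rhs by (rule arith[OF entry])
    qed
    have inP: "z \<in> P" if "R $$ (i, i) = s * T $$ (j, j) * z ^ n" for z
      using that step(1,2) by (auto simp: P_def)
    have "bounded_continuation P \<Omega> (?f i j)
        (\<lambda>z. ((\<Sum>l<n. - V l $$ (i, j) * z ^ l) + (\<Sum>k\<in>{i<..<m1}. - R $$ (i, k) * g1 k z) +
           z ^ n * (\<Sum>k\<in>{..<j}. s * T $$ (k, j) * g2 k z)) / (R $$ (i, i) - s * T $$ (j, j) * z ^ n))"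
    proof (rule bounded_continuation_solve[OF R0[OF step(1)] inP _ n F])
      show "bounded ((\<lambda>z. z ^ k / (R $$ (i, i) - s * T $$ (j, j) * z ^ n)) ` \<Omega>)" if "k \<le> n" for k
        unfolding \<Omega>_def
        by (rule bounded_off_discs[OF \<delta>(1) _ n that inP]) (use s T0 step(2) in auto)
      show "bounded_continuation P \<Omega> ?F1 (\<lambda>z. \<Sum>k\<in>{i<..<m1}. - R $$ (i, k) * g1 k z)"
        by (intro bounded_continuation_sum bounded_continuation_cmult g1)
      show "bounded_continuation P \<Omega> ?F2 (\<lambda>z. \<Sum>k\<in>{..<j}. s * T $$ (k, j) * g2 k z)"
        by (intro bounded_continuation_sum bounded_continuation_cmult g2)
    qed
    then show ?case by blast
  qed
  note ex = this
  define e where "e = (\<lambda>i j. SOME g. bounded_continuation P \<Omega> (Abs_fps (\<lambda>l. E l $$ (i, j))) g)"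
  have e: "bounded_continuation P \<Omega> (Abs_fps (\<lambda>l. E l $$ (i, j))) (e i j)" if "i < m1" "j < m2" for i j
    unfolding e_def using ex[OF that] by (rule someI_ex)
  define g where "g = (\<lambda>i j z. \<Sum>a<m1. P1 $$ (i, a) * (\<Sum>b<m2. Q2 $$ (b, j) * e a b z))"
  have "bounded_continuation P \<Omega> (Abs_fps (\<lambda>l. B l $$ (i, j))) (g i j)" if ij: "i < m1" "j < m2" for i j
  proof -
    have "bounded_continuation P \<Omega> (\<Sum>a<m1. fps_const (P1 $$ (i, a)) *
        (\<Sum>b<m2. fps_const (Q2 $$ (b, j)) * Abs_fps (\<lambda>l. E l $$ (a, b)))) (g i j)"
      unfolding g_def
      by (intro bounded_continuation_sum bounded_continuation_cmult e) auto
    also have "(\<Sum>a<m1. fps_const (P1 $$ (i, a)) *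
        (\<Sum>b<m2. fps_const (Q2 $$ (b, j)) * Abs_fps (\<lambda>l. E l $$ (a, b)))) = Abs_fps (\<lambda>l. B l $$ (i, j))"
    proof (rule fps_ext)
      fix l
      have PE: "P1 * E l \<in> carrier_mat m1 m2" by (rule mult_carrier_mat[OF R(1) E])
      have "B l = P1 * E l * Q2"
        unfolding E_def by (rule conjugate_cancel[symmetric]) (use R T B in auto)
      then have "B l $$ (i, j) = (\<Sum>b<m2. (P1 * E l) $$ (i, b) * Q2 $$ (b, j))"
        using index_mult_mat_sum[OF PE T(2) ij] by simp
      also have "\<dots> = (\<Sum>b<m2. (\<Sum>a<m1. P1 $$ (i, a) * E l $$ (a, b)) * Q2 $$ (b, j))"
        using index_mult_mat_sum[OF R(1) E] ij by (intro sum.cong) auto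
      also have "\<dots> = (\<Sum>a<m1. P1 $$ (i, a) * (\<Sum>b<m2. Q2 $$ (b, j) * E l $$ (a, b)))"
        by (simp add: sum_distrib_left sum_distrib_right mult_ac) (rule sum.swap)
      finally show "fps_nth (\<Sum>a<m1. fps_const (P1 $$ (i, a)) *
        (\<Sum>b<m2. fps_const (Q2 $$ (b, j)) * Abs_fps (\<lambda>l. E l $$ (a, b)))) l =
        fps_nth (Abs_fps (\<lambda>l. B l $$ (i, j))) l"
        by (simp add: fps_sum_nth)
    qed
    finally show ?thesis .
  qed
  with P P0 Plam \<delta> show ?thesis unfolding \<Omega>_def by (rule that)
qed

section \<open>The Laplace sum as a quotient of theta series\<close>

lemma has_sum_finite_sum:
  fixes f :: "'a \<Rightarrow> 'b \<Rightarrow> 'c :: topological_comm_monoid_add"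
  assumes "\<And>i. i \<in> I \<Longrightarrow> (f i has_sum S i) A"
  shows "((\<lambda>x. \<Sum>i\<in>I. f i x) has_sum (\<Sum>i\<in>I. S i)) A"
  using assms by (induction I rule: infinite_finite_induct) (auto intro: has_sum_add has_sum_0)

text \<open>
  The denominators of the Laplace sum at \<open>z\<close>, with \<open>w = z / lam\<close>.
\<close>
lemma Theta_at_orbit:
  assumes p: "1 < cmod p" and w: "w \<noteq> 0"
  shows "Theta p (p powi (k + 1) / w) = p powi tri k * w powi (- k) * Theta p w"
proof -
  have p0: "p \<noteq> 0" using p by auto
  \<comment> \<open>\<open>p powi (k + 1) / w = 1 / u\<close>, so that inversion and quasi-periodicity apply in turn.\<close>
  define u where "u = p powi (- (k + 1)) * w"
  have u: "u \<noteq> 0" using p0 w by (simp add: u_def)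
  have "p powi (k + 1) / w = 1 / u"
    unfolding u_def power_int_minus using p0 w by (simp add: divide_simps)
  then have "Theta p (p powi (k + 1) / w) = u * Theta p u"
    using Theta_inverse[OF p u] by simp
  also have "Theta p u = p powi tri (- (k + 1) - 1) * w powi (- (k + 1)) * Theta p w"
    unfolding u_def by (rule Theta_mult_base_powi[OF p w])
  also have "u * (p powi tri (- (k + 1) - 1) * w powi (- (k + 1)) * Theta p w) =
      (p powi (- (k + 1)) * p powi tri (k + 1)) * (w * w powi (- (k + 1))) * Theta p w"
    unfolding tri_reflect u_def by (simp add: mult_ac)
  also have "p powi (- (k + 1)) * p powi tri (k + 1) = p powi tri k"
    unfolding tri_step using p0 by (subst power_int_add[symmetric]) auto
  also have "w * w powi (- (k + 1)) = w powi (- k)"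
    using power_int_add[of w 1 "- (k + 1)"] w by simp
  finally show ?thesis .
qed

lemma laplace_sum:
  assumes p: "1 < cmod p" and w: "w \<noteq> 0"
  shows "(\<Sum>\<^sub>\<infinity>k\<in>UNIV. a k / Theta p (p powi (k + 1) / w)) = gauss_series p a w / Theta p w"
proof -
  have p0: "p \<noteq> 0" using p by auto
  have "(\<Sum>\<^sub>\<infinity>k\<in>UNIV. a k / Theta p (p powi (k + 1) / w)) =
      (\<Sum>\<^sub>\<infinity>k\<in>UNIV. a k * p powi (- tri k) * w powi k * (1 / Theta p w))"
    unfolding Theta_at_orbit[OF p w] using p0 w
    by (intro infsum_cong) (simp add: power_int_minus field_simps)
  also have "\<dots> = gauss_series p a w * (1 / Theta p w)"
    unfolding gauss_series_def by (rule infsum_cmult_left')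
  finally show ?thesis by simp
qed

text \<open>
  Replacing \<open>u\<close> by \<open>p ^ \<nu> * u\<close> multiplies the \<open>k\<close>-th term of a series by \<open>(p powi k) ^ \<nu>\<close>. So the
  hypothesis at \<open>k\<close>, multiplied by \<open>p powi (- tri k) * u powi k\<close>, is the \<open>k\<close>-th term of the conclusion.
\<close>
lemma gauss_series_equation:
  assumes p: "1 < cmod p" and lam: "lam \<noteq> 0" and u: "u \<noteq> 0"
    and f: "\<And>a. a \<in> A \<Longrightarrow> bounded (range (f a))" and g: "\<And>b. b \<in> B \<Longrightarrow> bounded (range (g b))"
    and eq: "\<And>k::int. (\<Sum>a\<in>A. \<alpha> a * f a k) + (\<Sum>\<nu><n. w \<nu> * (lam * p powi k) ^ \<nu>) =
        s * (lam * p powi k) ^ n * (\<Sum>b\<in>B. g b k * \<beta> b)"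
  shows "(\<Sum>a\<in>A. \<alpha> a * gauss_series p (f a) u) + (\<Sum>\<nu><n. w \<nu> * lam ^ \<nu> * Theta p (p ^ \<nu> * u)) =
        s * lam ^ n * (\<Sum>b\<in>B. gauss_series p (g b) (p ^ n * u) * \<beta> b)"
proof -
  have p0: "p \<noteq> 0" using p by auto
  define t where "t = (\<lambda>(k::int) u. p powi (- tri k) * u powi k)"
  have shift: "t k (p ^ \<nu> * u) = (p powi k) ^ \<nu> * t k u" for k and \<nu> :: nat
    by (simp add: t_def power_int_mult_distrib power_int_power power_int_power' mult_ac)
  have J: "((\<lambda>k. a k * t k u) has_sum gauss_series p a u) UNIV" if "bounded (range a)" "u \<noteq> 0" for a u
    using gauss_series_has_sum[OF p that] by (simp add: t_def mult.assoc)
  have Th: "((\<lambda>k. t k u) has_sum Theta p u) UNIV" if "u \<noteq> 0" for u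
    using Theta_has_sum[OF p that] by (simp add: t_def)
  have "((\<lambda>k. (\<Sum>a\<in>A. \<alpha> a * (f a k * t k u)) + (\<Sum>\<nu><n. w \<nu> * lam ^ \<nu> * t k (p ^ \<nu> * u))) has_sum
      (\<Sum>a\<in>A. \<alpha> a * gauss_series p (f a) u) + (\<Sum>\<nu><n. w \<nu> * lam ^ \<nu> * Theta p (p ^ \<nu> * u))) UNIV"
    by (intro has_sum_add has_sum_finite_sum has_sum_cmult_right J Th f) (use u p0 in auto)
  moreover have "((\<lambda>k. s * lam ^ n * (\<Sum>b\<in>B. g b k * t k (p ^ n * u) * \<beta> b)) has_sum
      s * lam ^ n * (\<Sum>b\<in>B. gauss_series p (g b) (p ^ n * u) * \<beta> b)) UNIV"
    by (intro has_sum_finite_sum has_sum_cmult_right has_sum_cmult_left J g) (use u p0 in auto)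
  moreover have "(\<Sum>a\<in>A. \<alpha> a * (f a k * t k u)) + (\<Sum>\<nu><n. w \<nu> * lam ^ \<nu> * t k (p ^ \<nu> * u)) =
      s * lam ^ n * (\<Sum>b\<in>B. g b k * t k (p ^ n * u) * \<beta> b)" for k
  proof -
    have "(\<Sum>a\<in>A. \<alpha> a * (f a k * t k u)) + (\<Sum>\<nu><n. w \<nu> * lam ^ \<nu> * t k (p ^ \<nu> * u)) =
        ((\<Sum>a\<in>A. \<alpha> a * f a k) + (\<Sum>\<nu><n. w \<nu> * (lam * p powi k) ^ \<nu>)) * t k u"
      unfolding shift
      by (simp add: distrib_left distrib_right sum_distrib_left sum_distrib_right power_mult_distrib mult_ac)
    also have "\<dots> = s * (lam * p powi k) ^ n * (\<Sum>b\<in>B. g b k * \<beta> b) * t k u"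
      unfolding eq ..
    also have "\<dots> = s * lam ^ n * (\<Sum>b\<in>B. g b k * t k (p ^ n * u) * \<beta> b)"
      unfolding shift by (simp add: sum_distrib_left sum_distrib_right power_mult_distrib mult_ac)
    finally show ?thesis .
  qed
  ultimately show ?thesis by (simp add: has_sum_unique)
qed

definition theta_quotient :: "complex \<Rightarrow> complex \<Rightarrow> (int \<Rightarrow> complex) \<Rightarrow> complex \<Rightarrow> complex" where
  "theta_quotient p lam a z = gauss_series p a (z / lam) / Theta p (z / lam)"

text \<open>
  Dividing \<open>gauss_series_equation\<close> by \<open>Theta p (z / lam)\<close> gives this equation; the weights
  \<open>p powi (- tri (\<nu> - 1))\<close> that the Borel transformation puts on the coefficients cancel against those
  of \<open>Theta p (p ^ \<nu> * u)\<close>.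
\<close>
lemma theta_quotient_equation:
  assumes p: "1 < cmod p" and lam: "lam \<noteq> 0" and z: "z \<noteq> 0" and nz: "Theta p (z / lam) \<noteq> 0"
    and f: "\<And>a. a \<in> A \<Longrightarrow> bounded (range (f a))" and g: "\<And>b. b \<in> B \<Longrightarrow> bounded (range (g b))"
    and eq: "\<And>k::int. (\<Sum>a\<in>A. \<alpha> a * f a k) + (\<Sum>\<nu><n. v \<nu> * p powi (- tri (int \<nu> - 1)) * (lam * p powi k) ^ \<nu>) =
        p powi (- tri (int n - 1)) * (lam * p powi k) ^ n * (\<Sum>b\<in>B. g b k * \<beta> b)"
  shows "(\<Sum>a\<in>A. \<alpha> a * theta_quotient p lam (f a) z) + (\<Sum>\<nu><n. v \<nu> * z ^ \<nu>) =
        z ^ n * (\<Sum>b\<in>B. theta_quotient p lam (g b) (p ^ n * z) * \<beta> b)"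
proof -
  have p0: "p \<noteq> 0" using p by auto
  define u where "u = z / lam"
  have u: "u \<noteq> 0" "z = lam * u" using z lam by (auto simp: u_def)
  define \<theta> where "\<theta> = Theta p u"
  have \<theta>: "\<theta> \<noteq> 0" using nz by (simp add: \<theta>_def u_def)
  have Th: "Theta p (p ^ \<nu> * u) = p powi tri (int \<nu> - 1) * u ^ \<nu> * \<theta>" for \<nu>
    using Theta_mult_base_powi[OF p u(1), of "int \<nu>"] by (simp add: \<theta>_def)
  have "(\<Sum>a\<in>A. \<alpha> a * gauss_series p (f a) u) +
      (\<Sum>\<nu><n. v \<nu> * p powi (- tri (int \<nu> - 1)) * lam ^ \<nu> * Theta p (p ^ \<nu> * u)) =
      p powi (- tri (int n - 1)) * lam ^ n * (\<Sum>b\<in>B. gauss_series p (g b) (p ^ n * u) * \<beta> b)"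
    by (rule gauss_series_equation[OF p lam u(1)]) (erule f | erule g | rule eq)+
  also have "(\<Sum>\<nu><n. v \<nu> * p powi (- tri (int \<nu> - 1)) * lam ^ \<nu> * Theta p (p ^ \<nu> * u)) =
      (\<Sum>\<nu><n. v \<nu> * z ^ \<nu>) * \<theta>"
    unfolding Th u(2) sum_distrib_right
    using p0 by (intro sum.cong) (simp_all add: power_int_minus power_mult_distrib field_simps)
  finally have "(\<Sum>a\<in>A. \<alpha> a * gauss_series p (f a) u) / \<theta> + (\<Sum>\<nu><n. v \<nu> * z ^ \<nu>) =
      p powi (- tri (int n - 1)) * lam ^ n * (\<Sum>b\<in>B. gauss_series p (g b) (p ^ n * u) * \<beta> b) / \<theta>"
    using \<theta> by (simp add: field_simps)
  moreover have "(\<Sum>a\<in>A. \<alpha> a * gauss_series p (f a) u) / \<theta> = (\<Sum>a\<in>A. \<alpha> a * theta_quotient p lam (f a) z)"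
    by (simp add: theta_quotient_def u_def \<theta>_def sum_divide_distrib)
  moreover have "z ^ n * theta_quotient p lam (g b) (p ^ n * z) =
      p powi (- tri (int n - 1)) * lam ^ n * gauss_series p (g b) (p ^ n * u) / \<theta>" for b
  proof -
    have "theta_quotient p lam (g b) (p ^ n * z) = gauss_series p (g b) (p ^ n * u) / Theta p (p ^ n * u)"
      by (simp add: theta_quotient_def u_def)
    then show ?thesis
      unfolding Th u(2) using p0 u(1) \<theta> lam
      by (simp add: power_int_minus power_mult_distrib field_simps)
  qed
  then have "z ^ n * (\<Sum>b\<in>B. theta_quotient p lam (g b) (p ^ n * z) * \<beta> b) =
      p powi (- tri (int n - 1)) * lam ^ n * (\<Sum>b\<in>B. gauss_series p (g b) (p ^ n * u) * \<beta> b) / \<theta>"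
    by (simp add: sum_distrib_left sum_divide_distrib mult.assoc[symmetric])
  ultimately show ?thesis by simp
qed

lemma holomorphic_on_scaled:
  assumes "f holomorphic_on - {0}" "lam \<noteq> 0"
  shows "(\<lambda>z::complex. f (z / lam)) holomorphic_on - {0}"
proof -
  have "(f \<circ> (\<lambda>z. z / lam)) holomorphic_on - {0}"
    by (rule holomorphic_on_compose_gen[OF _ assms(1)]) (use assms(2) in \<open>auto intro!: holomorphic_intros\<close>)
  then show ?thesis by (simp add: o_def)
qed

lemma Theta_scaled_holomorphic:
  assumes "1 < cmod p" "lam \<noteq> 0"
  shows "(\<lambda>z. Theta p (z / lam)) holomorphic_on - {0}"
  using assms by (intro holomorphic_on_scaled Theta_holomorphic)

lemma eventually_Theta_scaled_nonzero:
  assumes p: "1 < cmod p" and lam: "lam \<noteq> 0" and z: "z \<noteq> 0"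
  shows "eventually (\<lambda>w. Theta p (w / lam) \<noteq> 0) (at z)"
proof -
  have opn: "open (- {0::complex})" by (simp add: open_Compl)
  have "(\<lambda>z. Theta p (z / lam)) nicely_meromorphic_on - {0}"
    using Theta_scaled_holomorphic[OF p lam]
    by (intro analytic_on_imp_nicely_meromorphic_on) (simp add: analytic_on_open opn)
  moreover have "connected (- {0::complex})" by (rule connected_punctured_universe) simp
  ultimately have "(\<forall>x\<in>- {0}. Theta p (x / lam) = 0) \<or> (\<forall>\<^sub>\<approx>x\<in>- {0}. Theta p (x / lam) \<noteq> 0)"
    using opn by (intro nicely_meromorphic_imp_constant_or_avoid)
  moreover obtain w where "w \<noteq> 0" "Theta p w \<noteq> 0" using Theta_not_identically_0[OF p] by blast
  then have "w * lam \<in> - {0}" "Theta p ((w * lam) / lam) \<noteq> 0" using lam by auto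
  then have "\<not> (\<forall>x\<in>- {0}. Theta p (x / lam) = 0)" by blast
  ultimately show ?thesis using z by (simp add: eventually_cosparse_open_eq opn)
qed

lemma theta_quotient_meromorphic:
  assumes p: "1 < cmod p" and lam: "lam \<noteq> 0" and a: "bounded (range a)"
  shows "theta_quotient p lam a meromorphic_on - {0}"
  unfolding theta_quotient_def using holomorphic_on_scaled[OF gauss_series_holomorphic[OF p a] lam]
    Theta_scaled_holomorphic[OF p lam]
  by (intro meromorphic_intros analytic_on_imp_meromorphic_on) (auto simp: analytic_on_open open_Compl)

text \<open>
  The numerator is holomorphic, so poles come from zeros of the denominator, which are simple.
\<close>
lemma theta_quotient_pole:
  assumes p: "1 < cmod p" and lam: "lam \<noteq> 0" and a: "bounded (range a)"
    and z0: "z0 \<noteq> 0" and pole: "is_pole (theta_quotient p lam a) z0"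
  shows "(\<exists>k::int. z0 = - lam * p powi k) \<and> zorder (theta_quotient p lam a) z0 = - 1"
proof -
  define J where "J = (\<lambda>z. gauss_series p a (z / lam))"
  have J: "J holomorphic_on - {0}"
    unfolding J_def by (rule holomorphic_on_scaled[OF gauss_series_holomorphic[OF p a] lam])
  have "Theta p (z0 / lam) = 0"
  proof (rule ccontr)
    assume *: "Theta p (z0 / lam) \<noteq> 0"
    have "theta_quotient p lam a analytic_on {z0}"
      unfolding theta_quotient_def
    proof (rule analytic_on_divide)
      show "(\<lambda>z. gauss_series p a (z / lam)) analytic_on {z0}" "(\<lambda>z. Theta p (z / lam)) analytic_on {z0}"
        using J Theta_scaled_holomorphic[OF p lam] z0
        by (auto simp: analytic_on_holomorphic J_def intro!: exI[of _ "- {0}"])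
    qed (use * in auto)
    then show False using pole analytic_at_imp_no_pole by blast
  qed
  then obtain k where k: "z0 / lam = - (p powi k)"
    using Theta_eq_0_iff[OF p, of "z0 / lam"] z0 lam by auto
  then have z0k: "z0 = - lam * p powi k" using lam by (simp add: field_simps)
  obtain v where v: "v holomorphic_on - {0}" "v (- (p powi k)) \<noteq> 0"
    "\<And>z. z \<noteq> 0 \<Longrightarrow> Theta p z = (z + p powi k) * v z"
    using Theta_simple_zero[OF p] by blast
  define V where "V = (\<lambda>z. v (z / lam))"
  have V: "V holomorphic_on - {0}"
    unfolding V_def by (rule holomorphic_on_scaled[OF v(1) lam])
  define S where "S = {z \<in> - {0}. V z \<noteq> 0}"
  have S: "open S"
    unfolding S_def using continuous_open_preimage[OF holomorphic_on_imp_continuous_on[OF V], of "- {0}"]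
    by (simp add: open_Compl vimage_def Int_def)
  have z0S: "z0 \<in> S" using z0 v(2) k by (simp add: S_def V_def)
  define h where "h = (\<lambda>z. lam * J z / V z)"
  have h: "h holomorphic_on S"
    unfolding h_def by (intro holomorphic_intros holomorphic_on_subset[OF J] holomorphic_on_subset[OF V])
      (auto simp: S_def)
  have fh: "theta_quotient p lam a z = h z / (z - z0)" if "z \<in> S" "z \<noteq> z0" for z
  proof -
    have "Theta p (z / lam) = (z / lam + p powi k) * V z"
      using v(3)[of "z / lam"] that lam by (auto simp: S_def V_def)
    also have "z / lam + p powi k = (z - z0) / lam"
      using z0k lam by (simp add: field_simps)
    finally show ?thesis
      using lam by (simp add: theta_quotient_def h_def J_def mult_ac)
  qed
  have ev: "eventually (\<lambda>z. z \<in> S) (at z0)"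
    using S z0S by (rule eventually_at_in_open')
  \<comment> \<open>If \<open>h\<close> vanished at \<open>z0\<close>, the quotient would have a finite limit there.\<close>
  have "h z0 \<noteq> 0"
  proof
    assume 0: "h z0 = 0"
    have "(h has_field_derivative deriv h z0) (at z0)"
      using holomorphic_derivI[OF h S z0S] .
    then have "((\<lambda>z. (h z - h z0) / (z - z0)) \<longlongrightarrow> deriv h z0) (at z0)"
      by (simp only: has_field_derivative_iff)
    moreover have "eventually (\<lambda>z. (h z - h z0) / (z - z0) = theta_quotient p lam a z) (at z0)"
      using ev eventually_neq_at_within[of z0 z0] by eventually_elim (simp add: fh 0)
    ultimately have "(theta_quotient p lam a \<longlongrightarrow> deriv h z0) (at z0)"
      by (rule Lim_transform_eventually)
    then show False
      using pole not_tendsto_and_filterlim_at_infinity[of "at z0"] by (auto simp: is_pole_def)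
  qed
  then have "zorder (theta_quotient p lam a) z0 = - 1"
    by (rule zorder_eqI[OF S z0S h]) (simp add: fh power_int_minus divide_inverse)
  with z0k show ?thesis by blast
qed

section \<open>Uniqueness of the solution with simple poles\<close>

text \<open>
  In triangularising bases every entry, once the entries treated before are known to vanish, is a
  scalar eigenfunction with eigenvalue \<open>c * \<alpha>1 / \<alpha>2\<close>. Nonresonance says that this is no power of \<open>q\<close>.
\<close>
lemma twisted_matrix_eigenfunction_eq_0:
  fixes G :: "complex \<Rightarrow> complex mat"
  assumes q: "1 < cmod q" and r: "r > 0" and c: "c \<noteq> 0"
    and C1: "C1 \<in> carrier_mat m1 m1" "0 \<notin> spectrum C1"
    and C2: "C2 \<in> carrier_mat m2 m2" "0 \<notin> spectrum C2"
    and G: "\<And>z. G z \<in> carrier_mat m1 m2"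
    and hol: "\<And>i j. i < m1 \<Longrightarrow> j < m2 \<Longrightarrow> (\<lambda>z. G z $$ (i, j)) holomorphic_on ball 0 r - {0}"
    and eq: "\<And>z. z \<noteq> 0 \<Longrightarrow> cmod (q * z) < r \<Longrightarrow> G (q * z) * C2 = c \<cdot>\<^sub>m (C1 * G z)"
    and nonres: "\<And>\<alpha>1 \<alpha>2 k. \<alpha>1 \<in> spectrum C1 \<Longrightarrow> \<alpha>2 \<in> spectrum C2 \<Longrightarrow> c * \<alpha>1 \<noteq> q powi k * \<alpha>2"
    and z: "z \<noteq> 0" "cmod z < r"
  shows "G z = 0\<^sub>m m1 m2"
proof -
  obtain P1 Q1 R where R: "P1 \<in> carrier_mat m1 m1" "Q1 \<in> carrier_mat m1 m1" "R \<in> carrier_mat m1 m1"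
    "P1 * Q1 = 1\<^sub>m m1" "Q1 * P1 = 1\<^sub>m m1" "C1 = P1 * R * Q1" "upper_triangular R"
    "\<And>i. i < m1 \<Longrightarrow> R $$ (i, i) \<in> spectrum C1"
    using complex_mat_triangularise[OF C1(1)] by blast
  obtain P2 Q2 T where T: "P2 \<in> carrier_mat m2 m2" "Q2 \<in> carrier_mat m2 m2" "T \<in> carrier_mat m2 m2"
    "P2 * Q2 = 1\<^sub>m m2" "Q2 * P2 = 1\<^sub>m m2" "C2 = P2 * T * Q2" "upper_triangular T"
    "\<And>i. i < m2 \<Longrightarrow> T $$ (i, i) \<in> spectrum C2"
    using complex_mat_triangularise[OF C2(1)] by blast
  define E where "E = (\<lambda>z. Q1 * G z * P2)"
  have QG: "Q1 * G z \<in> carrier_mat m1 m2" for z by (rule mult_carrier_mat[OF R(2) G])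
  have E: "E z \<in> carrier_mat m1 m2" for z
    unfolding E_def by (rule mult_carrier_mat[OF QG T(1)])
  have Eentry: "E z $$ (i, j) = (\<Sum>b<m2. (\<Sum>a<m1. Q1 $$ (i, a) * G z $$ (a, b)) * P2 $$ (b, j))"
    if "i < m1" "j < m2" for z i j
  proof -
    have "E z $$ (i, j) = (\<Sum>b<m2. (Q1 * G z) $$ (i, b) * P2 $$ (b, j))"
      unfolding E_def by (rule index_mult_mat_sum[OF QG T(1) that])
    also have "\<dots> = (\<Sum>b<m2. (\<Sum>a<m1. Q1 $$ (i, a) * G z $$ (a, b)) * P2 $$ (b, j))"
      by (intro sum.cong refl arg_cong2[of _ _ _ _ "(*)"] index_mult_mat_sum[OF R(2) G that(1)]) auto
    finally show ?thesis .
  qed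
  have Ehol: "(\<lambda>z. E z $$ (i, j)) holomorphic_on ball 0 r - {0}" if "i < m1" "j < m2" for i j
    unfolding Eentry[OF that] by (intro holomorphic_intros hol) auto
  have Eeq: "E (q * z) * T = c \<cdot>\<^sub>m (R * E z)" if "z \<noteq> 0" "cmod (q * z) < r" for z
  proof -
    have CG: "C1 * G z \<in> carrier_mat m1 m2" by (rule mult_carrier_mat[OF C1(1) G])
    have "E (q * z) * T = Q1 * (G (q * z) * C2) * P2"
      unfolding E_def T(6) by (rule conjugate_mult_right[symmetric]) (use R T G in auto)
    also have "\<dots> = Q1 * (c \<cdot>\<^sub>m (C1 * G z)) * P2" unfolding eq[OF that] ..
    also have "\<dots> = c \<cdot>\<^sub>m (Q1 * (C1 * G z) * P2)"
      using mult_smult_distrib[OF R(2) CG, of c]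
          mult_smult_assoc_mat[OF mult_carrier_mat[OF R(2) CG] T(1), of c] by simp
    also have "Q1 * (C1 * G z) * P2 = R * E z"
      unfolding E_def R(6) by (rule conjugate_mult_left) (use R T G in auto)
    finally show ?thesis .
  qed
  have E0: "\<forall>z. z \<noteq> 0 \<longrightarrow> cmod z < r \<longrightarrow> E z $$ (i, j) = 0" if "i < m1" "j < m2" for i j
    using that
  proof (induction rule: triangular_pair_induct)
    case (step i j)
    have T0: "T $$ (j, j) \<noteq> 0" using T(8)[OF step(2)] C2(2) by metis
    have R0: "R $$ (i, i) \<noteq> 0" using R(8)[OF step(1)] C1(2) by metis
    define \<beta> where "\<beta> = c * R $$ (i, i) / T $$ (j, j)"
    have \<beta>: "\<beta> \<noteq> 0" using c T0 R0 by (simp add: \<beta>_def)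
    have \<beta>': "\<beta> \<noteq> q powi k" for k
      using nonres[OF R(8)[OF step(1)] T(8)[OF step(2)], of k] T0 by (auto simp: \<beta>_def field_simps)
    have "E (q * z) $$ (i, j) = \<beta> * E z $$ (i, j)" if z: "z \<noteq> 0" "cmod (q * z) < r" for z
    proof -
      have "1 * cmod z \<le> cmod q * cmod z" using q by (intro mult_right_mono) auto
      then have z': "cmod z < r" using z(2) by (simp add: norm_mult)
      have qz: "q * z \<noteq> 0" using q z by auto
      have "(E (q * z) * T) $$ (i, j) = c * (R * E z) $$ (i, j)"
        unfolding Eeq[OF z] using R(3) E[of z] step(1,2) by (auto simp del: index_mult_mat(1))
      moreover have "(E (q * z) * T) $$ (i, j) = E (q * z) $$ (i, j) * T $$ (j, j) +
          (\<Sum>k<j. E (q * z) $$ (i, k) * T $$ (k, j))"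
        by (rule triangular_mult_right_index[OF R(3,7) T(3,7) E step(1,2)])
      moreover have "(\<Sum>k<j. E (q * z) $$ (i, k) * T $$ (k, j)) = 0"
        using step(4) qz z by (intro sum.neutral) auto
      moreover have "(R * E z) $$ (i, j) = R $$ (i, i) * E z $$ (i, j) + (\<Sum>k\<in>{i<..<m1}. R $$ (i, k) * E z $$ (k, j))"
        by (rule triangular_mult_left_index[OF R(3,7) T(3,7) E step(1,2)])
      moreover have "(\<Sum>k\<in>{i<..<m1}. R $$ (i, k) * E z $$ (k, j)) = 0"
        using step(3) z z' by (intro sum.neutral) auto
      ultimately have "E (q * z) $$ (i, j) * T $$ (j, j) = c * (R $$ (i, i) * E z $$ (i, j))"
        by (simp only: add_0_right)
      then show ?thesis using T0 by (simp add: \<beta>_def field_simps)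
    qed
    then show ?case
      using contraction_eigenfunction_eq_0[OF q r \<beta> \<beta>' Ehol[OF step(1,2)]] by blast
  qed
  have "E z = 0\<^sub>m m1 m2"
    using E[of z] E0 z by (intro eq_matI) auto
  then have "P1 * (Q1 * G z * P2) * Q2 = 0\<^sub>m m1 m2"
    using R(1) T(2) by (simp add: E_def)
  moreover have "P1 * (Q1 * G z * P2) * Q2 = G z"
    by (rule conjugate_cancel) (use R T G in auto)
  ultimately show ?thesis by simp
qed

text \<open>
  Nicely meromorphic functions are fixed by \<open>remove_sings\<close>, which depends only on the values
  in a punctured neighbourhood.
\<close>
lemma nicely_meromorphic_eqI:
  assumes f: "f nicely_meromorphic_on A" and g: "g nicely_meromorphic_on A"
    and eq: "eventually (\<lambda>z. f z = g z) (at z)" and z: "z \<in> A"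
  shows "f z = g z"
proof -
  have *: "remove_sings h z = h z" if "h nicely_meromorphic_on A" for h
  proof (cases "is_pole h z")
    case True
    then have "h z = 0"
      using that z not_tendsto_and_filterlim_at_infinity[of "at z" h]
      by (auto simp: nicely_meromorphic_on_def is_pole_def)
    then show ?thesis using True by simp
  next
    case False
    then show ?thesis using nicely_meromorphic_on_imp_analytic_at[OF that z] by simp
  qed
  have "remove_sings f z = remove_sings g z"
    by (rule remove_sings_cong[OF eq]) simp
  with *[OF f] *[OF g] show ?thesis by simp
qed

text \<open>
  A simple pole at \<open>- lam * p powi k\<close> is cancelled by the zero of the theta factor there.
\<close>
lemma theta_clears_poles:
  assumes p: "1 < cmod p" and lam: "lam \<noteq> 0"
    and f: "f nicely_meromorphic_on - {0}"
    and poles: "\<And>z. z \<noteq> 0 \<Longrightarrow> cmod z < r \<Longrightarrow> is_pole f z \<Longrightarrow>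
                  zorder f z = - 1 \<and> (\<exists>k::int. z = - lam * p powi k)"
  obtains K where "K holomorphic_on ball 0 r - {0}"
    "\<And>z. z \<noteq> 0 \<Longrightarrow> eventually (\<lambda>z. K z = Theta p (z / lam) * f z) (at z)"
proof -
  have Th: "(\<lambda>z. Theta p (z / lam)) holomorphic_on - {0}"
    by (rule Theta_scaled_holomorphic[OF p lam])
  define k0 where "k0 = (\<lambda>z. Theta p (z / lam) * f z)"
  have mero: "k0 meromorphic_on - {0}"
  proof -
    have "f meromorphic_on - {0}" using f by (simp add: nicely_meromorphic_on_def)
    moreover have "(\<lambda>z. Theta p (z / lam)) meromorphic_on - {0}"
      using Th by (intro analytic_on_imp_meromorphic_on) (simp add: analytic_on_open open_Compl)
    ultimately show ?thesis unfolding k0_def by (rule meromorphic_on_mult[rotated])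
  qed
  have iso: "isolated_singularity_at k0 z" if "z \<noteq> 0" for z
    using mero that by (meson ComplI empty_iff insert_iff meromorphic_onE)
  have "remove_sings k0 analytic_on {z}" if z: "z \<noteq> 0" "cmod z < r" for z
  proof (cases "is_pole f z")
    case False
    then have "f analytic_on {z}"
      using nicely_meromorphic_on_imp_analytic_at[OF f] z by auto
    moreover have "(\<lambda>z. Theta p (z / lam)) analytic_on {z}"
      using Th z by (auto simp: analytic_on_holomorphic intro!: exI[of _ "- {0}"])
    ultimately have "k0 analytic_on {z}" unfolding k0_def by (intro analytic_intros)
    then show ?thesis by (rule remove_sings_analytic_on)
  next
    case True
    then obtain k where zo: "zorder f z = - 1" and k: "z = - lam * p powi k"
      using poles[OF z] by blast
    obtain v where v: "v holomorphic_on - {0}"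
      "\<And>z. z \<noteq> 0 \<Longrightarrow> Theta p z = (z + p powi k) * v z"
      using Theta_simple_zero[OF p] by blast
    have fm: "f meromorphic_on - {0}" using f by (simp add: nicely_meromorphic_on_def)
    have fiso: "isolated_singularity_at f z" and fness: "not_essential f z"
      using fm z by (meson ComplI empty_iff insert_iff meromorphic_onE)+
    have fnz: "\<exists>\<^sub>F w in at z. f w \<noteq> 0"
      using non_zero_neighbour_pole[OF True] by (simp add: eventually_frequently)
    define g where "g = zor_poly f z"
    obtain \<rho> where \<rho>: "\<rho> > 0" "g holomorphic_on cball z \<rho>"
       "\<And>w. w \<in> cball z \<rho> - {z} \<Longrightarrow> f w = g w * (w - z) powi (- 1)"
      using zorder_exist[OF fiso fness fnz] unfolding zo g_def by blast
    have "isCont g z"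
      using \<rho>(1,2) by (meson ball_subset_cball centre_in_ball continuous_on_eq_continuous_at
          continuous_on_subset holomorphic_on_imp_continuous_on open_ball)
    then have g: "(g \<longlongrightarrow> g z) (at z)" by (simp add: isCont_def)
    have "isCont (\<lambda>w. v (w / lam)) z"
      using holomorphic_on_imp_continuous_on[OF holomorphic_on_scaled[OF v(1) lam]] z
      by (simp add: continuous_on_eq_continuous_at open_Compl)
    then have vl: "((\<lambda>w. v (w / lam)) \<longlongrightarrow> v (z / lam)) (at z)" by (simp add: isCont_def)
    have lim: "((\<lambda>w. v (w / lam) / lam * g w) \<longlongrightarrow> v (z / lam) / lam * g z) (at z)"
      using lam by (intro tendsto_intros g vl) auto
    have "eventually (\<lambda>w. w \<in> - {0}) (at z)"
      using z by (intro eventually_at_in_open') auto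
    moreover have "eventually (\<lambda>w. w \<in> ball z \<rho> - {z}) (at z)"
      using \<rho> by (intro eventually_at_in_open) auto
    ultimately have "eventually (\<lambda>w. v (w / lam) / lam * g w = k0 w) (at z)"
    proof eventually_elim
      case (elim w)
      have "Theta p (w / lam) = (w / lam + p powi k) * v (w / lam)"
        using v(2)[of "w / lam"] elim lam by auto
      also have "w / lam + p powi k = (w - z) / lam"
        using k lam by (simp add: field_simps)
      finally have "Theta p (w / lam) = (w - z) / lam * v (w / lam)" .
      moreover have "f w = g w / (w - z)"
        using \<rho>(3)[of w] elim by (simp add: power_int_minus divide_inverse)
      moreover have "w - z \<noteq> 0" using elim by simp
      ultimately show ?case by (simp add: k0_def)
    qed
    with lim have "(k0 \<longlongrightarrow> v (z / lam) / lam * g z) (at z)"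
      by (rule Lim_transform_eventually)
    then show ?thesis using iso z by (intro remove_sings_analytic_at) auto
  qed
  then have "remove_sings k0 analytic_on ball 0 r - {0}"
    by (subst analytic_on_analytic_at) auto
  then have "remove_sings k0 holomorphic_on ball 0 r - {0}"
    by (rule analytic_imp_holomorphic)
  moreover have "eventually (\<lambda>w. remove_sings k0 w = Theta p (w / lam) * f w) (at z)" if "z \<noteq> 0" for z
    using eventually_remove_sings_eq_at[OF iso[OF that]] by (simp add: k0_def)
  ultimately show ?thesis by (rule that)
qed

text \<open>
  The theta factor vanishes only on a discrete set, and meromorphic functions on the connected set
  \<open>- {0}\<close> that agree near one point agree everywhere.
\<close>
lemma theta_cleared_eq_imp_eq:
  assumes p: "1 < cmod p" and lam: "lam \<noteq> 0" and r: "r > 0"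
    and f: "f nicely_meromorphic_on - {0}" and g: "g nicely_meromorphic_on - {0}"
    and eq: "\<And>z. z \<noteq> 0 \<Longrightarrow> cmod z < r \<Longrightarrow>
       eventually (\<lambda>z. Theta p (z / lam) * f z = Theta p (z / lam) * g z) (at z)"
    and z: "z \<noteq> 0"
  shows "f z = g z"
proof -
  have conn: "connected (- {0::complex})" by (rule connected_punctured_universe) simp
  have opn: "open (- {0::complex})" by (simp add: open_Compl)
  have fg: "(\<lambda>z. f z - g z) meromorphic_on - {0}"
    using f g by (intro meromorphic_intros) (auto simp: nicely_meromorphic_on_def)
  define x where "x = complex_of_real (r / 2)"
  have x: "x \<noteq> 0" "cmod x < r" using r by (auto simp: x_def)
  have "eventually (\<lambda>z. Theta p (z / lam) \<noteq> 0) (at x)"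
    by (rule eventually_Theta_scaled_nonzero[OF p lam x(1)])
  with eq[OF x] have "eventually (\<lambda>z. f z - g z = 0) (at x)"
    by eventually_elim auto
  then have "\<not> eventually (\<lambda>z. f z - g z \<noteq> 0) (at x)"
    using eventually_frequently[of "at x" "\<lambda>z. f z - g z = 0"] by (simp add: frequently_def)
  then have "\<not> eventually (\<lambda>z. f z - g z \<noteq> 0) (cosparse (- {0}))"
    using x by (auto simp: eventually_cosparse_open_eq opn)
  with meromorphic_imp_constant_or_avoid[OF fg opn conn, of 0]
  have "eventually (\<lambda>z. f z - g z = 0) (cosparse (- {0}))" by blast
  then have "eventually (\<lambda>z. f z = g z) (at z)"
    using z by (simp add: eventually_cosparse_open_eq opn)
  with f g show ?thesis using z by (intro nicely_meromorphic_eqI[of f "- {0}" g]) auto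
qed

lemma eventually_at_scaled:
  fixes q z :: complex
  assumes "q \<noteq> 0" "eventually P (at (q * z))"
  shows "eventually (\<lambda>w. P (q * w)) (at z)"
proof -
  have "filterlim (\<lambda>w. q * w) (at (q * z)) (at z)"
    using assms(1) by (intro filterlim_atI) (auto intro!: tendsto_eq_intros simp: eventually_at_filter)
  with assms(2) show ?thesis by (rule eventually_compose_filterlim)
qed

text \<open>
  The block equation of the gauge problem with its pole condition, in terms of \<open>p\<close> with
  \<open>q = p ^ n\<close>. The inhomogeneity \<open>V\<close> is arbitrary, since it drops out of the difference of two solutions.
\<close>
definition simple_pole_solution ::
    "complex \<Rightarrow> nat \<Rightarrow> complex \<Rightarrow> nat \<Rightarrow> nat \<Rightarrow> complex mat \<Rightarrow> complex mat \<Rightarrow>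
      (nat \<Rightarrow> nat \<Rightarrow> complex \<Rightarrow> complex) \<Rightarrow> (complex \<Rightarrow> complex mat) \<Rightarrow> bool" where
  "simple_pole_solution p n lam m1 m2 C1 C2 V Y \<longleftrightarrow>
     (\<forall>i<m1. \<forall>j<m2. (\<lambda>z. Y z $$ (i, j)) nicely_meromorphic_on - {0}) \<and>
     (\<forall>i<m1. \<forall>j<m2. \<exists>r>0. \<forall>z. z \<noteq> 0 \<longrightarrow> cmod z < r \<longrightarrow> is_pole (\<lambda>w. Y w $$ (i, j)) z \<longrightarrow>
        zorder (\<lambda>w. Y w $$ (i, j)) z = - 1 \<and> (\<exists>k::int. z = - lam * p powi k)) \<and>
     (\<forall>i<m1. \<forall>j<m2. \<forall>z\<noteq>0. eventually (\<lambda>z. (\<Sum>a<m1. C1 $$ (i, a) * Y z $$ (a, j)) + V i j z =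
        z ^ n * (\<Sum>b<m2. Y (p ^ n * z) $$ (i, b) * C2 $$ (b, j))) (at z))"

text \<open>
  The theta factor clears the poles and contributes \<open>c * z ^ n\<close> under \<open>z \<mapsto> q z\<close>, which absorbs the factor
  \<open>z ^ n\<close> of the equation. So the cleared difference \<open>G\<close> satisfies an equation with constant
  coefficients, first off a discrete set and then everywhere by continuity.
\<close>
lemma simple_pole_solution_unique:
  fixes X X' :: "complex \<Rightarrow> complex mat"
  assumes p: "1 < cmod p" and n: "n > 0" and lam: "lam \<noteq> 0"
    and C1: "C1 \<in> carrier_mat m1 m1" "0 \<notin> spectrum C1"
    and C2: "C2 \<in> carrier_mat m2 m2" "0 \<notin> spectrum C2"
    and nonres: "\<And>\<alpha>1 \<alpha>2 k. \<alpha>1 \<in> spectrum C1 \<Longrightarrow> \<alpha>2 \<in> spectrum C2 \<Longrightarrow>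
       \<alpha>1 \<noteq> p powi (- tri (int n - 1)) * \<alpha>2 * (lam * p powi k) ^ n"
    and X: "simple_pole_solution p n lam m1 m2 C1 C2 V X"
    and X': "simple_pole_solution p n lam m1 m2 C1 C2 V X'"
    and ij: "i < m1" "j < m2" and z: "z \<noteq> 0"
  shows "X z $$ (i, j) = X' z $$ (i, j)"
proof -
  have "simple_pole_solution p n lam m1 m2 C1 C2 V Y" if "Y \<in> {X, X'}" for Y
    using that X X' by blast
  note sol = this[unfolded simple_pole_solution_def]
  have p0: "p \<noteq> 0" using p by auto
  define q where "q = p ^ n"
  have q: "1 < cmod q" unfolding q_def norm_power using p n by (rule one_less_power)
  then have q0: "q \<noteq> 0" by auto
  \<comment> \<open>\<open>c * z ^ n\<close> is the factor by which \<open>Theta p (z / lam)\<close> changes under \<open>z \<mapsto> q z\<close>.\<close>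
  define c where "c = p powi tri (int n - 1) / lam ^ n"
  have c: "c \<noteq> 0" using p0 lam by (simp add: c_def)
  have Th_q: "Theta p (q * z / lam) = c * z ^ n * Theta p (z / lam)" if "z \<noteq> 0" for z
    using Theta_mult_base_powi[OF p, of "z / lam" "int n"] that lam
    by (simp add: q_def c_def power_divide)
  define simple where "simple = (\<lambda>Y i j r. \<forall>z. z \<noteq> 0 \<longrightarrow> cmod z < r \<longrightarrow> is_pole (\<lambda>w. Y w $$ (i, j)) z \<longrightarrow>
      zorder (\<lambda>w. Y w $$ (i, j)) z = - 1 \<and> (\<exists>k::int. z = - lam * p powi k))"
  have simple_mono: "simple Y i j r'" if "simple Y i j r" "r' < r" for Y i j r r'
    unfolding simple_def
  proof (intro allI impI)
    fix z assume *: "z \<noteq> 0" "cmod z < r'" "is_pole (\<lambda>w. Y w $$ (i, j)) z"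
    then have "cmod z < r" using that(2) by simp
    with that(1) * show "zorder (\<lambda>w. Y w $$ (i, j)) z = - 1 \<and> (\<exists>k::int. z = - lam * p powi k)"
      unfolding simple_def by blast
  qed
  have "eventually (\<lambda>r. \<forall>Y\<in>{X, X'}. \<forall>i\<in>{..<m1}. \<forall>j\<in>{..<m2}. simple Y i j r) (at_right 0)"
  proof (intro eventually_ball_finite ballI)
    fix Y i j assume Y: "Y \<in> {X, X'}" and i: "i \<in> {..<m1}" and j: "j \<in> {..<m2}"
    have "\<exists>r>0. simple Y i j r"
      using sol[OF Y, THEN conjunct2, THEN conjunct1] i j unfolding simple_def by blast
    then obtain r where "r > 0" "simple Y i j r" by blast
    then show "eventually (simple Y i j) (at_right 0)"
      unfolding eventually_at_right_field using simple_mono by (intro exI[of _ r]) auto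
  qed auto
  moreover have "eventually (\<lambda>r::real. r > 0) (at_right 0)" by (rule eventually_at_right_less)
  ultimately have "eventually (\<lambda>r. (\<forall>Y\<in>{X, X'}. \<forall>i\<in>{..<m1}. \<forall>j\<in>{..<m2}. simple Y i j r) \<and> r > 0) (at_right 0)"
    by (rule eventually_conj)
  from eventually_happens'[OF trivial_limit_at_right_real this]
  obtain r where r: "r > 0" and simple: "\<forall>Y\<in>{X, X'}. \<forall>i\<in>{..<m1}. \<forall>j\<in>{..<m2}. simple Y i j r"
    by blast
  have "\<exists>K. K holomorphic_on ball 0 r - {0} \<and>
      (\<forall>z. z \<noteq> 0 \<longrightarrow> eventually (\<lambda>z. K z = Theta p (z / lam) * Y z $$ (i, j)) (at z))"
    if Y: "Y \<in> {X, X'}" and "i < m1" "j < m2" for Y i j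
  proof -
    have nice: "(\<lambda>z. Y z $$ (i, j)) nicely_meromorphic_on - {0}"
      using sol[OF Y, THEN conjunct1] that(2,3) by blast
    have "simple Y i j r" using simple that by blast
    then have poles: "zorder (\<lambda>w. Y w $$ (i, j)) z = - 1 \<and> (\<exists>k::int. z = - lam * p powi k)"
      if "z \<noteq> 0" "cmod z < r" "is_pole (\<lambda>w. Y w $$ (i, j)) z" for z
      using that unfolding simple_def by blast
    show ?thesis
      by (rule theta_clears_poles[OF p lam nice, of r]) (use poles in blast)+
  qed
  note exK = this
  define K where "K = (\<lambda>Y i j. SOME K. K holomorphic_on ball 0 r - {0} \<and>
      (\<forall>z. z \<noteq> 0 \<longrightarrow> eventually (\<lambda>z. K z = Theta p (z / lam) * Y z $$ (i, j)) (at z)))"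
  have K: "K Y i j holomorphic_on ball 0 r - {0} \<and>
      (\<forall>z. z \<noteq> 0 \<longrightarrow> eventually (\<lambda>z. K Y i j z = Theta p (z / lam) * Y z $$ (i, j)) (at z))"
    if Y: "Y \<in> {X, X'}" and "i < m1" "j < m2" for Y i j
    unfolding K_def using exK[OF that] by (rule someI_ex)
  define G where "G = (\<lambda>z. mat m1 m2 (\<lambda>(i, j). K X i j z - K X' i j z))"
  have G: "G z \<in> carrier_mat m1 m2" for z by (simp add: G_def)
  have Gij: "G z $$ (i, j) = K X i j z - K X' i j z" if "i < m1" "j < m2" for z i j
    using that by (simp add: G_def)
  have Ghol: "(\<lambda>z. G z $$ (i, j)) holomorphic_on ball 0 r - {0}" if "i < m1" "j < m2" for i j
    unfolding Gij[OF that] using K[of X i j] K[of X' i j] that by (intro holomorphic_intros) auto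
  have Geq: "G (q * z) * C2 = c \<cdot>\<^sub>m (C1 * G z)" if z: "z \<noteq> 0" "cmod (q * z) < r" for z
  proof (rule eq_matI)
    have "1 * cmod z \<le> cmod q * cmod z" using q by (intro mult_right_mono) auto
    then have z': "cmod z < r" using z(2) by (simp add: norm_mult)
    have qz: "q * z \<noteq> 0" using q0 z by auto
    fix i j assume "i < dim_row (c \<cdot>\<^sub>m (C1 * G z))" "j < dim_col (c \<cdot>\<^sub>m (C1 * G z))"
    then have ij: "i < m1" "j < m2" using C1(1) G[of z] by auto
    have evK: "eventually (\<lambda>w. \<forall>i\<in>{..<m1}. \<forall>j\<in>{..<m2}. \<forall>Y\<in>{X, X'}. K Y i j w = Theta p (w / lam) * Y w $$ (i, j)) (at x)"
      if "x \<noteq> 0" for x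
      by (intro eventually_ball_finite ballI) (use K that in auto)
    have ev1: "eventually (\<lambda>w. \<forall>i\<in>{..<m1}. \<forall>j\<in>{..<m2}. \<forall>Y\<in>{X, X'}.
        K Y i j (q * w) = Theta p (q * w / lam) * Y (q * w) $$ (i, j)) (at z)"
      using eventually_at_scaled[OF q0 evK[OF qz]] .
    have ev2: "eventually (\<lambda>z. \<forall>Y\<in>{X, X'}. (\<Sum>a<m1. C1 $$ (i, a) * Y z $$ (a, j)) + V i j z =
          z ^ n * (\<Sum>b<m2. Y (q * z) $$ (i, b) * C2 $$ (b, j))) (at z)"
      unfolding q_def by (intro eventually_ball_finite ballI) (use sol ij z in auto)
    have ev3: "eventually (\<lambda>w. w \<in> - {0}) (at z)" using z by (intro eventually_at_in_open') auto
    have ev: "eventually (\<lambda>w. (\<Sum>b<m2. G (q * w) $$ (i, b) * C2 $$ (b, j)) = c * (\<Sum>a<m1. C1 $$ (i, a) * G w $$ (a, j))) (at z)"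
      using evK[OF z(1)] ev1 ev2 ev3
    proof eventually_elim
      case (elim w)
      have *: "(\<Sum>b<m2. K Y i b (q * w) * C2 $$ (b, j)) =
          c * (\<Sum>a<m1. C1 $$ (i, a) * K Y a j w) + c * Theta p (w / lam) * V i j w" if Y: "Y \<in> {X, X'}" for Y
      proof -
        have "(\<Sum>b<m2. K Y i b (q * w) * C2 $$ (b, j)) =
            (\<Sum>b<m2. Theta p (q * w / lam) * Y (q * w) $$ (i, b) * C2 $$ (b, j))"
          using elim(2) ij Y by (intro sum.cong) auto
        also have "\<dots> = c * Theta p (w / lam) * (w ^ n * (\<Sum>b<m2. Y (q * w) $$ (i, b) * C2 $$ (b, j)))"
          using Th_q[of w] elim(4) by (simp add: sum_distrib_left mult_ac)
        also have "w ^ n * (\<Sum>b<m2. Y (q * w) $$ (i, b) * C2 $$ (b, j)) =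
            (\<Sum>a<m1. C1 $$ (i, a) * Y w $$ (a, j)) + V i j w"
          by (rule bspec[OF elim(3) Y, symmetric])
        also have "c * Theta p (w / lam) * ((\<Sum>a<m1. C1 $$ (i, a) * Y w $$ (a, j)) + V i j w) =
            c * (\<Sum>a<m1. C1 $$ (i, a) * (Theta p (w / lam) * Y w $$ (a, j))) + c * Theta p (w / lam) * V i j w"
          by (simp add: sum_distrib_left distrib_left mult_ac)
        also have "(\<Sum>a<m1. C1 $$ (i, a) * (Theta p (w / lam) * Y w $$ (a, j))) = (\<Sum>a<m1. C1 $$ (i, a) * K Y a j w)"
          using elim(1) ij Y by (intro sum.cong) auto
        finally show ?thesis .
      qed
      have "(\<Sum>b<m2. G (q * w) $$ (i, b) * C2 $$ (b, j)) =
          (\<Sum>b<m2. K X i b (q * w) * C2 $$ (b, j)) - (\<Sum>b<m2. K X' i b (q * w) * C2 $$ (b, j))"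
        using ij by (simp add: Gij left_diff_distrib sum_subtractf)
      also have "\<dots> = c * ((\<Sum>a<m1. C1 $$ (i, a) * K X a j w) - (\<Sum>a<m1. C1 $$ (i, a) * K X' a j w))"
        using *[of X] *[of X'] by (simp add: right_diff_distrib)
      also have "\<dots> = c * (\<Sum>a<m1. C1 $$ (i, a) * G w $$ (a, j))"
        using ij by (simp add: Gij right_diff_distrib sum_subtractf)
      finally show ?case .
    qed
    have contG: "isCont (\<lambda>w. G w $$ (a, b)) x" if "a < m1" "b < m2" "x \<noteq> 0" "cmod x < r" for a b x
    proof -
      have "open (ball 0 r - {0::complex})" by (intro open_Diff) auto
      with holomorphic_on_imp_continuous_on[OF Ghol[OF that(1,2)]] show ?thesis
        using that by (simp add: continuous_on_eq_continuous_at)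
    qed
    have t1: "((\<lambda>w. \<Sum>b<m2. G (q * w) $$ (i, b) * C2 $$ (b, j)) \<longlongrightarrow> (\<Sum>b<m2. G (q * z) $$ (i, b) * C2 $$ (b, j))) (at z)"
    proof (intro tendsto_intros)
      fix b assume "b \<in> {..<m2}"
      then have "isCont (\<lambda>w. G w $$ (i, b)) (q * z)" using ij qz z by (intro contG) auto
      then show "((\<lambda>w. G (q * w) $$ (i, b)) \<longlongrightarrow> G (q * z) $$ (i, b)) (at z)"
        by (rule isCont_tendsto_compose) (auto intro!: tendsto_eq_intros)
    qed
    have t2: "((\<lambda>w. c * (\<Sum>a<m1. C1 $$ (i, a) * G w $$ (a, j))) \<longlongrightarrow> c * (\<Sum>a<m1. C1 $$ (i, a) * G z $$ (a, j))) (at z)"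
      using contG[of _ j z] ij z z' by (intro tendsto_intros) (auto simp: isCont_def)
    have "(\<Sum>b<m2. G (q * z) $$ (i, b) * C2 $$ (b, j)) = c * (\<Sum>a<m1. C1 $$ (i, a) * G z $$ (a, j))"
      using tendsto_unique[OF _ Lim_transform_eventually[OF t1 ev] t2] by simp
    then show "(G (q * z) * C2) $$ (i, j) = (c \<cdot>\<^sub>m (C1 * G z)) $$ (i, j)"
      using index_mult_mat_sum[OF G[of "q * z"] C2(1) ij] index_mult_mat_sum[OF C1(1) G[of z] ij]
        ij C1(1) G[of z] by (simp del: index_mult_mat(1))
  qed (use G[of z] G[of "q * z"] C1(1) C2(1) in auto)
  have nonres': "c * \<alpha>1 \<noteq> q powi k * \<alpha>2" if "\<alpha>1 \<in> spectrum C1" "\<alpha>2 \<in> spectrum C2" for \<alpha>1 \<alpha>2 k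
  proof
    assume *: "c * \<alpha>1 = q powi k * \<alpha>2"
    have "(lam * p powi k) ^ n = lam ^ n * q powi k"
      by (simp add: q_def power_mult_distrib power_int_power power_int_power' mult.commute)
    moreover have "\<alpha>1 = p powi (- tri (int n - 1)) * lam ^ n * (c * \<alpha>1)"
      using p0 lam by (simp add: c_def power_int_minus)
    ultimately have "\<alpha>1 = p powi (- tri (int n - 1)) * \<alpha>2 * (lam * p powi k) ^ n"
      unfolding * by (simp add: mult_ac)
    with nonres[OF that] show False by blast
  qed
  have G0: "G z = 0\<^sub>m m1 m2" if "z \<noteq> 0" "cmod z < r" for z
    by (rule twisted_matrix_eigenfunction_eq_0[OF q r c C1 C2 G Ghol Geq nonres' that])
  show ?thesis
  proof (rule theta_cleared_eq_imp_eq[OF p lam r _ _ _ z])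
    show "(\<lambda>z. X z $$ (i, j)) nicely_meromorphic_on - {0}" "(\<lambda>z. X' z $$ (i, j)) nicely_meromorphic_on - {0}"
      using sol[of X, THEN conjunct1] sol[of X', THEN conjunct1] ij by auto
    fix z :: complex assume z: "z \<noteq> 0" "cmod z < r"
    have "eventually (\<lambda>w. w \<in> ball 0 r - {0}) (at z)"
      using z by (intro eventually_at_in_open' open_Diff) auto
    moreover have "eventually (\<lambda>w. K X i j w = Theta p (w / lam) * X w $$ (i, j)) (at z)"
      "eventually (\<lambda>w. K X' i j w = Theta p (w / lam) * X' w $$ (i, j)) (at z)"
      using K[of X i j] K[of X' i j] ij z by auto
    ultimately show "eventually (\<lambda>w. Theta p (w / lam) * X w $$ (i, j) = Theta p (w / lam) * X' w $$ (i, j)) (at z)"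
    proof eventually_elim
      case (elim w)
      then have "G w $$ (i, j) = 0" using G0[of w] ij by auto
      then show ?case using Gij[OF ij, of w] elim by simp
    qed
  qed
qed

section \<open>Borel and Laplace transforms of series with a bounded continuation\<close>

lemma
  assumes N: "N > 0"
  shows qpow_root_powi: "qpow lq (of_int k / of_nat N) = qpow lq (1 / of_nat N) powi k"
    and qpow_root_power: "qpow lq (1 / of_nat N) ^ N = exp lq"
  unfolding qpow_def using N by (simp_all add: exp_power_int exp_of_nat_mult[symmetric])

lemma norm_qpow_root:
  assumes "N > 0" "1 < cmod (exp lq)"
  shows "1 < cmod (qpow lq (1 / of_nat N))"
proof (rule ccontr)
  assume "\<not> ?thesis"
  then have "cmod (qpow lq (1 / of_nat N)) ^ N \<le> 1" by (intro power_le_one) auto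
  then have "cmod (exp lq) \<le> 1"
    using qpow_root_power[OF assms(1), of lq] by (metis norm_power)
  with assms(2) show False by simp
qed

text \<open>
  All terms of the series are positive and the one at \<open>k = 0\<close> is \<open>1\<close>.
\<close>
lemma Theta_real_ge_1:
  assumes \<rho>: "1 < \<rho>" and x: "0 < x"
  shows "1 \<le> cmod (Theta (of_real \<rho>) (of_real x))"
proof -
  have "((\<lambda>k. of_real \<rho> powi (- tri k) * of_real x powi k) has_sum Theta (of_real \<rho>) (of_real x)) UNIV"
    by (rule Theta_has_sum) (use \<rho> x in auto)
  then have "((\<lambda>k. of_real (\<rho> powi (- tri k) * x powi k)) has_sum Theta (of_real \<rho>) (of_real x)) UNIV"
    by (simp add: of_real_power_int)
  from has_sum_Re[OF this]
  have "((\<lambda>k. \<rho> powi (- tri k) * x powi k) has_sum Re (Theta (of_real \<rho>) (of_real x))) UNIV"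
    by (simp only: Re_complex_of_real)
  then have "(\<Sum>k\<in>{0::int}. \<rho> powi (- tri k) * x powi k) \<le> Re (Theta (of_real \<rho>) (of_real x))"
    by (rule finite_sum_le_has_sum) (use \<rho> x in auto)
  then have "1 \<le> Re (Theta (of_real \<rho>) (of_real x))" by (simp add: tri_def)
  also have "\<dots> \<le> cmod (Theta (of_real \<rho>) (of_real x))" by (rule complex_Re_le_cmod)
  finally show ?thesis .
qed

lemma inv_ints_reindex:
  assumes "N > 0"
  shows "(\<Sum>\<^sub>\<infinity>l\<in>inv_ints N. f l) = (\<Sum>\<^sub>\<infinity>k\<in>UNIV. f (of_int k / of_nat N :: complex))"
proof -
  have "inj (\<lambda>k::int. of_int k / of_nat N :: complex)"
    using assms by (auto simp: inj_def)
  from infsum_reindex[OF this, of f] show ?thesis by (simp add: inv_ints_def o_def)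
qed

lemma qH_continuation_exists:
  fixes g :: "complex \<Rightarrow> complex" and f :: "complex fps"
  assumes lq: "1 < cmod (exp lq)" and d: "d > 0" and \<delta>: "\<delta> > 0" and P: "finite P"
    and conn: "connected (- (\<Union>x\<in>P. cball x \<delta>))"
    and discs: "\<And>k z. cmod (z - lam * qpow lq (1 / of_nat (nat d)) powi k) <
       \<delta> * cmod (lam * qpow lq (1 / of_nat (nat d)) powi k) \<Longrightarrow> z \<in> - (\<Union>x\<in>P. cball x \<delta>)"
    and g: "bounded_continuation P (- (\<Union>x\<in>P. cball x \<delta>)) f g"
  shows "qH_continuation lq (of_int d) (nat d) lam (eval_fps f) g"
proof -
  define \<Omega> where "\<Omega> = - (\<Union>x\<in>P. cball x \<delta>)"
  have N: "nat d > 0" using d by simp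
  have fg: "g has_fps_expansion f" and hol: "g holomorphic_on - P" and bdd: "bounded (g ` \<Omega>)"
    using g by (auto simp: bounded_continuation_def \<Omega>_def)
  have \<Omega>: "open \<Omega>" "connected \<Omega>"
    using conn P by (auto simp: \<Omega>_def intro!: open_Compl closed_UN)
  have sub: "(\<Union>l\<in>inv_ints (nat d). {z. z \<noteq> 0 \<and> cmod (z - lam * qpow lq l) < \<delta> * cmod (qpow lq l * lam)}) \<subseteq> \<Omega>"
    using discs by (auto simp: \<Omega>_def inv_ints_def qpow_root_powi[OF N] mult.commute)
  have "\<Omega> \<subseteq> - P" using \<delta> by (force simp: \<Omega>_def)
  then have hol\<Omega>: "g holomorphic_on \<Omega>" using hol holomorphic_on_subset by blast
  have "eventually (\<lambda>z. eval_fps f z = g z) (nhds 0)"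
    using fg by (simp add: has_fps_expansion_def)
  then obtain r where r: "r > 0" "\<And>z. cmod z < r \<Longrightarrow> eval_fps f z = g z"
    by (auto simp: eventually_nhds_metric)
  have near: "\<forall>\<^sub>\<approx>z\<in>\<Omega> \<inter> (ball 0 r - {0}). g z = eval_fps f z"
  proof -
    have "\<forall>\<^sub>\<approx>z\<in>\<Omega> \<inter> (ball 0 r - {0}). z \<in> \<Omega> \<inter> (ball 0 r - {0})"
      by (rule eventually_in_cosparse) (auto intro!: open_Int open_Diff \<Omega>)
    then show ?thesis by eventually_elim (use r(2) in auto)
  qed
  obtain B where B: "\<And>z. z \<in> \<Omega> \<Longrightarrow> cmod (g z) \<le> B"
    using bdd by (auto simp: bounded_iff)
  define \<rho> where "\<rho> = cmod (exp lq) powr (1 / of_rat (of_int d))"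
  have "1 powr (1 / real_of_int d) < cmod (exp lq) powr (1 / real_of_int d)"
    using lq d by (intro powr_less_mono2) auto
  then have \<rho>: "1 < \<rho>" by (simp add: \<rho>_def)
  have growth: "cmod (g z) < (\<bar>B\<bar> + 1) * cmod (Theta (of_real \<rho>) (of_real (1 * cmod z)))"
    if "z \<in> \<Omega> - {0}" for z
  proof -
    have "1 \<le> cmod (Theta (of_real \<rho>) (of_real (1 * cmod z)))"
      using Theta_real_ge_1[OF \<rho>, of "cmod z"] that by simp
    then have "(\<bar>B\<bar> + 1) * 1 \<le> (\<bar>B\<bar> + 1) * cmod (Theta (of_real \<rho>) (of_real (1 * cmod z)))"
      by (intro mult_left_mono) auto
    with B[of z] that show ?thesis by simp
  qed
  show ?thesis
    unfolding qH_continuation_def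
  proof (intro exI conjI)
    show "\<forall>z\<in>\<Omega> - {0}. cmod (g z) < (\<bar>B\<bar> + 1) * cmod (Theta (of_real (cmod (exp lq) powr (1 / of_rat (of_int d))))
             (of_real (1 * cmod z)))"
      using growth unfolding \<rho>_def by blast
  qed (use \<delta> \<Omega> sub hol\<Omega> r(1) near in auto)
qed

text \<open>
  The transform \<^const>\<open>q_laplace\<close> selects some admissible continuation. Its domain contains the
  whole orbit \<open>lam * p powi k\<close>, hence points of the orbit arbitrarily close to \<open>0\<close>, where every admissible
  continuation agrees with the germ. The identity theorem on that domain without \<open>P\<close> gives equality at
  all points of the orbit.
\<close>
lemma qH_continuation_unique_at_orbit:
  fixes g g' :: "complex \<Rightarrow> complex"
  assumes lq: "1 < cmod (exp lq)" and N: "N > 0" and lam: "lam \<noteq> 0" and P: "finite P"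
    and avoid: "\<And>k::int. lam * qpow lq (1 / of_nat N) powi k \<notin> P"
    and fg: "g has_fps_expansion f" and hol: "g holomorphic_on - P"
    and g': "qH_continuation lq mu N lam (eval_fps f) g'"
  shows "g' (lam * qpow lq (1 / of_nat N) powi k) = g (lam * qpow lq (1 / of_nat N) powi k)"
proof -
  define p where "p = qpow lq (1 / of_nat N)"
  have p: "1 < cmod p" unfolding p_def by (rule norm_qpow_root[OF N lq])
  then have p0: "p \<noteq> 0" by auto
  obtain \<epsilon> \<Omega> r where \<epsilon>: "\<epsilon> > 0" and \<Omega>: "open \<Omega>" "connected \<Omega>"
    "(\<Union>l\<in>inv_ints N. {z. z \<noteq> 0 \<and> cmod (z - lam * qpow lq l) < \<epsilon> * cmod (qpow lq l * lam)}) \<subseteq> \<Omega>"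
    "g' holomorphic_on \<Omega>" and r: "r > 0" "\<forall>\<^sub>\<approx>z\<in>\<Omega> \<inter> (ball 0 r - {0}). g' z = eval_fps f z"
    using g' unfolding qH_continuation_def by blast
  have orbit: "lam * p powi k \<in> \<Omega>" for k
  proof -
    have "lam * p powi k \<in> {z. z \<noteq> 0 \<and> cmod (z - lam * qpow lq (of_int k / of_nat N)) <
        \<epsilon> * cmod (qpow lq (of_int k / of_nat N) * lam)}"
      using lam p0 \<epsilon> by (simp add: qpow_root_powi[OF N] p_def norm_mult)
    moreover have "of_int k / of_nat N \<in> inv_ints N" by (auto simp: inv_ints_def)
    ultimately show ?thesis using \<Omega>(3) by blast
  qed
  have "eventually (\<lambda>z. eval_fps f z = g z) (nhds 0)"
    using fg by (simp add: has_fps_expansion_def)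
  then obtain r' where r': "r' > 0" "\<And>z. cmod z < r' \<Longrightarrow> eval_fps f z = g z"
    by (auto simp: eventually_nhds_metric)
  \<comment> \<open>\<open>x = lam * p powi (- m)\<close> is an orbit point so close to \<open>0\<close> that both continuations are known near it.\<close>
  obtain m where "cmod lam / min r r' < cmod p ^ m" using real_arch_pow[OF p] by blast
  moreover have "0 < min r r'" using r r' by simp
  moreover have "0 < cmod p ^ m" using p by (intro zero_less_power) auto
  ultimately have small: "cmod lam / cmod p ^ m < min r r'"
    by (simp only: pos_divide_less_eq mult.commute)
  define x where "x = lam * p powi (- int m)"
  have x: "x \<noteq> 0" "cmod x < min r r'"
    using lam p0 small
    by (auto simp: x_def norm_mult norm_power_int power_int_minus norm_inverse norm_power divide_inverse)
  have x\<Omega>: "x \<in> \<Omega>" unfolding x_def by (rule orbit)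
  have xP: "x \<notin> P" using avoid[of "- int m"] by (simp add: x_def p_def)
  define S where "S = \<Omega> - P"
  have S: "open S" "connected S"
    unfolding S_def using \<Omega> P by (auto intro!: open_Diff finite_imp_closed connected_open_delete_finite)
  have "open (\<Omega> \<inter> (ball 0 r - {0}))" using \<Omega> by (intro open_Int open_Diff) auto
  with r(2) have "eventually (\<lambda>z. g' z = eval_fps f z) (at x)"
    using x x\<Omega> by (auto simp: eventually_cosparse_open_eq)
  moreover have "eventually (\<lambda>z. z \<in> S \<inter> ball 0 r') (at x)"
    using S x x\<Omega> xP by (intro eventually_at_in_open' open_Int) (auto simp: S_def)
  ultimately have ev: "eventually (\<lambda>z. z \<in> S \<and> g' z - g z = 0) (at x)"
    by eventually_elim (use r' in auto)
  have "g' (lam * p powi k) - g (lam * p powi k) = 0"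
  proof (rule analytic_continuation[of "\<lambda>z. g' z - g z" S "{z \<in> S. g' z - g z = 0}" x])
    show "(\<lambda>z. g' z - g z) holomorphic_on S"
      by (intro holomorphic_intros holomorphic_on_subset[OF \<Omega>(4)] holomorphic_on_subset[OF hol]) (auto simp: S_def)
    show "x islimpt {z \<in> S. g' z - g z = 0}"
      unfolding islimpt_conv_frequently_at using eventually_frequently[OF _ ev] by simp
  qed (use S x\<Omega> xP orbit avoid in \<open>auto simp: S_def p_def\<close>)
  then show ?thesis by (simp add: p_def)
qed

lemma q_laplace_eq_theta_quotient:
  fixes g :: "complex \<Rightarrow> complex"
  assumes lq: "1 < cmod (exp lq)" and d: "d > 0" and lam: "lam \<noteq> 0" and P: "finite P"
    and avoid: "\<And>k::int. lam * qpow lq (1 / of_nat (nat d)) powi k \<notin> P"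
    and fg: "g has_fps_expansion f" and hol: "g holomorphic_on - P"
    and g: "qH_continuation lq (of_int d) (nat d) lam (eval_fps f) g" and z: "z \<noteq> 0"
  shows "q_laplace lq (of_int d) (nat d) lam (eval_fps f) z =
    theta_quotient (qpow lq (1 / of_nat (nat d))) lam (\<lambda>k. g (lam * qpow lq (1 / of_nat (nat d)) powi k)) z"
proof -
  define N where "N = nat d"
  have N: "N > 0" using d by (simp add: N_def)
  define p where "p = qpow lq (1 / of_nat N)"
  have p: "1 < cmod p" unfolding p_def by (rule norm_qpow_root[OF N lq])
  define g' where "g' = (SOME g. qH_continuation lq (of_int d) N lam (eval_fps f) g)"
  have g': "qH_continuation lq (of_int d) N lam (eval_fps f) g'"
    unfolding g'_def by (rule someI[of _ g]) (use g in \<open>simp add: N_def\<close>)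
  have val: "g' (lam * p powi k) = g (lam * p powi k)" for k
    unfolding p_def
    by (rule qH_continuation_unique_at_orbit[OF lq N lam P _ fg hol g']) (use avoid in \<open>simp add: N_def\<close>)
  have dN: "(of_int d :: complex) = of_nat N" using d by (simp add: N_def)
  have "q_laplace lq (of_int d) N lam (eval_fps f) z =
      (\<Sum>\<^sub>\<infinity>l\<in>inv_ints N. g' (qpow lq l * lam) / Theta (qpow lq (1 / of_nat N)) (qpow lq (1 / of_nat N + l) * lam / z))"
    using N unfolding q_laplace_def Let_def g'_def[symmetric] by (simp add: dN)
  also have "\<dots> = (\<Sum>\<^sub>\<infinity>k\<in>UNIV. g (lam * p powi k) / Theta p (p powi (k + 1) / (z / lam)))"
    unfolding inv_ints_reindex[OF N]
  proof (intro infsum_cong)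
    fix k :: int
    have "qpow lq (1 / of_nat N + of_int k / of_nat N) = qpow lq (of_int (k + 1) / of_nat N)"
      by (simp add: add_divide_distrib add.commute)
    also have "\<dots> = p powi (k + 1)" unfolding p_def by (rule qpow_root_powi[OF N])
    finally show "g' (qpow lq (of_int k / of_nat N) * lam) /
        Theta (qpow lq (1 / of_nat N)) (qpow lq (1 / of_nat N + of_int k / of_nat N) * lam / z) =
        g (lam * p powi k) / Theta p (p powi (k + 1) / (z / lam))"
      using val[of k] by (simp add: qpow_root_powi[OF N] p_def[symmetric] mult.commute)
  qed
  also have "\<dots> = theta_quotient p lam (\<lambda>k. g (lam * p powi k)) z"
    unfolding theta_quotient_def by (rule laplace_sum[OF p]) (use z lam in auto)
  finally show ?thesis by (simp add: N_def p_def)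
qed

section \<open>Gauge equations for block matrices\<close>

lemma block_gauge_iff:
  fixes A U E X Y :: "'a :: comm_ring_1 mat"
  assumes c: "A \<in> carrier_mat m1 m1" "U \<in> carrier_mat m1 m2" "E \<in> carrier_mat m2 m2"
    "X \<in> carrier_mat m1 m2" "Y \<in> carrier_mat m1 m2"
  shows "four_block_mat A U (0\<^sub>m m2 m1) E * unip_mat m1 m2 X =
           unip_mat m1 m2 Y * four_block_mat A (0\<^sub>m m1 m2) (0\<^sub>m m2 m1) E \<longleftrightarrow>
         A * X + U = Y * E"
proof -
  have z: "0\<^sub>m m1 m2 \<in> carrier_mat m1 m2" "0\<^sub>m m2 m1 \<in> carrier_mat m2 m1"
    "1\<^sub>m m1 \<in> carrier_mat m1 m1" "1\<^sub>m m2 \<in> carrier_mat m2 m2" by auto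
  have AX: "A * X \<in> carrier_mat m1 m2" by (rule mult_carrier_mat[OF c(1,4)])
  have YE: "Y * E \<in> carrier_mat m1 m2" by (rule mult_carrier_mat[OF c(5,3)])
  have "four_block_mat A U (0\<^sub>m m2 m1) E * unip_mat m1 m2 X =
      four_block_mat (A * 1\<^sub>m m1 + U * 0\<^sub>m m2 m1) (A * X + U * 1\<^sub>m m2)
        (0\<^sub>m m2 m1 * 1\<^sub>m m1 + E * 0\<^sub>m m2 m1) (0\<^sub>m m2 m1 * X + E * 1\<^sub>m m2)"
    unfolding unip_mat_def by (rule mult_four_block_mat[OF c(1,2) z(2) c(3) z(3) c(4) z(2,4)])
  also have "A * 1\<^sub>m m1 + U * 0\<^sub>m m2 m1 = A" using c by simp
  also have "A * X + U * 1\<^sub>m m2 = A * X + U" using c by simp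
  also have "0\<^sub>m m2 m1 * 1\<^sub>m m1 + E * 0\<^sub>m m2 m1 = 0\<^sub>m m2 m1" using c by simp
  also have "0\<^sub>m m2 m1 * X + E * 1\<^sub>m m2 = E" using c by simp
  finally have lhs: "four_block_mat A U (0\<^sub>m m2 m1) E * unip_mat m1 m2 X =
      four_block_mat A (A * X + U) (0\<^sub>m m2 m1) E" .
  have "unip_mat m1 m2 Y * four_block_mat A (0\<^sub>m m1 m2) (0\<^sub>m m2 m1) E =
      four_block_mat (1\<^sub>m m1 * A + Y * 0\<^sub>m m2 m1) (1\<^sub>m m1 * 0\<^sub>m m1 m2 + Y * E)
        (0\<^sub>m m2 m1 * A + 1\<^sub>m m2 * 0\<^sub>m m2 m1) (0\<^sub>m m2 m1 * 0\<^sub>m m1 m2 + 1\<^sub>m m2 * E)"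
    unfolding unip_mat_def by (rule mult_four_block_mat[OF z(3) c(5) z(2,4) c(1) z(1,2) c(3)])
  also have "1\<^sub>m m1 * A + Y * 0\<^sub>m m2 m1 = A" using c by simp
  also have "1\<^sub>m m1 * 0\<^sub>m m1 m2 + Y * E = Y * E" using c YE by simp
  also have "0\<^sub>m m2 m1 * A + 1\<^sub>m m2 * 0\<^sub>m m2 m1 = 0\<^sub>m m2 m1" using c by simp
  also have "0\<^sub>m m2 m1 * 0\<^sub>m m1 m2 + 1\<^sub>m m2 * E = E" using c by simp
  finally have rhs: "unip_mat m1 m2 Y * four_block_mat A (0\<^sub>m m1 m2) (0\<^sub>m m2 m1) E =
      four_block_mat A (Y * E) (0\<^sub>m m2 m1) E" .
  have "A * X + U = Y * E"
    if eq: "four_block_mat A (A * X + U) (0\<^sub>m m2 m1) E = four_block_mat A (Y * E) (0\<^sub>m m2 m1) E"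
  proof (rule eq_matI)
    fix i j assume "i < dim_row (Y * E)" "j < dim_col (Y * E)"
    then have ij: "i < m1" "j < m2" using YE by auto
    have "four_block_mat A (A * X + U) (0\<^sub>m m2 m1) E $$ (i, m1 + j) =
        four_block_mat A (Y * E) (0\<^sub>m m2 m1) E $$ (i, m1 + j)" unfolding eq ..
    then show "(A * X + U) $$ (i, j) = (Y * E) $$ (i, j)"
      using ij c AX YE by (simp del: index_mult_mat(1) index_add_mat(1))
  qed (use c AX YE in auto)
  then show ?thesis unfolding lhs rhs by auto
qed

lemma unip_mat_carrier: "X \<in> carrier_mat m1 m2 \<Longrightarrow> unip_mat m1 m2 X \<in> carrier_mat (m1 + m2) (m1 + m2)"
  unfolding unip_mat_def by (rule four_block_carrier_mat) auto

lemma formal_gauge_block: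
  fixes X :: "complex fps mat" and U :: "complex fls mat"
  assumes C1: "C1 \<in> carrier_mat m1 m1" and C2: "C2 \<in> carrier_mat m2 m2"
    and U: "U \<in> carrier_mat m1 m2" and X: "X \<in> carrier_mat m1 m2"
    and gauge: "formal_gauge q (D_mat n1 n2 C1 C2 U) (Diag_mat n1 n2 C1 C2) (unip_mat m1 m2 X)"
  shows "zpow_mat n1 C1 * map_mat fps_to_fls X + U =
           map_mat fps_to_fls (map_mat (sigma_q_fps q) X) * zpow_mat n2 C2"
proof -
  interpret semiring_hom "fps_to_fls :: complex fps \<Rightarrow> complex fls"
    by unfold_locales (auto simp: fls_times_fps_to_fls fps_to_fls_plus)
  let ?H = "unip_mat m1 m2 X" and ?S = "unip_mat m1 m2 (map_mat (sigma_q_fps q) X)"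
  have dims: "dim_row C1 = m1" "dim_col C1 = m1" "dim_row C2 = m2" "dim_col C2 = m2" using C1 C2 by auto
  have Z: "zpow_mat n1 C1 \<in> carrier_mat m1 m1" "zpow_mat n2 C2 \<in> carrier_mat m2 m2"
    using C1 C2 by (auto simp: zpow_mat_def)
  have H: "?H \<in> carrier_mat (m1 + m2) (m1 + m2)" by (rule unip_mat_carrier[OF X])
  have SX: "map_mat (sigma_q_fps q) X \<in> carrier_mat m1 m2" using X by simp
  have S: "?S \<in> carrier_mat (m1 + m2) (m1 + m2)" by (rule unip_mat_carrier[OF SX])
  obtain G where G: "inverts_mat ?H G" "inverts_mat G ?H"
    "D_mat n1 n2 C1 C2 U = map_mat fps_to_fls (map_mat (sigma_q_fps q) ?H) * Diag_mat n1 n2 C1 C2 * map_mat fps_to_fls G"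
    using gauge by (auto simp: formal_gauge_def)
  have HG: "?H * G = 1\<^sub>m (m1 + m2)" using G(1) H by (simp add: inverts_mat_def)
  have GH: "G * ?H = 1\<^sub>m (dim_row G)" using G(2) by (simp add: inverts_mat_def)
  have "dim_col (?H * G) = m1 + m2" unfolding HG by simp
  moreover have "dim_col (G * ?H) = dim_row G" unfolding GH by simp
  then have "dim_row G = m1 + m2" using H by simp
  ultimately have Gc: "G \<in> carrier_mat (m1 + m2) (m1 + m2)" by auto
  have GH': "G * ?H = 1\<^sub>m (m1 + m2)" using GH Gc by simp
  have mS: "map_mat (sigma_q_fps q) ?H = ?S"
    unfolding unip_mat_def using X
    by (subst map_four_block_mat[of _ m1 m1 _ m2 _ m2])
       (auto simp: sigma_q_fps_def intro!: arg_cong2[of _ _ _ _ "\<lambda>a b. four_block_mat a _ _ b"] eq_matI)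
  have fls_unip: "map_mat fps_to_fls (unip_mat m1 m2 Y) = unip_mat m1 m2 (map_mat fps_to_fls Y)"
    if "Y \<in> carrier_mat m1 m2" for Y :: "complex fps mat"
    unfolding unip_mat_def using that
    by (subst map_four_block_mat[of _ m1 m1 _ m2 _ m2])
       (auto intro!: arg_cong2[of _ _ _ _ "\<lambda>a b. four_block_mat a _ _ b"] eq_matI)
  have Diag: "Diag_mat n1 n2 C1 C2 \<in> carrier_mat (m1 + m2) (m1 + m2)"
    unfolding Diag_mat_def dims by (rule four_block_carrier_mat[OF Z])
  have fH: "map_mat fps_to_fls ?H \<in> carrier_mat (m1 + m2) (m1 + m2)" using H by simp
  have fG: "map_mat fps_to_fls G \<in> carrier_mat (m1 + m2) (m1 + m2)" using Gc by simp
  have fS: "map_mat fps_to_fls ?S \<in> carrier_mat (m1 + m2) (m1 + m2)" using S by simp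
  have SD: "map_mat fps_to_fls ?S * Diag_mat n1 n2 C1 C2 \<in> carrier_mat (m1 + m2) (m1 + m2)"
    by (rule mult_carrier_mat[OF fS Diag])
  have "D_mat n1 n2 C1 C2 U * map_mat fps_to_fls ?H =
      map_mat fps_to_fls ?S * Diag_mat n1 n2 C1 C2 * (map_mat fps_to_fls G * map_mat fps_to_fls ?H)"
    unfolding G(3) mS by (rule assoc_mult_mat[OF SD fG fH])
  also have "map_mat fps_to_fls G * map_mat fps_to_fls ?H = 1\<^sub>m (m1 + m2)"
    using mat_hom_mult[OF Gc H] by (simp add: GH' mat_hom_one)
  also have "map_mat fps_to_fls ?S * Diag_mat n1 n2 C1 C2 * 1\<^sub>m (m1 + m2) =
      map_mat fps_to_fls ?S * Diag_mat n1 n2 C1 C2"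
    by (rule right_mult_one_mat[OF SD])
  finally have "four_block_mat (zpow_mat n1 C1) U (0\<^sub>m m2 m1) (zpow_mat n2 C2) * unip_mat m1 m2 (map_mat fps_to_fls X) =
      unip_mat m1 m2 (map_mat fps_to_fls (map_mat (sigma_q_fps q) X)) *
        four_block_mat (zpow_mat n1 C1) (0\<^sub>m m1 m2) (0\<^sub>m m2 m1) (zpow_mat n2 C2)"
    unfolding D_mat_def Diag_mat_def dims fls_unip[OF X] fls_unip[OF SX] .
  then show ?thesis
    using block_gauge_iff[OF Z(1) U Z(2), of "map_mat fps_to_fls X" "map_mat fps_to_fls (map_mat (sigma_q_fps q) X)"] X
    by simp
qed

lemma fls_nth_X_intpow_mult:
  "fls_nth (fls_X_intpow k * f) m = fls_nth (f :: complex fls) (m - k)"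
  by (subst fls_X_intpow_times_conv_shift(1)) simp

lemma zpow_mat_index:
  assumes "C \<in> carrier_mat m m" "i < m" "j < m"
  shows "zpow_mat n C $$ (i, j) = fls_X_intpow n * fls_const (C $$ (i, j))"
  using assms by (simp add: zpow_mat_def)

text \<open>
  The coefficient of \<open>z ^ (n1 + l)\<close> in \<open>formal_gauge_block\<close>. The entries of \<open>U\<close> contribute only for
  \<open>l < N\<close> and the right hand side only for \<open>l \<ge> N\<close>.
\<close>
lemma formal_gauge_coeff:
  fixes X :: "complex fps mat" and U :: "complex fls mat" and c :: "nat \<Rightarrow> nat \<Rightarrow> int \<Rightarrow> complex"
  assumes C1: "C1 \<in> carrier_mat m1 m1" and C2: "C2 \<in> carrier_mat m2 m2"
    and U: "U \<in> carrier_mat m1 m2" and X: "X \<in> carrier_mat m1 m2" and n: "n1 < n2"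
    and Uc: "\<And>i j. i < m1 \<Longrightarrow> j < m2 \<Longrightarrow> U $$ (i, j) = (\<Sum>\<nu>=n1..n2-1. fls_const (c i j \<nu>) * fls_X_intpow \<nu>)"
    and gauge: "formal_gauge q (D_mat n1 n2 C1 C2 U) (Diag_mat n1 n2 C1 C2) (unip_mat m1 m2 X)"
    and ij: "i < m1" "j < m2"
  defines "N \<equiv> nat (n2 - n1)"
  shows "(\<Sum>a<m1. C1 $$ (i, a) * fps_nth (X $$ (a, j)) l) =
    (if l < N then - c i j (n1 + int l) else
       q ^ (l - N) * (\<Sum>b<m2. fps_nth (X $$ (i, b)) (l - N) * C2 $$ (b, j)))"
proof -
  have Z: "zpow_mat n1 C1 \<in> carrier_mat m1 m1" "zpow_mat n2 C2 \<in> carrier_mat m2 m2"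
    using C1 C2 by (auto simp: zpow_mat_def)
  have fX: "map_mat fps_to_fls X \<in> carrier_mat m1 m2" using X by simp
  have fS: "map_mat fps_to_fls (map_mat (sigma_q_fps q) X) \<in> carrier_mat m1 m2" using X by simp
  have "(zpow_mat n1 C1 * map_mat fps_to_fls X + U) $$ (i, j) =
      (map_mat fps_to_fls (map_mat (sigma_q_fps q) X) * zpow_mat n2 C2) $$ (i, j)"
    by (simp only: formal_gauge_block[OF C1 C2 U X gauge])
  moreover have "(zpow_mat n1 C1 * map_mat fps_to_fls X + U) $$ (i, j) =
      (\<Sum>a<m1. fls_X_intpow n1 * fls_const (C1 $$ (i, a)) * fps_to_fls (X $$ (a, j))) + U $$ (i, j)"
    using index_mult_mat_sum[OF Z(1) fX ij] ij C1 X U by (simp add: zpow_mat_def del: index_mult_mat(1))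
  moreover have "(map_mat fps_to_fls (map_mat (sigma_q_fps q) X) * zpow_mat n2 C2) $$ (i, j) =
      (\<Sum>b<m2. fps_to_fls (sigma_q_fps q (X $$ (i, b))) * (fls_X_intpow n2 * fls_const (C2 $$ (b, j))))"
    using index_mult_mat_sum[OF fS Z(2) ij] ij C2 X by (simp add: zpow_mat_def del: index_mult_mat(1))
  ultimately have "fls_nth ((\<Sum>a<m1. fls_X_intpow n1 * fls_const (C1 $$ (i, a)) * fps_to_fls (X $$ (a, j))) + U $$ (i, j)) (n1 + int l) =
      fls_nth (\<Sum>b<m2. fps_to_fls (sigma_q_fps q (X $$ (i, b))) * (fls_X_intpow n2 * fls_const (C2 $$ (b, j)))) (n1 + int l)"
    by simp
  moreover have "fls_nth (\<Sum>a<m1. fls_X_intpow n1 * fls_const (C1 $$ (i, a)) * fps_to_fls (X $$ (a, j))) (n1 + int l) =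
      (\<Sum>a<m1. C1 $$ (i, a) * fps_nth (X $$ (a, j)) l)"
    unfolding fls_nth_sum
    by (intro sum.cong refl) (simp only: mult.assoc fls_nth_X_intpow_mult, simp)
  moreover have "fls_nth (U $$ (i, j)) (n1 + int l) = (if l < N then c i j (n1 + int l) else 0)"
  proof -
    have "fls_nth (U $$ (i, j)) (n1 + int l) = (\<Sum>\<nu>=n1..n2-1. if n1 + int l = \<nu> then c i j \<nu> else 0)"
      unfolding Uc[OF ij] fls_nth_sum by (intro sum.cong refl) simp
    also have "\<dots> = (if l < N then c i j (n1 + int l) else 0)"
      using n by (auto simp: sum.delta' N_def)
    finally show ?thesis .
  qed
  moreover have "fls_nth (\<Sum>b<m2. fps_to_fls (sigma_q_fps q (X $$ (i, b))) * (fls_X_intpow n2 * fls_const (C2 $$ (b, j)))) (n1 + int l) =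
      (if l < N then 0 else q ^ (l - N) * (\<Sum>b<m2. fps_nth (X $$ (i, b)) (l - N) * C2 $$ (b, j)))"
  proof -
    have "fls_nth (fps_to_fls (sigma_q_fps q (X $$ (i, b))) * (fls_X_intpow n2 * fls_const (C2 $$ (b, j)))) (n1 + int l) =
        (if l < N then 0 else q ^ (l - N) * fps_nth (X $$ (i, b)) (l - N) * C2 $$ (b, j))" for b
    proof -
      have "fps_to_fls (sigma_q_fps q (X $$ (i, b))) * (fls_X_intpow n2 * fls_const (C2 $$ (b, j))) =
          fls_X_intpow n2 * (fls_const (C2 $$ (b, j)) * fps_to_fls (sigma_q_fps q (X $$ (i, b))))"
        by (simp only: mult_ac)
      also have "fls_nth \<dots> (n1 + int l) =
          C2 $$ (b, j) * fls_nth (fps_to_fls (sigma_q_fps q (X $$ (i, b)))) (n1 + int l - n2)"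
        by (simp only: fls_nth_X_intpow_mult) simp
      also have "fls_nth (fps_to_fls (sigma_q_fps q (X $$ (i, b)))) (n1 + int l - n2) =
          (if l < N then 0 else q ^ (l - N) * fps_nth (X $$ (i, b)) (l - N))"
      proof (cases "l < N")
        case True
        then show ?thesis by (simp add: N_def)
      next
        case False
        then have "nat (n1 + int l - n2) = l - N" "n1 + int l - n2 \<ge> 0" using n by (auto simp: N_def)
        then show ?thesis using False by (simp add: sigma_q_fps_def fps_compose_linear)
      qed
      finally show ?thesis by (simp add: mult_ac)
    qed
    then show ?thesis unfolding fls_nth_sum by (simp add: sum_distrib_left mult_ac)
  qed
  ultimately have "(\<Sum>a<m1. C1 $$ (i, a) * fps_nth (X $$ (a, j)) l) + (if l < N then c i j (n1 + int l) else 0) =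
      (if l < N then 0 else q ^ (l - N) * (\<Sum>b<m2. fps_nth (X $$ (i, b)) (l - N) * C2 $$ (b, j)))"
    by (simp only: fls_plus_nth)
  then show ?thesis by (cases "l < N") (simp_all only: if_True if_False eq_neg_iff_add_eq_0 add_0_right simp_thms)
qed

text \<open>
  The factor \<open>z powi n1\<close> common to both sides is cancelled.
\<close>
lemma eval_mat_equation_iff:
  fixes U :: "complex fls mat" and c :: "nat \<Rightarrow> nat \<Rightarrow> int \<Rightarrow> complex"
  assumes C1: "C1 \<in> carrier_mat m1 m1" and C2: "C2 \<in> carrier_mat m2 m2"
    and U: "U \<in> carrier_mat m1 m2" and n: "n1 < n2" and z: "z \<noteq> 0"
    and Uc: "\<And>i j. i < m1 \<Longrightarrow> j < m2 \<Longrightarrow> U $$ (i, j) = (\<Sum>\<nu>=n1..n2-1. fls_const (c i j \<nu>) * fls_X_intpow \<nu>)"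
    and X: "X \<in> carrier_mat m1 m2" and Y: "Y \<in> carrier_mat m1 m2"
  defines "N \<equiv> nat (n2 - n1)"
  shows "eval_mat (D_mat n1 n2 C1 C2 U) z * unip_mat m1 m2 X = unip_mat m1 m2 Y * eval_mat (Diag_mat n1 n2 C1 C2) z \<longleftrightarrow>
    (\<forall>i<m1. \<forall>j<m2. (\<Sum>a<m1. C1 $$ (i, a) * X $$ (a, j)) + (\<Sum>l<N. c i j (n1 + int l) * z ^ l) =
       z ^ N * (\<Sum>b<m2. Y $$ (i, b) * C2 $$ (b, j)))"
proof -
  have dims: "dim_row C1 = m1" "dim_col C1 = m1" "dim_row C2 = m2" "dim_col C2 = m2" using C1 C2 by auto
  define A where "A = map_mat (\<lambda>f. eval_fls f z) (zpow_mat n1 C1)"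
  define E where "E = map_mat (\<lambda>f. eval_fls f z) (zpow_mat n2 C2)"
  define W where "W = map_mat (\<lambda>f. eval_fls f z) U"
  have A: "A \<in> carrier_mat m1 m1" and E: "E \<in> carrier_mat m2 m2" and W: "W \<in> carrier_mat m1 m2"
    using C1 C2 U by (auto simp: A_def E_def W_def zpow_mat_def)
  have evX: "eval_fls (fls_X_intpow k * fls_const x) z = z powi k * x" for k x
    using z by (subst eval_fls_mult) auto
  have Aij: "A $$ (i, a) = z powi n1 * C1 $$ (i, a)" if "i < m1" "a < m1" for i a
  proof -
    have "A $$ (i, a) = eval_fls (zpow_mat n1 C1 $$ (i, a)) z"
      using that C1 by (simp add: A_def zpow_mat_def)
    then show ?thesis by (simp only: zpow_mat_index[OF C1 that] evX)
  qed
  have Eij: "E $$ (b, j) = z powi n2 * C2 $$ (b, j)" if "b < m2" "j < m2" for b j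
  proof -
    have "E $$ (b, j) = eval_fls (zpow_mat n2 C2 $$ (b, j)) z"
      using that C2 by (simp add: E_def zpow_mat_def)
    then show ?thesis by (simp only: zpow_mat_index[OF C2 that] evX)
  qed
  \<comment> \<open>The radius of convergence is carried along because evaluation of a sum requires it.\<close>
  have ev_sum: "fls_conv_radius (\<Sum>\<nu>\<in>S. fls_const (d \<nu>) * fls_X_intpow \<nu>) = \<infinity> \<and>
      eval_fls (\<Sum>\<nu>\<in>S. fls_const (d \<nu>) * fls_X_intpow \<nu>) z = (\<Sum>\<nu>\<in>S. d \<nu> * z powi \<nu>)"
    if "finite S" for S :: "int set" and d :: "int \<Rightarrow> complex"
    using that
  proof (induction S rule: finite_induct)
    case (insert x S)
    have R1: "fls_conv_radius (fls_const (d x) * fls_X_intpow x) = \<infinity>"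
      using fls_conv_radius_mult_ge[of \<infinity> "fls_const (d x)" "fls_X_intpow x"] by simp
    have R2: "fls_conv_radius (\<Sum>\<nu>\<in>S. fls_const (d \<nu>) * fls_X_intpow \<nu>) = \<infinity>" using insert by blast
    have "fls_conv_radius (fls_const (d x) * fls_X_intpow x + (\<Sum>\<nu>\<in>S. fls_const (d \<nu>) * fls_X_intpow \<nu>)) = \<infinity>"
      using fls_conv_radius_add_ge[of \<infinity> "fls_const (d x) * fls_X_intpow x" "\<Sum>\<nu>\<in>S. fls_const (d \<nu>) * fls_X_intpow \<nu>"]
        R1 R2 by simp
    moreover have "eval_fls (fls_const (d x) * fls_X_intpow x + (\<Sum>\<nu>\<in>S. fls_const (d \<nu>) * fls_X_intpow \<nu>)) z =
        d x * z powi x + (\<Sum>\<nu>\<in>S. d \<nu> * z powi \<nu>)"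
    proof -
      have "eval_fls (fls_const (d x) * fls_X_intpow x + (\<Sum>\<nu>\<in>S. fls_const (d \<nu>) * fls_X_intpow \<nu>)) z =
          eval_fls (fls_const (d x) * fls_X_intpow x) z + eval_fls (\<Sum>\<nu>\<in>S. fls_const (d \<nu>) * fls_X_intpow \<nu>) z"
        by (rule eval_fls_add) (simp_all only: R1 R2 z less_ereal.simps simp_thms)
      also have "eval_fls (fls_const (d x) * fls_X_intpow x) z = d x * z powi x"
        using evX[of x "d x"] by (simp only: mult.commute)
      also have "eval_fls (\<Sum>\<nu>\<in>S. fls_const (d \<nu>) * fls_X_intpow \<nu>) z = (\<Sum>\<nu>\<in>S. d \<nu> * z powi \<nu>)"
        using insert by blast
      finally show ?thesis .
    qed
    ultimately show ?case by (simp only: sum.insert[OF insert(1,2)])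
  qed simp
  have Wij: "W $$ (i, j) = z powi n1 * (\<Sum>l<N. c i j (n1 + int l) * z ^ l)" if "i < m1" "j < m2" for i j
  proof -
    have "W $$ (i, j) = (\<Sum>\<nu>=n1..n2-1. c i j \<nu> * z powi \<nu>)"
    proof -
      have "W $$ (i, j) = eval_fls (U $$ (i, j)) z" using that U by (simp add: W_def)
      then show ?thesis
        using ev_sum[of "{n1..n2-1}" "c i j"] by (simp only: Uc[OF that] finite_atLeastAtMost_int simp_thms)
    qed
    also have "\<dots> = (\<Sum>l<N. c i j (n1 + int l) * z powi (n1 + int l))"
      by (rule sum.reindex_bij_witness[of _ "\<lambda>l. n1 + int l" "\<lambda>\<nu>. nat (\<nu> - n1)"]) (use n in \<open>auto simp: N_def\<close>)
    also have "\<dots> = z powi n1 * (\<Sum>l<N. c i j (n1 + int l) * z ^ l)"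
      using z by (simp add: sum_distrib_left power_int_add mult_ac)
    finally show ?thesis .
  qed
  have D: "eval_mat (D_mat n1 n2 C1 C2 U) z = four_block_mat A W (0\<^sub>m m2 m1) E"
    unfolding eval_mat_def D_mat_def dims A_def E_def W_def
    by (subst map_four_block_mat[of _ m1 m1 _ m2 _ m2])
       (use C1 C2 U in \<open>auto simp: zpow_mat_def intro!: arg_cong[of _ _ "\<lambda>x. four_block_mat _ _ x _"] eq_matI\<close>)
  have Dg: "eval_mat (Diag_mat n1 n2 C1 C2) z = four_block_mat A (0\<^sub>m m1 m2) (0\<^sub>m m2 m1) E"
    unfolding eval_mat_def Diag_mat_def dims A_def E_def
    by (subst map_four_block_mat[of _ m1 m1 _ m2 _ m2])
       (use C1 C2 U in \<open>auto simp: zpow_mat_def intro!: arg_cong2[of _ _ _ _ "\<lambda>x y. four_block_mat _ x y _"] eq_matI\<close>)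
  have AX: "A * X \<in> carrier_mat m1 m2" by (rule mult_carrier_mat[OF A X])
  have YE: "Y * E \<in> carrier_mat m1 m2" by (rule mult_carrier_mat[OF Y E])
  have entry: "(A * X + W) $$ (i, j) = (Y * E) $$ (i, j) \<longleftrightarrow>
      (\<Sum>a<m1. C1 $$ (i, a) * X $$ (a, j)) + (\<Sum>l<N. c i j (n1 + int l) * z ^ l) =
       z ^ N * (\<Sum>b<m2. Y $$ (i, b) * C2 $$ (b, j))" if ij: "i < m1" "j < m2" for i j
  proof -
    have "(A * X + W) $$ (i, j) = (\<Sum>a<m1. A $$ (i, a) * X $$ (a, j)) + W $$ (i, j)"
      using index_mult_mat_sum[OF A X ij] ij AX W by (simp del: index_mult_mat(1))
    also have "(\<Sum>a<m1. A $$ (i, a) * X $$ (a, j)) = z powi n1 * (\<Sum>a<m1. C1 $$ (i, a) * X $$ (a, j))"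
      using ij Aij by (simp add: sum_distrib_left mult.assoc)
    finally have l: "(A * X + W) $$ (i, j) =
        z powi n1 * ((\<Sum>a<m1. C1 $$ (i, a) * X $$ (a, j)) + (\<Sum>l<N. c i j (n1 + int l) * z ^ l))"
      by (simp add: Wij[OF ij] distrib_left)
    have "(Y * E) $$ (i, j) = (\<Sum>b<m2. Y $$ (i, b) * E $$ (b, j))"
      by (rule index_mult_mat_sum[OF Y E ij])
    also have "\<dots> = z powi n2 * (\<Sum>b<m2. Y $$ (i, b) * C2 $$ (b, j))"
      using ij Eij by (simp add: sum_distrib_left mult_ac)
    also have "z powi n2 = z powi n1 * z ^ N"
    proof -
      have "n1 + int N = n2" using n by (simp add: N_def)
      then show ?thesis using z power_int_add[of z n1 "int N"] by simp
    qed
    finally have r: "(Y * E) $$ (i, j) = z powi n1 * (z ^ N * (\<Sum>b<m2. Y $$ (i, b) * C2 $$ (b, j)))"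
      by (simp add: mult_ac)
    show ?thesis unfolding l r using z by simp
  qed
  have "A * X + W = Y * E \<longleftrightarrow> (\<forall>i<m1. \<forall>j<m2. (A * X + W) $$ (i, j) = (Y * E) $$ (i, j))"
    using AX W YE by (auto simp del: index_mult_mat(1) index_add_mat(1) intro!: eq_matI)
  then show ?thesis
    unfolding D Dg block_gauge_iff[OF A W E X Y] using entry by simp
qed

section \<open>Borel-Laplace sum and meromorphic gauge transformation\<close>

text \<open>
  The constant \<open>p powi (- tri (N - 1))\<close> is \<open>q\<close> to the power \<open>- (N - 1) / 2\<close>, and \<open>(lam * p powi k) ^ N\<close> runs
  through \<open>lam ^ N\<close> times the integral powers of \<open>q\<close>: a resonance is an equality of two cosets of these powers.
\<close>
lemma not_Sigma_imp_nonresonant: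
  assumes lam: "lam \<noteq> 0" "lam \<notin> Sigma_set lq n1 n2 C1 C2" and n: "n1 < n2"
    and \<alpha>: "\<alpha>1 \<in> spectrum C1" "\<alpha>2 \<in> spectrum C2" "\<alpha>2 \<noteq> 0"
  defines "N \<equiv> nat (n2 - n1)"
  defines "p \<equiv> qpow lq (1 / of_nat N)"
  shows "\<alpha>1 \<noteq> p powi (- tri (int N - 1)) * \<alpha>2 * (lam * p powi k) ^ N"
proof
  assume eq: "\<alpha>1 = p powi (- tri (int N - 1)) * \<alpha>2 * (lam * p powi k) ^ N"
  have N: "N > 0" and nN: "n2 - n1 = int N" using n by (auto simp: N_def)
  have q: "p ^ N = exp lq" unfolding p_def by (rule qpow_root_power[OF N])
  have half: "qpow lq (- (of_int (n2 - n1) - 1) / 2) = p powi (- tri (int N - 1))"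
  proof -
    have "2 * of_int (tri (int N - 1)) = (of_nat N - 1) * (of_nat N :: complex)"
      using arg_cong[OF two_tri[of "int N - 1"], of "of_int :: int \<Rightarrow> complex"] by simp
    then have "of_int (- tri (int N - 1)) / of_nat N = (- (of_int (n2 - n1) - 1) / 2 :: complex)"
      using N unfolding nN by (simp add: field_simps)
    then have "qpow lq (- (of_int (n2 - n1) - 1) / 2) = qpow lq (of_int (- tri (int N - 1)) / of_nat N)"
      by (simp only:)
    also have "\<dots> = p powi (- tri (int N - 1))" unfolding p_def by (rule qpow_root_powi[OF N])
    finally show ?thesis .
  qed
  define A where "A = lam powi (n2 - n1) * qpow lq (- (of_int (n2 - n1) - 1) / 2)"
  have A: "A = lam ^ N * p powi (- tri (int N - 1))" unfolding A_def half unfolding nN by simp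
  have "(p powi k) ^ N = exp lq powi k"
    unfolding q[symmetric] by (simp add: power_int_power power_int_power' mult.commute)
  then have \<alpha>A: "\<alpha>1 / \<alpha>2 = A * exp lq powi k"
    using eq \<alpha>(3) by (simp add: A power_mult_distrib mult_ac)
  have "range (\<lambda>k::int. A * exp lq powi k) = range (\<lambda>k::int. \<alpha>1 / \<alpha>2 * exp lq powi k)"
  proof (intro equalityI image_subsetI)
    fix l :: int
    have "A * exp lq powi l = \<alpha>1 / \<alpha>2 * exp lq powi (l - k)"
      unfolding \<alpha>A by (simp add: power_int_diff)
    then show "A * exp lq powi l \<in> range (\<lambda>k::int. \<alpha>1 / \<alpha>2 * exp lq powi k)" by blast
    have "\<alpha>1 / \<alpha>2 * exp lq powi l = A * exp lq powi (k + l)"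
      unfolding \<alpha>A by (simp add: power_int_add)
    then show "\<alpha>1 / \<alpha>2 * exp lq powi l \<in> range (\<lambda>k::int. A * exp lq powi k)" by blast
  qed
  then have "lam \<in> Sigma_set lq n1 n2 C1 C2"
    unfolding Sigma_set_def A_def using lam(1) \<alpha>(1,2) by blast
  with lam(2) show False ..
qed

lemma q_borel_nth:
  assumes d: "d > 0"
  shows "fps_nth (q_borel lq (of_int d) f) l =
           fps_nth f l * qpow lq (1 / of_nat (nat d)) powi (- tri (int l - 1))"
proof -
  have N: "nat d > 0" using d by simp
  have "2 * of_int (tri (int l - 1)) = (of_nat l - 1) * (of_nat l :: complex)"
    using arg_cong[OF two_tri[of "int l - 1"], of "of_int :: int \<Rightarrow> complex"] by simp
  then have "of_int (- tri (int l - 1)) / of_nat (nat d) = (- (of_nat l * (of_nat l - 1)) / (2 * of_int d) :: complex)"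
    using d by (simp add: field_simps)
  then show ?thesis
    unfolding q_borel_def qpow_root_powi[OF N, symmetric] by simp
qed

text \<open>
  The Borel weights turn the factor \<open>q ^ (l - N)\<close> of the recursion into a constant.
\<close>
lemma q_borel_gauge_coeff:
  fixes X :: "complex fps mat" and U :: "complex fls mat" and c :: "nat \<Rightarrow> nat \<Rightarrow> int \<Rightarrow> complex"
  assumes C1: "C1 \<in> carrier_mat m1 m1" and C2: "C2 \<in> carrier_mat m2 m2"
    and U: "U \<in> carrier_mat m1 m2" and X: "X \<in> carrier_mat m1 m2" and n: "n1 < n2"
    and Uc: "\<And>i j. i < m1 \<Longrightarrow> j < m2 \<Longrightarrow> U $$ (i, j) = (\<Sum>\<nu>=n1..n2-1. fls_const (c i j \<nu>) * fls_X_intpow \<nu>)"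
    and gauge: "formal_gauge (exp lq) (D_mat n1 n2 C1 C2 U) (Diag_mat n1 n2 C1 C2) (unip_mat m1 m2 X)"
    and ij: "i < m1" "j < m2"
  defines "N \<equiv> nat (n2 - n1)"
  defines "p \<equiv> qpow lq (1 / of_nat N)"
  defines "f \<equiv> \<lambda>i j. q_borel lq (of_int (n2 - n1)) (X $$ (i, j))"
  shows "(\<Sum>a<m1. C1 $$ (i, a) * fps_nth (f a j) l) =
      (if l < N then - (c i j (n1 + int l) * p powi (- tri (int l - 1)))
       else p powi (- tri (int N - 1)) * (\<Sum>b<m2. fps_nth (f i b) (l - N) * C2 $$ (b, j)))"
proof -
  have d: "n2 - n1 > 0" and N: "N > 0" using n by (auto simp: N_def)
  define s where "s = p powi (- tri (int N - 1))"
  have p0: "p \<noteq> 0" by (simp add: p_def qpow_def)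
  have q: "p ^ N = exp lq" unfolding p_def by (rule qpow_root_power[OF N])
  have fn: "fps_nth (f i j) l = fps_nth (X $$ (i, j)) l * p powi (- tri (int l - 1))" for i j l
    unfolding f_def q_borel_nth[OF d] p_def N_def ..
  have "(\<Sum>a<m1. C1 $$ (i, a) * fps_nth (f a j) l) =
      (\<Sum>a<m1. C1 $$ (i, a) * fps_nth (X $$ (a, j)) l) * p powi (- tri (int l - 1))"
    by (simp add: fn sum_distrib_right mult.assoc)
  also have "(\<Sum>a<m1. C1 $$ (i, a) * fps_nth (X $$ (a, j)) l) =
    (if l < N then - c i j (n1 + int l) else
     exp lq ^ (l - N) * (\<Sum>b<m2. fps_nth (X $$ (i, b)) (l - N) * C2 $$ (b, j)))"
    unfolding N_def by (rule formal_gauge_coeff[OF C1 C2 U X n Uc gauge ij])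
  also have "\<dots> * p powi (- tri (int l - 1)) =
    (if l < N then - (c i j (n1 + int l) * p powi (- tri (int l - 1)))
     else s * (\<Sum>b<m2. fps_nth (f i b) (l - N) * C2 $$ (b, j)))"
  proof (cases "l < N")
    case False
    define h where "h = l - N"
    have l: "l = h + N" using False by (simp add: h_def)
    \<comment> \<open>\<open>N * h - tri (h + N - 1) = - tri (N - 1) - tri (h - 1)\<close>: the mixed term of the quadratic
      \<open>tri\<close> cancels the exponent \<open>N * h\<close> of \<open>q ^ h = p ^ (N * h)\<close>.\<close>
    have "tri (int h - 1 + int N) = tri (int h - 1) + (int h - 1) * int N + tri (int N)"
      by (rule tri_add)
    moreover have "tri (int N - 1) = tri (int N) - int N" by (rule tri_pred)
    ultimately have "int (N * h) + (- tri (int l - 1)) = - tri (int N - 1) + (- tri (int h - 1))"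
      unfolding l by (simp add: algebra_simps)
    then have "p powi (int (N * h)) * p powi (- tri (int l - 1)) = s * p powi (- tri (int h - 1))"
      unfolding s_def using p0 by (simp only: power_int_add[symmetric] simp_thms)
    then have *: "exp lq ^ h * p powi (- tri (int l - 1)) = s * p powi (- tri (int h - 1))"
      unfolding q[symmetric] by (simp only: power_int_of_nat power_mult)
    have "exp lq ^ h * (\<Sum>b<m2. fps_nth (X $$ (i, b)) h * C2 $$ (b, j)) * p powi (- tri (int l - 1)) =
        (exp lq ^ h * p powi (- tri (int l - 1))) * (\<Sum>b<m2. fps_nth (X $$ (i, b)) h * C2 $$ (b, j))"
      by (simp only: mult_ac)
    also have "\<dots> = s * (\<Sum>b<m2. fps_nth (f i b) h * C2 $$ (b, j))"
      unfolding * fn by (simp add: sum_distrib_left mult_ac)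
    finally show ?thesis using False by (simp add: h_def)
  qed simp
  finally show ?thesis unfolding s_def .
qed

text \<open>
  The relation holds near \<open>0\<close> because the two sides have the same power series, and it propagates by the
  identity theorem on the connected set \<open>- P\<close>.
\<close>
lemma fps_equation_continues:
  fixes f h :: "nat \<Rightarrow> complex fps" and g k :: "nat \<Rightarrow> complex \<Rightarrow> complex"
  assumes P: "finite P" "0 \<notin> P" and z: "z \<notin> P"
    and g: "\<And>a. a < m1 \<Longrightarrow> g a has_fps_expansion f a" "\<And>a. a < m1 \<Longrightarrow> g a holomorphic_on - P"
    and k: "\<And>b. b < m2 \<Longrightarrow> k b has_fps_expansion h b" "\<And>b. b < m2 \<Longrightarrow> k b holomorphic_on - P"
    and coeff: "\<And>l. (\<Sum>a<m1. \<alpha> a * fps_nth (f a) l) =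
       (if l < N then - w l else s * (\<Sum>b<m2. fps_nth (h b) (l - N) * \<beta> b))"
  shows "(\<Sum>a<m1. \<alpha> a * g a z) + (\<Sum>l<N. w l * z ^ l) = s * z ^ N * (\<Sum>b<m2. k b z * \<beta> b)"
proof -
  define F where "F = (\<Sum>a<m1. fps_const (\<alpha> a) * f a) + (\<Sum>l<N. fps_const (w l) * fps_X ^ l) -
      fps_const s * fps_X ^ N * (\<Sum>b<m2. h b * fps_const (\<beta> b))"
  define e where "e = (\<lambda>z. (\<Sum>a<m1. \<alpha> a * g a z) + (\<Sum>l<N. w l * z ^ l) - s * z ^ N * (\<Sum>b<m2. k b z * \<beta> b))"
  have "(\<lambda>z. \<Sum>a<m1. \<alpha> a * g a z) has_fps_expansion (\<Sum>a<m1. fps_const (\<alpha> a) * f a)"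
    by (intro has_fps_expansion_sum has_fps_expansion_cmult_left g(1)) auto
  moreover have "(\<lambda>z. \<Sum>l<N. w l * z ^ l) has_fps_expansion (\<Sum>l<N. fps_const (w l) * fps_X ^ l)"
    by (intro has_fps_expansion_sum has_fps_expansion_cmult_left has_fps_expansion_fps_X_power)
  moreover have "(\<lambda>z. \<Sum>b<m2. k b z * \<beta> b) has_fps_expansion (\<Sum>b<m2. h b * fps_const (\<beta> b))"
    by (intro has_fps_expansion_sum has_fps_expansion_cmult_right k(1)) auto
  ultimately have eF: "e has_fps_expansion F"
    unfolding e_def F_def
    by (intro has_fps_expansion_diff has_fps_expansion_add has_fps_expansion_mult
        has_fps_expansion_const has_fps_expansion_fps_X_power)
  have "F = 0"
  proof (rule fps_ext)
    fix l
    have poly: "fps_nth (\<Sum>l<N. fps_const (w l) * fps_X ^ l) l = (if l < N then w l else 0)"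
      by (simp add: fps_sum_nth fps_X_power_iff if_distrib[of "\<lambda>x. _ * x"] cong: if_cong)
    have left: "fps_nth (\<Sum>a<m1. fps_const (\<alpha> a) * f a) l = (\<Sum>a<m1. \<alpha> a * fps_nth (f a) l)"
      by (simp add: fps_sum_nth)
    have right: "fps_nth (fps_const s * fps_X ^ N * (\<Sum>b<m2. h b * fps_const (\<beta> b))) l =
        (if l < N then 0 else s * (\<Sum>b<m2. fps_nth (h b) (l - N) * \<beta> b))"
      by (simp add: mult.assoc fps_X_power_mult_nth fps_sum_nth)
    show "fps_nth F l = fps_nth 0 l"
      unfolding F_def fps_sub_nth fps_add_nth left right poly coeff by simp
  qed
  then have "eventually (\<lambda>z. e z = 0) (nhds 0)"
    using eF by (auto simp: has_fps_expansion_def elim: eventually_mono)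
  then have "eventually (\<lambda>z. e z = 0) (at 0)"
    unfolding eventually_at_filter by eventually_elim auto
  moreover have "eventually (\<lambda>z. z \<in> - P) (at 0)"
    using P by (intro eventually_at_in_open') (auto simp: open_Compl finite_imp_closed)
  ultimately have ev: "eventually (\<lambda>z. z \<in> - P \<and> e z = 0) (at 0)" by eventually_elim auto
  have "e z = 0"
  proof (rule analytic_continuation[of e "- P" "{z \<in> - P. e z = 0}" 0])
    show "e holomorphic_on - P"
      unfolding e_def by (intro holomorphic_intros g(2) k(2)) auto
    show "open (- P)" using P by (simp add: open_Compl finite_imp_closed)
    show "connected (- P)"
      using connected_open_delete_finite[of "UNIV :: complex set" P] P
      by (simp add: Compl_eq_Diff_UNIV convex_connected)
    show "0 islimpt {z \<in> - P. e z = 0}"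
      unfolding islimpt_conv_frequently_at using eventually_frequently[OF _ ev] by simp
  qed (use P z in auto)
  then show ?thesis by (simp add: e_def)
qed

text \<open>
  Removing the removable singularities of the theta quotients gives representatives that are nicely
  meromorphic. As this may change values at a discrete set of points, the equation is stated in punctured neighbourhoods.
\<close>
lemma theta_quotient_solution:
  fixes a :: "nat \<Rightarrow> nat \<Rightarrow> int \<Rightarrow> complex"
  assumes p: "1 < cmod p" and lam: "lam \<noteq> 0"
    and a: "\<And>i j. i < m1 \<Longrightarrow> j < m2 \<Longrightarrow> bounded (range (a i j))"
    and eq: "\<And>i j k. i < m1 \<Longrightarrow> j < m2 \<Longrightarrow>
       (\<Sum>b<m1. C1 $$ (i, b) * a b j k) + (\<Sum>\<nu><N. v i j \<nu> * p powi (- tri (int \<nu> - 1)) * (lam * p powi k) ^ \<nu>) =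
       p powi (- tri (int N - 1)) * (lam * p powi k) ^ N * (\<Sum>b<m2. a i b k * C2 $$ (b, j))"
  obtains X where "\<And>z. X z \<in> carrier_mat m1 m2" "X 0 = 0\<^sub>m m1 m2"
    "\<And>i j z. i < m1 \<Longrightarrow> j < m2 \<Longrightarrow> z \<noteq> 0 \<Longrightarrow>
       eventually (\<lambda>w. X w $$ (i, j) = theta_quotient p lam (a i j) w) (at z)"
    "simple_pole_solution p N lam m1 m2 C1 C2 (\<lambda>i j z. \<Sum>l<N. v i j l * z ^ l) X"
proof -
  have p0: "p \<noteq> 0" using p by auto
  define Y where "Y = (\<lambda>i j. theta_quotient p lam (a i j))"
  have Ymero: "Y i j meromorphic_on - {0}" if "i < m1" "j < m2" for i j
    unfolding Y_def by (rule theta_quotient_meromorphic[OF p lam a[OF that]])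
  have Yeq: "(\<Sum>a<m1. C1 $$ (i, a) * Y a j z) + (\<Sum>l<N. v i j l * z ^ l) =
      z ^ N * (\<Sum>b<m2. Y i b (p ^ N * z) * C2 $$ (b, j))"
    if ij: "i < m1" "j < m2" and z: "z \<noteq> 0" "Theta p (z / lam) \<noteq> 0" for i j z
    unfolding Y_def by (rule theta_quotient_equation[OF p lam z _ _ eq[OF ij]]) (use a ij in auto)
  define X0 where "X0 = (\<lambda>z. mat m1 m2 (\<lambda>(i, j). if z = 0 then 0 else remove_sings (Y i j) z))"
  have X0c: "X0 z \<in> carrier_mat m1 m2" for z by (simp add: X0_def)
  have X0ij: "X0 z $$ (i, j) = (if z = 0 then 0 else remove_sings (Y i j) z)" if "i < m1" "j < m2" for z i j
    using that by (simp add: X0_def)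
  have opn: "open (- {0::complex})" by (simp add: open_Compl)
  have evnz: "eventually (\<lambda>w. w \<noteq> 0) (at z)" if "z \<noteq> 0" for z :: complex
    using eventually_at_in_open'[OF opn, of z] that by simp
  have iso: "isolated_singularity_at (Y i j) z" if "i < m1" "j < m2" "z \<noteq> 0" for i j z
    using Ymero[OF that(1,2)] that(3) by (meson ComplI empty_iff insert_iff meromorphic_onE)
  have X0Y: "eventually (\<lambda>w. X0 w $$ (i, j) = Y i j w) (at z)" if "i < m1" "j < m2" "z \<noteq> 0" for i j z
    using eventually_remove_sings_eq_at[OF iso[OF that]] evnz[OF that(3)]
    by eventually_elim (simp add: X0ij that)
  have X0nice: "(\<lambda>z. X0 z $$ (i, j)) nicely_meromorphic_on - {0}" if ij: "i < m1" "j < m2" for i j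
  proof -
    have nice: "remove_sings (Y i j) nicely_meromorphic_on - {0}"
      by (rule remove_sings_nicely_meromorphic[OF Ymero[OF ij]])
    have eq: "eventually (\<lambda>w. X0 w $$ (i, j) = remove_sings (Y i j) w) (at z)" if "z \<noteq> 0" for z
      using evnz[OF that] by eventually_elim (simp add: X0ij ij)
    have "(\<lambda>z. X0 z $$ (i, j)) meromorphic_on - {0} \<longleftrightarrow> remove_sings (Y i j) meromorphic_on - {0}"
      by (rule meromorphic_on_cong) (use eq in auto)
    moreover have "is_pole (\<lambda>z. X0 z $$ (i, j)) z \<longleftrightarrow> is_pole (remove_sings (Y i j)) z" if "z \<noteq> 0" for z
      by (rule is_pole_cong[OF eq[OF that] refl])
    moreover have "((\<lambda>z. X0 z $$ (i, j)) \<longlongrightarrow> l) (at z) \<longleftrightarrow> (remove_sings (Y i j) \<longlongrightarrow> l) (at z)" if "z \<noteq> 0" for z l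
      by (rule tendsto_cong[OF eq[OF that]])
    ultimately show ?thesis
      using nice ij by (auto simp: nicely_meromorphic_on_def X0ij)
  qed
  have X0pole: "zorder (\<lambda>w. X0 w $$ (i, j)) z = - 1 \<and> (\<exists>k::int. z = - lam * p powi k)"
    if ij: "i < m1" "j < m2" and z: "z \<noteq> 0" and pole: "is_pole (\<lambda>w. X0 w $$ (i, j)) z" for i j z
  proof -
    note ev = X0Y[OF ij z]
    have "is_pole (Y i j) z" using is_pole_cong[OF ev refl] pole by simp
    then have "(\<exists>k::int. z = - lam * p powi k) \<and> zorder (Y i j) z = - 1"
      unfolding Y_def by (rule theta_quotient_pole[OF p lam a[OF ij] z])
    moreover have "zorder (\<lambda>w. X0 w $$ (i, j)) z = zorder (Y i j) z" by (rule zorder_cong[OF ev refl])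
    ultimately show ?thesis by simp
  qed
  define q where "q = p ^ N"
  have q0: "q \<noteq> 0" using p0 by (simp add: q_def)
  have X0eq: "eventually (\<lambda>z. (\<Sum>a<m1. C1 $$ (i, a) * X0 z $$ (a, j)) + (\<Sum>l<N. v i j l * z ^ l) =
          z ^ N * (\<Sum>b<m2. X0 (q * z) $$ (i, b) * C2 $$ (b, j))) (at z)"
    if ij: "i < m1" "j < m2" and z: "z \<noteq> 0" for i j z
  proof -
    have all: "eventually (\<lambda>w. \<forall>a\<in>{..<m1}. \<forall>b\<in>{..<m2}. X0 w $$ (a, b) = Y a b w) (at x)" if "x \<noteq> 0" for x
      by (intro eventually_ball_finite ballI) (use X0Y that in auto)
    have "q * z \<noteq> 0" using q0 z by simp
    from eventually_at_scaled[OF q0 all[OF this]] all[OF z] eventually_Theta_scaled_nonzero[OF p lam z] evnz[OF z]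
    show ?thesis
    proof eventually_elim
      case (elim w)
      have "(\<Sum>a<m1. C1 $$ (i, a) * X0 w $$ (a, j)) = (\<Sum>a<m1. C1 $$ (i, a) * Y a j w)"
        using elim(2) ij by (intro sum.cong) auto
      moreover have "(\<Sum>b<m2. X0 (q * w) $$ (i, b) * C2 $$ (b, j)) = (\<Sum>b<m2. Y i b (q * w) * C2 $$ (b, j))"
        using elim(1) ij by (intro sum.cong) auto
      ultimately show ?case using Yeq[OF ij elim(4,3)] by (simp only: q_def)
    qed
  qed
  have X00: "X0 0 = 0\<^sub>m m1 m2" by (rule eq_matI) (simp_all add: X0_def)
  have "simple_pole_solution p N lam m1 m2 C1 C2 (\<lambda>i j z. \<Sum>l<N. v i j l * z ^ l) X0"
    unfolding simple_pole_solution_def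
  proof (intro conjI allI impI)
    fix i j assume ij: "i < m1" "j < m2"
    show "(\<lambda>z. X0 z $$ (i, j)) nicely_meromorphic_on - {0}" by (rule X0nice[OF ij])
    show "\<exists>r>0. \<forall>z. z \<noteq> 0 \<longrightarrow> cmod z < r \<longrightarrow> is_pole (\<lambda>w. X0 w $$ (i, j)) z \<longrightarrow>
          zorder (\<lambda>w. X0 w $$ (i, j)) z = - 1 \<and> (\<exists>k::int. z = - lam * p powi k)"
      by (rule exI[of _ 1]) (use X0pole[OF ij] in auto)
    fix z :: complex assume "z \<noteq> 0"
    from X0eq[OF ij this]
    show "eventually (\<lambda>z. (\<Sum>a<m1. C1 $$ (i, a) * X0 z $$ (a, j)) + (\<Sum>l<N. v i j l * z ^ l) =
          z ^ N * (\<Sum>b<m2. X0 (p ^ N * z) $$ (i, b) * C2 $$ (b, j))) (at z)"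
      unfolding q_def .
  qed
  with X0c X00 X0Y show ?thesis unfolding Y_def by (rule that)
qed

lemma is_H_lam_iff:
  fixes lq lam :: complex and U :: "complex fls mat" and c :: "nat \<Rightarrow> nat \<Rightarrow> int \<Rightarrow> complex"
  assumes C1: "C1 \<in> carrier_mat m1 m1" and C2: "C2 \<in> carrier_mat m2 m2"
    and U: "U \<in> carrier_mat m1 m2" and n: "n1 < n2"
    and Uc: "\<And>i j. i < m1 \<Longrightarrow> j < m2 \<Longrightarrow> U $$ (i, j) = (\<Sum>\<nu>=n1..n2-1. fls_const (c i j \<nu>) * fls_X_intpow \<nu>)"
  defines "N \<equiv> nat (n2 - n1)"
  defines "p \<equiv> qpow lq (1 / of_nat N)"
  shows "is_H_lam lq n1 n2 m1 m2 C1 C2 U lam H \<longleftrightarrow>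
      (\<exists>X. (\<forall>z. X z \<in> carrier_mat m1 m2) \<and> H = (\<lambda>z. unip_mat m1 m2 (X z)) \<and> X 0 = 0\<^sub>m m1 m2 \<and>
         simple_pole_solution p N lam m1 m2 C1 C2 (\<lambda>i j z. \<Sum>l<N. c i j (n1 + int l) * z ^ l) X)"
proof -
  have N: "N > 0" using n by (simp add: N_def)
  have q: "p ^ N = exp lq" unfolding p_def by (rule qpow_root_power[OF N])
  have opn: "open (- {0::complex})" by (simp add: open_Compl)
  have evnz: "eventually (\<lambda>w. w \<noteq> 0) (at z)" if "z \<noteq> 0" for z :: complex
    using eventually_at_in_open'[OF opn, of z] that by simp
  have orbit_iff: "z \<in> (\<lambda>l. - lam * qpow lq l) ` inv_ints N \<longleftrightarrow> (\<exists>k::int. z = - lam * p powi k)" for z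
    by (auto simp: inv_ints_def qpow_root_powi[OF N] p_def image_iff)
  have eqn: "(\<forall>\<^sub>\<approx>z\<in>- {0}. eval_mat (D_mat n1 n2 C1 C2 U) z * unip_mat m1 m2 (X z) =
       unip_mat m1 m2 (X (exp lq * z)) * eval_mat (Diag_mat n1 n2 C1 C2) z) \<longleftrightarrow>
     (\<forall>i<m1. \<forall>j<m2. \<forall>z\<noteq>0. eventually (\<lambda>z. (\<Sum>a<m1. C1 $$ (i, a) * X z $$ (a, j)) + (\<Sum>l<N. c i j (n1 + int l) * z ^ l) =
        z ^ N * (\<Sum>b<m2. X (p ^ N * z) $$ (i, b) * C2 $$ (b, j))) (at z))"
    if X: "\<And>z. X z \<in> carrier_mat m1 m2" for X :: "complex \<Rightarrow> complex mat"
  proof -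
    let ?E = "\<lambda>i j z. (\<Sum>a<m1. C1 $$ (i, a) * X z $$ (a, j)) + (\<Sum>l<N. c i j (n1 + int l) * z ^ l) =
        z ^ N * (\<Sum>b<m2. X (p ^ N * z) $$ (i, b) * C2 $$ (b, j))"
    let ?M = "\<lambda>z. eval_mat (D_mat n1 n2 C1 C2 U) z * unip_mat m1 m2 (X z) =
       unip_mat m1 m2 (X (exp lq * z)) * eval_mat (Diag_mat n1 n2 C1 C2) z"
    have M: "?M z \<longleftrightarrow> (\<forall>i\<in>{..<m1}. \<forall>j\<in>{..<m2}. ?E i j z)" if "z \<noteq> 0" for z
      using eval_mat_equation_iff[OF C1 C2 U n that Uc X[of z] X[of "exp lq * z"]]
      by (simp add: N_def[symmetric] q Ball_def)
    have "eventually ?M (at z) \<longleftrightarrow> (\<forall>i\<in>{..<m1}. \<forall>j\<in>{..<m2}. eventually (?E i j) (at z))" if "z \<noteq> 0" for z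
    proof -
      have "eventually ?M (at z) \<longleftrightarrow> eventually (\<lambda>z. \<forall>i\<in>{..<m1}. \<forall>j\<in>{..<m2}. ?E i j z) (at z)"
        by (rule eventually_subst, rule eventually_mono[OF evnz[OF that]], rule M)
      also have "\<dots> \<longleftrightarrow> (\<forall>i\<in>{..<m1}. \<forall>j\<in>{..<m2}. eventually (?E i j) (at z))"
        by (simp add: eventually_ball_finite_distrib)
      finally show ?thesis .
    qed
    then show ?thesis by (auto simp: eventually_cosparse_open_eq opn)
  qed
  have polesn: "(\<exists>r>0. \<forall>z\<in>ball 0 r - {0}. is_pole (\<lambda>w. X w $$ (i, j)) z \<longrightarrow>
           zorder (\<lambda>w. X w $$ (i, j)) z = -1 \<and> z \<in> (\<lambda>l. - lam * qpow lq l) ` inv_ints (nat (n2 - n1))) \<longleftrightarrow>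
      (\<exists>r>0. \<forall>z. z \<noteq> 0 \<longrightarrow> cmod z < r \<longrightarrow> is_pole (\<lambda>w. X w $$ (i, j)) z \<longrightarrow>
        zorder (\<lambda>w. X w $$ (i, j)) z = - 1 \<and> (\<exists>k::int. z = - lam * p powi k))"
    for X :: "complex \<Rightarrow> complex mat" and i j
    unfolding N_def[symmetric] orbit_iff by (auto simp: Ball_def)
  show ?thesis
    unfolding is_H_lam_def simple_pole_solution_def polesn using eqn by (auto cong: conj_cong)
qed

theorem theorem2p5:
  fixes q lq lam :: complex
    and n1 n2 :: int
    and m1 m2 :: nat
    and C1 C2 :: "complex mat"
    and U12 :: "complex fls mat"
    and H12 :: "complex fps mat"
  assumes "cmod q > 1" and "exp lq = q"
    and "n1 < n2" and "m1 > 0" and "m2 > 0"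
    and "C1 \<in> carrier_mat m1 m1" and "invertible_mat C1"
    and "C2 \<in> carrier_mat m2 m2" and "invertible_mat C2"
    and "U12 \<in> carrier_mat m1 m2"
    and "\<forall>i<m1. \<forall>j<m2. \<exists>c :: int \<Rightarrow> complex.
           U12 $$ (i, j) = (\<Sum>\<nu>=n1..n2-1. fls_const (c \<nu>) * fls_X_intpow \<nu>)"
    and "H12 \<in> carrier_mat m1 m2"
    and "formal_gauge q (D_mat n1 n2 C1 C2 U12) (Diag_mat n1 n2 C1 C2) (unip_mat m1 m2 H12)"
    and "lam \<noteq> 0" and "lam \<notin> Sigma_set lq n1 n2 C1 C2"
  shows
    "(\<forall>i<m1. \<forall>j<m2.
        fps_conv_radius (q_borel lq (of_int (n2 - n1)) (H12 $$ (i, j))) > 0 \<and>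
        eval_fps (q_borel lq (of_int (n2 - n1)) (H12 $$ (i, j)))
          \<in> qH lq (of_int (n2 - n1)) (nat (n2 - n1)) lam) \<and>
     (\<exists>!H. is_H_lam lq n1 n2 m1 m2 C1 C2 U12 lam H) \<and>
     (\<exists>r>0. \<forall>\<^sub>\<approx>z\<in>ball 0 r - {0}.
        S_q lq n1 n2 m1 m2 lam H12 z = H_lam lq n1 n2 m1 m2 C1 C2 U12 lam z)"
proof -
  define N where "N = nat (n2 - n1)"
  define d where "d = n2 - n1"
  define p where "p = qpow lq (1 / of_nat N)"
  define s where "s = p powi (- tri (int N - 1))"
  have d: "d > 0" and N: "N > 0" and dN: "nat d = N" using assms(3) by (auto simp: d_def N_def)
  have lq: "1 < cmod (exp lq)" using assms(1,2) by simp
  have p: "1 < cmod p" unfolding p_def by (rule norm_qpow_root[OF N lq])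
  then have p0: "p \<noteq> 0" by auto
  have s: "s \<noteq> 0" using p0 by (simp add: s_def)
  note C1 = assms(6) and C2 = assms(8) and U = assms(10) and X = assms(12) and lam = assms(14)
  have sp1: "0 \<notin> spectrum C1" by (rule invertible_mat_zero_notin_spectrum[OF C1 assms(7)])
  have sp2: "0 \<notin> spectrum C2" by (rule invertible_mat_zero_notin_spectrum[OF C2 assms(9)])
  have nonres: "\<alpha>1 \<noteq> s * \<alpha>2 * (lam * p powi k) ^ N"
    if "\<alpha>1 \<in> spectrum C1" "\<alpha>2 \<in> spectrum C2" for \<alpha>1 \<alpha>2 k
    unfolding s_def p_def N_def
    by (rule not_Sigma_imp_nonresonant[OF lam assms(15,3) that]) (use that sp2 in auto)
  have "\<exists>c. \<forall>i<m1. \<forall>j<m2. U12 $$ (i, j) = (\<Sum>\<nu>=n1..n2-1. fls_const (c i j \<nu>) * fls_X_intpow \<nu>)"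
  proof (intro exI allI impI)
    fix i j assume "i < m1" "j < m2"
    with assms(11) have "\<exists>c. U12 $$ (i, j) = (\<Sum>\<nu>=n1..n2-1. fls_const (c \<nu>) * fls_X_intpow \<nu>)" by blast
    then show "U12 $$ (i, j) = (\<Sum>\<nu>=n1..n2-1. fls_const ((\<lambda>i j. SOME c. U12 $$ (i, j) =
        (\<Sum>\<nu>=n1..n2-1. fls_const (c \<nu>) * fls_X_intpow \<nu>)) i j \<nu>) * fls_X_intpow \<nu>)"
      by (rule someI_ex)
  qed
  then obtain c where c: "\<And>i j. i < m1 \<Longrightarrow> j < m2 \<Longrightarrow>
      U12 $$ (i, j) = (\<Sum>\<nu>=n1..n2-1. fls_const (c i j \<nu>) * fls_X_intpow \<nu>)" by blast
  define f where "f = (\<lambda>i j. q_borel lq (of_int d) (H12 $$ (i, j)))"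
  define B where "B = (\<lambda>l. mat m1 m2 (\<lambda>(i, j). fps_nth (f i j) l))"
  define w where "w = (\<lambda>i j (l::nat). c i j (n1 + int l) * p powi (- tri (int l - 1)))"
  define W where "W = (\<lambda>l::nat. mat m1 m2 (\<lambda>(i, j). w i j l))"
  have B: "B l \<in> carrier_mat m1 m2" and W: "W l \<in> carrier_mat m1 m2" for l
    by (auto simp: B_def W_def)
  have gauge: "formal_gauge (exp lq) (D_mat n1 n2 C1 C2 U12) (Diag_mat n1 n2 C1 C2) (unip_mat m1 m2 H12)"
    using assms(13) unfolding assms(2) .
  have coeff: "(\<Sum>a<m1. C1 $$ (i, a) * fps_nth (f a j) l) =
      (if l < N then - w i j l else s * (\<Sum>b<m2. fps_nth (f i b) (l - N) * C2 $$ (b, j)))"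
    if ij: "i < m1" "j < m2" for i j l
    unfolding s_def w_def p_def N_def f_def d_def by (rule q_borel_gauge_coeff[OF C1 C2 U X assms(3) c gauge ij])
  have Beq: "C1 * B l = (if l < N then - W l else s \<cdot>\<^sub>m (B (l - N) * C2))" for l
  proof (rule eq_matI)
    have CB: "C1 * B l \<in> carrier_mat m1 m2" by (rule mult_carrier_mat[OF C1 B])
    have BC: "B (l - N) * C2 \<in> carrier_mat m1 m2" by (rule mult_carrier_mat[OF B C2])
    have rhs: "(if l < N then - W l else s \<cdot>\<^sub>m (B (l - N) * C2)) \<in> carrier_mat m1 m2"
    proof (cases "l < N")
      case True
      then show ?thesis using W[of l] by simp
    next
      case False
      then show ?thesis using BC by (simp only: if_False smult_carrier_mat)
    qed
    show "dim_row (C1 * B l) = dim_row (if l < N then - W l else s \<cdot>\<^sub>m (B (l - N) * C2))"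
      "dim_col (C1 * B l) = dim_col (if l < N then - W l else s \<cdot>\<^sub>m (B (l - N) * C2))"
      using carrier_matD[OF CB] carrier_matD[OF rhs] by (simp_all only:)
    fix i j assume "i < dim_row (if l < N then - W l else s \<cdot>\<^sub>m (B (l - N) * C2))"
      "j < dim_col (if l < N then - W l else s \<cdot>\<^sub>m (B (l - N) * C2))"
    then have ij: "i < m1" "j < m2" using carrier_matD[OF rhs] by (simp_all only:)
    have l: "(C1 * B l) $$ (i, j) = (\<Sum>a<m1. C1 $$ (i, a) * fps_nth (f a j) l)"
      using index_mult_mat_sum[OF C1 B ij] ij by (simp add: B_def del: index_mult_mat(1))
    have r: "(B (l - N) * C2) $$ (i, j) = (\<Sum>b<m2. fps_nth (f i b) (l - N) * C2 $$ (b, j))"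
      using index_mult_mat_sum[OF B C2 ij] ij by (simp add: B_def del: index_mult_mat(1))
    show "(C1 * B l) $$ (i, j) = (if l < N then - W l else s \<cdot>\<^sub>m (B (l - N) * C2)) $$ (i, j)"
    proof (cases "l < N")
      case True
      then show ?thesis unfolding l coeff[OF ij] using ij by (simp add: W_def)
    next
      case False
      have "(s \<cdot>\<^sub>m (B (l - N) * C2)) $$ (i, j) = s * (B (l - N) * C2) $$ (i, j)"
        by (rule index_smult_mat(1)) (use ij BC in auto)
      then show ?thesis using False unfolding l coeff[OF ij] by (simp only: r if_False)
    qed
  qed
  obtain P \<delta> g where P: "finite P" "0 \<notin> P" "\<And>k::int. lam * p powi k \<notin> P" and \<delta>: "\<delta> > 0"
    "connected (- (\<Union>x\<in>P. cball x \<delta>))"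
    "\<And>k z. cmod (z - lam * p powi k) < \<delta> * cmod (lam * p powi k) \<Longrightarrow> z \<in> - (\<Union>x\<in>P. cball x \<delta>)"
    and g: "\<And>i j. i < m1 \<Longrightarrow> j < m2 \<Longrightarrow>
       bounded_continuation P (- (\<Union>x\<in>P. cball x \<delta>)) (Abs_fps (\<lambda>l. B l $$ (i, j))) (g i j)"
    using borel_continuation[OF p N s lam C1 sp1 C2 sp2 B W Beq nonres] by blast
  have fB: "Abs_fps (\<lambda>l. B l $$ (i, j)) = f i j" if "i < m1" "j < m2" for i j
    using that by (intro fps_ext) (simp add: B_def)
  have gf: "bounded_continuation P (- (\<Union>x\<in>P. cball x \<delta>)) (f i j) (g i j)" if "i < m1" "j < m2" for i j
    using g[OF that] unfolding fB[OF that] .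
  have gexp: "g i j has_fps_expansion f i j" and ghol: "g i j holomorphic_on - P"
    and gbdd: "bounded (g i j ` (- (\<Union>x\<in>P. cball x \<delta>)))" if "i < m1" "j < m2" for i j
    using gf[OF that] by (auto simp: bounded_continuation_def)
  have cont: "qH_continuation lq (of_int d) (nat d) lam (eval_fps (f i j)) (g i j)" if "i < m1" "j < m2" for i j
    by (rule qH_continuation_exists[OF lq d \<delta>(1) P(1) \<delta>(2) _ gf[OF that]]) (use \<delta>(3) in \<open>simp add: dN p_def\<close>)
  have part1: "fps_conv_radius (f i j) > 0 \<and> eval_fps (f i j) \<in> qH lq (of_int d) (nat d) lam"
    if ij: "i < m1" "j < m2" for i j
  proof
    show R: "fps_conv_radius (f i j) > 0" using gexp[OF ij] by (simp add: has_fps_expansion_def)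
    obtain r where r: "0 < ereal r" "ereal r < fps_conv_radius (f i j)" using ereal_dense2[OF R] by auto
    have "eval_fps (f i j) holomorphic_on ball 0 r"
    proof (rule holomorphic_on_eval_fps, rule subsetI)
      fix z :: complex assume "z \<in> ball 0 r"
      then have "ereal (norm z) < ereal r" by simp
      then have "ereal (norm z) < fps_conv_radius (f i j)" using r(2) by (rule less_trans)
      then show "z \<in> eball 0 (fps_conv_radius (f i j))" by simp
    qed
    then have "eval_fps (f i j) meromorphic_on ball 0 r"
      by (intro analytic_on_imp_meromorphic_on) (simp add: analytic_on_open)
    then have "eval_fps (f i j) meromorphic_on ball 0 r - {0}"
      by (rule meromorphic_on_subset) auto
    then have "meromorphic_near_0 (eval_fps (f i j))"
      unfolding meromorphic_near_0_def using r(1) by auto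
    then show "eval_fps (f i j) \<in> qH lq (of_int d) (nat d) lam"
      unfolding qH_def using cont[OF ij] by blast
  qed
  \<comment> \<open>The values that the Laplace sum takes as input; they lie in the region where \<open>g\<close> is bounded.\<close>
  define a where "a = (\<lambda>i j (k::int). g i j (lam * p powi k))"
  have abdd: "bounded (range (a i j))" if ij: "i < m1" "j < m2" for i j
  proof -
    have "lam * p powi k \<in> - (\<Union>x\<in>P. cball x \<delta>)" for k
      using \<delta>(1) lam p0 by (intro \<delta>(3)[of _ k]) simp
    then have "range (a i j) \<subseteq> g i j ` (- (\<Union>x\<in>P. cball x \<delta>))" by (auto simp: a_def)
    with gbdd[OF ij] show ?thesis by (rule bounded_subset)
  qed
  have geq: "(\<Sum>b<m1. C1 $$ (i, b) * a b j k) + (\<Sum>l<N. w i j l * (lam * p powi k) ^ l) =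
      s * (lam * p powi k) ^ N * (\<Sum>b<m2. a i b k * C2 $$ (b, j))" if ij: "i < m1" "j < m2" for i j k
    unfolding a_def
    by (rule fps_equation_continues[OF P(1,2,3) _ _ _ _ coeff[OF ij]]) (use gexp ghol ij in auto)
  obtain X0 where X0c: "\<And>z. X0 z \<in> carrier_mat m1 m2" and X00: "X0 0 = 0\<^sub>m m1 m2"
    and X0Y: "\<And>i j z. i < m1 \<Longrightarrow> j < m2 \<Longrightarrow> z \<noteq> 0 \<Longrightarrow>
       eventually (\<lambda>w. X0 w $$ (i, j) = theta_quotient p lam (a i j) w) (at z)"
    and X0sol: "simple_pole_solution p N lam m1 m2 C1 C2 (\<lambda>i j z. \<Sum>l<N. c i j (n1 + int l) * z ^ l) X0"
    using theta_quotient_solution[OF p lam abdd geq[unfolded w_def s_def]] by blast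
  \<comment> \<open>Existence and uniqueness of the analytic gauge transformation reduce to its upper right block.\<close>
  have is_H_iff: "is_H_lam lq n1 n2 m1 m2 C1 C2 U12 lam H \<longleftrightarrow>
      (\<exists>X. (\<forall>z. X z \<in> carrier_mat m1 m2) \<and> H = (\<lambda>z. unip_mat m1 m2 (X z)) \<and>
         X 0 = 0\<^sub>m m1 m2 \<and>
         simple_pole_solution p N lam m1 m2 C1 C2 (\<lambda>i j z. \<Sum>l<N. c i j (n1 + int l) * z ^ l) X)" for H
    unfolding p_def N_def by (rule is_H_lam_iff[OF C1 C2 U assms(3) c])
  have H0: "is_H_lam lq n1 n2 m1 m2 C1 C2 U12 lam (\<lambda>z. unip_mat m1 m2 (X0 z))"
    unfolding is_H_iff
    by (intro exI[of _ X0] conjI allI X0c refl X0sol X00)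
  have uniq: "H = (\<lambda>z. unip_mat m1 m2 (X0 z))" if "is_H_lam lq n1 n2 m1 m2 C1 C2 U12 lam H" for H
  proof -
    from that obtain X' where "(\<forall>z. X' z \<in> carrier_mat m1 m2) \<and> H = (\<lambda>z. unip_mat m1 m2 (X' z)) \<and>
        X' 0 = 0\<^sub>m m1 m2 \<and>
        simple_pole_solution p N lam m1 m2 C1 C2 (\<lambda>i j z. \<Sum>l<N. c i j (n1 + int l) * z ^ l) X'"
      unfolding is_H_iff by (rule exE)
    then have X': "\<And>z. X' z \<in> carrier_mat m1 m2" "H = (\<lambda>z. unip_mat m1 m2 (X' z))"
      "X' 0 = 0\<^sub>m m1 m2" "simple_pole_solution p N lam m1 m2 C1 C2 (\<lambda>i j z. \<Sum>l<N. c i j (n1 + int l) * z ^ l) X'"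
      by simp_all
    have "X' z = X0 z" for z
    proof (cases "z = 0")
      case True
      then show ?thesis using X'(3) X00 by simp
    next
      case False
      show ?thesis
      proof (rule eq_matI)
        fix i j assume "i < dim_row (X0 z)" "j < dim_col (X0 z)"
        then have ij: "i < m1" "j < m2" using carrier_matD[OF X0c[of z]] by simp_all
        show "X' z $$ (i, j) = X0 z $$ (i, j)"
          by (rule simple_pole_solution_unique[OF p N lam C1 sp1 C2 sp2 nonres[unfolded s_def] X'(4) X0sol ij False])
      qed (use X'(1)[of z] X0c[of z] in auto)
    qed
    then show ?thesis using X'(2) by simp
  qed
  have ex1: "\<exists>!H. is_H_lam lq n1 n2 m1 m2 C1 C2 U12 lam H"
    using H0 uniq by blast
  have Hlam: "H_lam lq n1 n2 m1 m2 C1 C2 U12 lam = (\<lambda>z. unip_mat m1 m2 (X0 z))"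
    unfolding H_lam_def by (rule the_equality, rule H0, erule uniq)
  have lap: "q_laplace lq (of_int d) (nat d) lam (eval_fps (f i j)) z = theta_quotient p lam (a i j) z"
    if ij: "i < m1" "j < m2" and z: "z \<noteq> 0" for i j z
    unfolding a_def p_def dN[symmetric]
    by (rule q_laplace_eq_theta_quotient[OF lq d lam P(1) _ gexp[OF ij] ghol[OF ij] cont[OF ij] z])
       (use P(3) in \<open>simp add: dN p_def\<close>)
  have "eventually (\<lambda>z. S_q lq n1 n2 m1 m2 lam H12 z = H_lam lq n1 n2 m1 m2 C1 C2 U12 lam z) (at x)"
    if x: "x \<noteq> 0" for x
  proof -
    have opn: "open (- {0::complex})" by (simp add: open_Compl)
    then have nz: "eventually (\<lambda>w. w \<noteq> 0) (at x)"
      using eventually_at_in_open'[OF opn, of x] x by simp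
    have "eventually (\<lambda>w. \<forall>aa\<in>{..<m1}. \<forall>b\<in>{..<m2}. X0 w $$ (aa, b) = theta_quotient p lam (a aa b) w) (at x)"
      by (intro eventually_ball_finite ballI) (use X0Y x in auto)
    with nz show ?thesis
    proof eventually_elim
      case (elim z)
      have "map_mat (\<lambda>f. q_laplace lq (of_int (n2 - n1)) (nat (n2 - n1)) lam
                       (eval_fps (q_borel lq (of_int (n2 - n1)) f)) z) H12 = X0 z"
      proof (rule eq_matI)
        fix i j assume "i < dim_row (X0 z)" "j < dim_col (X0 z)"
        then have ij: "i < m1" "j < m2" using carrier_matD[OF X0c[of z]] by simp_all
        have "map_mat (\<lambda>f. q_laplace lq (of_int (n2 - n1)) (nat (n2 - n1)) lam
                       (eval_fps (q_borel lq (of_int (n2 - n1)) f)) z) H12 $$ (i, j) =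
            q_laplace lq (of_int (n2 - n1)) (nat (n2 - n1)) lam
                       (eval_fps (q_borel lq (of_int (n2 - n1)) (H12 $$ (i, j)))) z"
          by (rule index_map_mat(1)) (use ij X in auto)
        also have "\<dots> = theta_quotient p lam (a i j) z" using lap[OF ij elim(1)] unfolding f_def d_def .
        also have "\<dots> = X0 z $$ (i, j)" using elim(2) ij by simp
        finally show "map_mat (\<lambda>f. q_laplace lq (of_int (n2 - n1)) (nat (n2 - n1)) lam
                       (eval_fps (q_borel lq (of_int (n2 - n1)) f)) z) H12 $$ (i, j) = X0 z $$ (i, j)" .
      qed (use X X0c[of z] in auto)
      then show ?case by (simp add: S_q_def Hlam)
    qed
  qed
  then have "\<forall>\<^sub>\<approx>z\<in>ball 0 1 - {0}. S_q lq n1 n2 m1 m2 lam H12 z = H_lam lq n1 n2 m1 m2 C1 C2 U12 lam z"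
    by (subst eventually_cosparse_open_eq) (auto intro: open_Diff)
  then have part3: "\<exists>r>0. \<forall>\<^sub>\<approx>z\<in>ball 0 r - {0}.
        S_q lq n1 n2 m1 m2 lam H12 z = H_lam lq n1 n2 m1 m2 C1 C2 U12 lam z"
    by (intro exI[of _ 1]) simp
  show ?thesis
    using part1 ex1 part3 unfolding f_def d_def by blast
qed

end
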